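(* Let $(K,E,\sigma,\phi)$ be an Exel-Pardo self-similar group on a finite graph $E$, and let $(\sigma^*,\phi^* )$ be the extension of $(\sigma,\phi)$ to $E^*$. Let $K\times E^0=\{(k,v)\}$ be the transformation groupoid with $d(k,v)=v$, $c(k,v)=\sigma_k^0(v)$ and unit space $E^0$, and consider the maps $$(k,v)\cdot\mu:=\sigma_k^*(\mu)\quad\text{and}\quad(k,v)|_\mu:=(\phi^*(k,\mu),s(\mu))\qquad\text{for }\mu\in vE^*.$$ Then the first map defines a groupoid action of $K\times E^0$ on $T_E$ by partial isomorphisms. If this groupoid action is faithful, then $(K\times E^0,E)$ is a self-similar groupoid action (with the restriction map given by the second formula). Moreover, if (in addition to the action being faithful) $E$ has no sources, then the algebra $\mathcal{O}(K\times E^0,E)$ is isomorphic to the Exel-Pardo algebra $\mathcal{O}_{K,E}$.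
   Context: Graphs: for a directed graph $E=(E^0,E^1,r,s)$, $E^k$ is the set of paths $\mu=\mu_1\cdots\mu_k$ with $s(\mu_i)=r(\mu_{i+1})$; $r(\mu)=r(\mu_1)$, $s(\mu)=s(\mu_k)$; vertices are paths of length $0$; $E^*=\bigsqcup_{k\ge0}E^k$; $vE^k=\{\mu\in E^k:r(\mu)=v\}$, $vE^*=\bigsqcup_kvE^k$. $T_E$ is the forest with vertex set $E^*$ and edges $\{\mu,\mu e\}$, the disjoint union of the trees $vE^*$. "No sources" means $vE^1\ne\emptyset$ for all $v$. Exel-Pardo data: $(K,E,\sigma,\phi)$ is a self-similar group on a graph if $K$ is a group, $E$ is a graph with no sources, and: (1) $\sigma:K\to\operatorname{Aut}E$ is an action by bijections $\sigma_k^0$ of $E^0$ and $\sigma_k^1$ of $E^1$ with $r\circ\sigma_k^1=\sigma_k^0\circ r$, $s\circ\sigma_k^1=\sigma_k^0\circ s$, $\sigma_k\sigma_l=\sigma_{kl}$; (2) $\phi:K\times E^1\to K$ satisfies $\phi(kl,e)=\phi(k,\sigma_l^1(e))\phi(l,e)$; (3) $\sigma^0_{\phi(k,e)}=\sigma_k^0$ for all $k\in K$, $e\in E^1$. By a result of Exel and Pardo, $(\sigma,\phi)$ extends uniquely to $(\sigma^*,\phi^* )$ with $\sigma^*$ an action of $K$ on $E^*$ and $\phi^*:K\times E^*\to K$ a one-cocycle such that: $\sigma_k^*(E^n)\subset E^n$; $r\circ\sigma_k^*=\sigma_k\circ r$ and $s\circ\sigma_k^*=\sigma_k\circ s$ on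 $E^n$; $\sigma_{\phi^*(k,\mu)}(v)=\sigma_k(v)$ for $v\in E^0$, $\mu\in E^*$; $\sigma_k^*(\mu\nu)=\sigma_k^*(\mu)\sigma^*_{\phi^*(k,\mu)}(\nu)$; $\phi^*(k,\mu\nu)=\phi^*(\phi^*(k,\mu),\nu)$. The algebra $\mathcal{O}_{K,E}$ is the universal unital $C^*$-algebra generated by $\{u_k:k\in K\}$, $\{p_v:v\in E^0\}$, $\{s_e:e\in E^1\}$ such that $(p,s)$ is a Cuntz-Krieger $E$-family (mutually orthogonal projections $p_v$, partial isometries $s_e$ with $s_e^*s_e=p_{s(e)}$ and $p_v=\sum_{e\in vE^1}s_es_e^*$; here $\sum_vp_v=1$), $k\mapsto u_k$ is a unitary representation of $K$, $u_ks_e=s_{\sigma_k^1(e)}u_{\phi(k,e)}$ and $u_kp_v=p_{\sigma_k^0(v)}u_k$. Groupoids: a groupoid is a small category with inverses, with domain and codomain maps $d,c$ to its unit space, product $gh$ defined when $d(g)=c(h)$. In the transformation groupoid, $(k,\sigma_l^0(v))(l,v)=(kl,v)$, and $(1_K,v)$ is the unit at $v$. Self-similar groupoid actions: a partial isomorphism of $T_E$ is a bijection $g:vE^*\to wE^*$ that maps $vE^k$ bijectively onto $wE^k$ for all $k\ge0$ and satisfies $g(\mu e)\in g(\mu)E^1$ for $\mu e\in vE^*$, $e\in E^1$; these form a groupoid $\mathrm{PIso}(E^* )$ with unit space $E^0$ under composition. An action of a groupoid $G$ with unit space $E^0$ is a unit-preserving homomorphism $G\to\mathrm{PIso}(E^*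 )$, written $g\cdot\mu$; it is faithful if injective. $(G,E)$ is a self-similar groupoid action if the action is faithful and for all $g\in G$, $e\in d(g)E^1$ there is $g|_e\in G$ with $g\cdot(e\mu)=(g\cdot e)(g|_e\cdot\mu)$ for all $\mu\in s(e)E^*$. The algebra $\mathcal{O}(G,E)$: it is the universal unital $C^*$-algebra generated by a unitary representation $u$ of the groupoid $G$ (projections $u_v$ for units, partial isometries $u_g$ with initial projection $u_{d(g)}$ and final projection $u_{c(g)}$, $u_gu_h=u_{gh}$ if $d(g)=c(h)$ and $0$ otherwise) and a Cuntz-Krieger $E$-family $(p,s)$ with $u_v=p_v$, $\sum_vp_v=1$, and $u_gs_e=s_{g\cdot e}u_{g|_e}$ if $d(g)=r(e)$, $u_gs_e=0$ otherwise. *)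

theory Defs
  imports
    "HOL-Analysis.Analysis"
    "HOL-Library.Poly_Mapping"
    "HOL-Algebra.QuotRing"
    "HOL-Algebra.Group_Action"
    "Graph_Theory.Digraph"
begin

section \<open>Unital C*-algebras\<close>

text \<open>The zero algebra is allowed, which is why this is not phrased with the type classes for
  normed algebras (these force \<open>norm 1 = 1\<close>).\<close>

record 'a cstar = "'a ring" +
  scale :: "complex \<Rightarrow> 'a \<Rightarrow> 'a"
  star :: "'a \<Rightarrow> 'a"
  nrm :: "'a \<Rightarrow> real"

locale cstar_algebra = ring A for A :: "('a, 'm) cstar_scheme" (structure) +
  assumes scale_closed: "x \<in> carrier A \<Longrightarrow> scale A c x \<in> carrier A"
    and scale_add_right: "\<lbrakk>x \<in> carrier A; y \<in> carrier A\<rbrakk> \<Longrightarrow> scale A c (x \<oplus> y) = scale A c x \<oplus> scale A c y"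
    and scale_add_left: "x \<in> carrier A \<Longrightarrow> scale A (c + d) x = scale A c x \<oplus> scale A d x"
    and scale_scale: "x \<in> carrier A \<Longrightarrow> scale A c (scale A d x) = scale A (c * d) x"
    and scale_one: "x \<in> carrier A \<Longrightarrow> scale A 1 x = x"
    and scale_mult_left: "\<lbrakk>x \<in> carrier A; y \<in> carrier A\<rbrakk> \<Longrightarrow> scale A c x \<otimes> y = scale A c (x \<otimes> y)"
    and scale_mult_right: "\<lbrakk>x \<in> carrier A; y \<in> carrier A\<rbrakk> \<Longrightarrow> x \<otimes> scale A c y = scale A c (x \<otimes> y)"
    and star_closed: "x \<in> carrier A \<Longrightarrow> star A x \<in> carrier A"
    and star_star: "x \<in> carrier A \<Longrightarrow> star A (star A x) = x"
    and star_add: "\<lbrakk>x \<in> carrier A; y \<in> carrier A\<rbrakk> \<Longrightarrow> star A (x \<oplus> y) = star A x \<oplus> star A y"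
    and star_scale: "x \<in> carrier A \<Longrightarrow> star A (scale A c x) = scale A (cnj c) (star A x)"
    and star_mult: "\<lbrakk>x \<in> carrier A; y \<in> carrier A\<rbrakk> \<Longrightarrow> star A (x \<otimes> y) = star A y \<otimes> star A x"
    and nrm_zero_iff: "x \<in> carrier A \<Longrightarrow> nrm A x = 0 \<longleftrightarrow> x = \<zero>"
    and nrm_triangle: "\<lbrakk>x \<in> carrier A; y \<in> carrier A\<rbrakk> \<Longrightarrow> nrm A (x \<oplus> y) \<le> nrm A x + nrm A y"
    and nrm_scale: "x \<in> carrier A \<Longrightarrow> nrm A (scale A c x) = cmod c * nrm A x"
    and nrm_mult: "\<lbrakk>x \<in> carrier A; y \<in> carrier A\<rbrakk> \<Longrightarrow> nrm A (x \<otimes> y) \<le> nrm A x * nrm A y"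
    and nrm_cstar: "x \<in> carrier A \<Longrightarrow> nrm A (star A x \<otimes> x) = (nrm A x)\<^sup>2"
    and complete: "\<lbrakk>\<And>n. z n \<in> carrier A;
        \<And>\<epsilon>. \<epsilon> > 0 \<Longrightarrow> \<exists>M. \<forall>m\<ge>M. \<forall>n\<ge>M. nrm A (z m \<ominus> z n) < \<epsilon>\<rbrakk> \<Longrightarrow>
        \<exists>l\<in>carrier A. (\<lambda>n. nrm A (z n \<ominus> l)) \<longlonglongrightarrow> 0"

text \<open>Unital *-homomorphisms and *-isomorphisms.\<close>

definition cstar_hom :: "('a, 'm) cstar_scheme \<Rightarrow> ('b, 'n) cstar_scheme \<Rightarrow> ('a \<Rightarrow> 'b) set" where
  "cstar_hom A B = {f \<in> ring_hom A B.
     (\<forall>c. \<forall>x\<in>carrier A. f (scale A c x) = scale B c (f x)) \<and>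
     (\<forall>x\<in>carrier A. f (star A x) = star B (f x))}"

definition cstar_isomorphic :: "('a, 'm) cstar_scheme \<Rightarrow> ('b, 'n) cstar_scheme \<Rightarrow> bool" where
  "cstar_isomorphic A B \<longleftrightarrow> (\<exists>f\<in>cstar_hom A B. bij_betw f (carrier A) (carrier B))"


section \<open>The free unital *-algebra on a set of generators\<close>

datatype 'g letter = Gen 'g | Adj 'g

fun letter_gen :: "'g letter \<Rightarrow> 'g" where
  "letter_gen (Gen g) = g"
| "letter_gen (Adj g) = g"

fun letter_adj :: "'g letter \<Rightarrow> 'g letter" where
  "letter_adj (Gen g) = Adj g"
| "letter_adj (Adj g) = Gen g"

text \<open>Words under concatenation, written additively because the convolution product on
  \<open>\<Rightarrow>\<^sub>0\<close> expects an additive monoid of exponents.\<close>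

datatype 'g word = Word (letters: "'g letter list")

instantiation word :: (type) monoid_add
begin
definition zero_word :: "'a word" where "0 = Word []"
definition plus_word :: "'a word \<Rightarrow> 'a word \<Rightarrow> 'a word" where
  "u + w = Word (letters u @ letters w)"
instance by standard (auto simp: zero_word_def plus_word_def)
end

definition word_adj :: "'g word \<Rightarrow> 'g word" where
  "word_adj w = Word (rev (map letter_adj (letters w)))"

type_synonym 'g falg = "'g word \<Rightarrow>\<^sub>0 complex"

definition free_algebra :: "'g set \<Rightarrow> 'g falg set" where
  "free_algebra X = {x. \<forall>w\<in>Poly_Mapping.keys x. letter_gen ` set (letters w) \<subseteq> X}"

definition gen :: "'g \<Rightarrow> 'g falg" where
  "gen g = Poly_Mapping.single (Word [Gen g]) 1"

definition fscale :: "complex \<Rightarrow> 'g falg \<Rightarrow> 'g falg" where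
  "fscale c x = Poly_Mapping.single 0 c * x"

definition fstar :: "'g falg \<Rightarrow> 'g falg" where
  "fstar x = Poly_Mapping.map_key word_adj (Poly_Mapping.map cnj x)"


section \<open>Universal C*-algebras of generators and relations\<close>

definition cstar_seminorm :: "'g falg set \<Rightarrow> ('g falg \<Rightarrow> real) \<Rightarrow> bool" where
  "cstar_seminorm F p \<longleftrightarrow>
     (\<forall>x\<in>F. \<forall>y\<in>F. p (x + y) \<le> p x + p y \<and> p (x * y) \<le> p x * p y) \<and>
     (\<forall>x\<in>F. (\<forall>c. p (fscale c x) = cmod c * p x) \<and> p (fstar x * x) = (p x)\<^sup>2)"

text \<open>A relation \<open>(x, y)\<close> stands for the equation \<open>x = y\<close>. The C*-seminorms on the free *-algebra
  respecting all relations are exactly the norms pulled back along families in C*-algebras that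
  satisfy the relations; \<open>universal_seminorm\<close> is their supremum.\<close>

definition rel_seminorms :: "'g set \<Rightarrow> ('g falg \<times> 'g falg) set \<Rightarrow> ('g falg \<Rightarrow> real) set" where
  "rel_seminorms X R = {p. cstar_seminorm (free_algebra X) p \<and> (\<forall>(x, y)\<in>R. p (x - y) = 0)}"

definition universal_seminorm :: "'g set \<Rightarrow> ('g falg \<times> 'g falg) set \<Rightarrow> 'g falg \<Rightarrow> real" where
  "universal_seminorm X R x = (SUP p\<in>rel_seminorms X R. p x)"

text \<open>Separation and completion of \<open>F\<close> with respect to the seminorm \<open>N\<close>: Cauchy sequences modulo
  null sequences.\<close>

definition cauchy_seqs :: "'g falg set \<Rightarrow> ('g falg \<Rightarrow> real) \<Rightarrow> (nat \<Rightarrow> 'g falg) set" where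
  "cauchy_seqs F N = {x. (\<forall>n. x n \<in> F) \<and>
     (\<forall>\<epsilon>>0. \<exists>M. \<forall>m\<ge>M. \<forall>n\<ge>M. N (x m - x n) < \<epsilon>)}"

definition null_rel :: "'g falg set \<Rightarrow> ('g falg \<Rightarrow> real) \<Rightarrow> ((nat \<Rightarrow> 'g falg) \<times> (nat \<Rightarrow> 'g falg)) set" where
  "null_rel F N = {(x, y). x \<in> cauchy_seqs F N \<and> y \<in> cauchy_seqs F N \<and>
     (\<lambda>n. N (x n - y n)) \<longlonglongrightarrow> 0}"

definition completion :: "'g falg set \<Rightarrow> ('g falg \<Rightarrow> real) \<Rightarrow> (nat \<Rightarrow> 'g falg) set cstar" where
  "completion F N =
    \<lparr>carrier = cauchy_seqs F N // null_rel F N,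
     mult = \<lambda>a b. \<Union>x\<in>a. \<Union>y\<in>b. null_rel F N `` {\<lambda>n. x n * y n},
     one = null_rel F N `` {\<lambda>n. 1},
     zero = null_rel F N `` {\<lambda>n. 0},
     add = \<lambda>a b. \<Union>x\<in>a. \<Union>y\<in>b. null_rel F N `` {\<lambda>n. x n + y n},
     scale = \<lambda>c a. \<Union>x\<in>a. null_rel F N `` {\<lambda>n. fscale c (x n)},
     star = \<lambda>a. \<Union>x\<in>a. null_rel F N `` {\<lambda>n. fstar (x n)},
     nrm = \<lambda>a. THE r. \<forall>x\<in>a. (\<lambda>n. N (x n)) \<longlonglongrightarrow> r\<rparr>"

definition universal_cstar :: "'g set \<Rightarrow> ('g falg \<times> 'g falg) set \<Rightarrow> (nat \<Rightarrow> 'g falg) set cstar" where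
  "universal_cstar X R = completion (free_algebra X) (universal_seminorm X R)"

definition const_class :: "'g set \<Rightarrow> ('g falg \<times> 'g falg) set \<Rightarrow> 'g falg \<Rightarrow> (nat \<Rightarrow> 'g falg) set" where
  "const_class X R x = null_rel (free_algebra X) (universal_seminorm X R) `` {\<lambda>n. x}"

lemma letter_adj_adj [simp]: "letter_adj (letter_adj a) = a"
  by (cases a) auto

lemma letter_gen_adj [simp]: "letter_gen (letter_adj a) = letter_gen a"
  by (cases a) auto

lemma word_adj_adj [simp]: "word_adj (word_adj w) = w"
  by (cases w) (simp add: word_adj_def rev_map o_def)

lemma word_adj_plus: "word_adj (u + w) = word_adj w + word_adj u"
  by (simp add: word_adj_def plus_word_def)

lemma word_adj_zero [simp]: "word_adj 0 = 0"
  by (simp add: word_adj_def zero_word_def)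

lemma inj_word_adj: "inj word_adj"
  by (metis injI word_adj_adj)

lemma lookup_fstar: "Poly_Mapping.lookup (fstar x) w = cnj (Poly_Mapping.lookup x (word_adj w))"
  unfolding fstar_def
  by (simp add: Poly_Mapping.map_key.rep_eq inj_word_adj Poly_Mapping.map.rep_eq when_def)

lemma fstar_add: "fstar (x + y) = fstar x + fstar y"
  by (rule poly_mapping_eqI) (simp add: lookup_fstar lookup_add)

lemma fstar_diff: "fstar (x - y) = fstar x - fstar y"
  by (rule poly_mapping_eqI) (simp add: lookup_fstar lookup_minus)

lemma fstar_fstar [simp]: "fstar (fstar x) = x"
  by (rule poly_mapping_eqI) (simp add: lookup_fstar)

lemma fstar_zero [simp]: "fstar 0 = 0"
  by (rule poly_mapping_eqI) (simp add: lookup_fstar)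

lemma fstar_single: "fstar (Poly_Mapping.single w c) = Poly_Mapping.single (word_adj w) (cnj c)"
  by (rule poly_mapping_eqI) (auto simp: lookup_fstar lookup_single when_def)

lemma fstar_one [simp]: "fstar 1 = 1"
  by (simp flip: single_one add: fstar_single)

lemma falg_induct [case_names zero add_single]:
  fixes x :: "'g falg"
  assumes "Q 0" and "\<And>x w c. Q x \<Longrightarrow> Q (x + Poly_Mapping.single w c)"
  shows "Q x"
proof (induction x rule: Poly_Mapping.update_induct)
  case const
  show ?case by (rule assms)
next
  case (update f a b)
  have "Poly_Mapping.update a b f = f + Poly_Mapping.single a b"
    using update(1)
    by (intro poly_mapping_eqI) (auto simp: lookup_update lookup_add lookup_single when_def in_keys_iff)
  with update assms(2) show ?case by simp
qed

lemma fstar_mult: "fstar (x * y) = fstar y * fstar x"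
proof (induction x rule: falg_induct)
  case zero
  show ?case by simp
next
  case (add_single x w c)
  have "fstar (Poly_Mapping.single w c * y) = fstar y * fstar (Poly_Mapping.single w c)"
  proof (induction y rule: falg_induct)
    case zero
    show ?case by simp
  next
    case (add_single y v d)
    then show ?case
      by (simp add: distrib_left distrib_right fstar_add mult_single fstar_single word_adj_plus mult.commute)
  qed
  with add_single show ?case
    by (simp add: distrib_left distrib_right fstar_add)
qed

lemma single_zero_commute: "Poly_Mapping.single 0 c * x = x * Poly_Mapping.single 0 (c :: complex)"
  for x :: "'g falg"
proof (induction x rule: falg_induct)
  case (add_single x w d)
  then show ?case
    by (simp add: distrib_left distrib_right mult_single mult.commute)
qed simp

lemma fscale_simps:
  fixes x y :: "'g falg"
  shows "fscale c (x + y) = fscale c x + fscale c y"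
    and "fscale (c + d) x = fscale c x + fscale d x"
    and "fscale c (fscale d x) = fscale (c * d) x"
    and "fscale 1 x = x"
    and "fscale c x * y = fscale c (x * y)"
    and "x * fscale c y = fscale c (x * y)"
    and "fscale c (x - y) = fscale c x - fscale c y"
    and "fscale (-1) x = - x"
    and "fscale 0 x = 0"
proof -
  show "fscale c (x + y) = fscale c x + fscale c y" "fscale c (x - y) = fscale c x - fscale c y"
    "fscale c x * y = fscale c (x * y)"
    by (simp_all add: fscale_def algebra_simps)
  show "fscale (c + d) x = fscale c x + fscale d x"
    by (simp add: fscale_def single_add algebra_simps)
  show "fscale c (fscale d x) = fscale (c * d) x"
    by (simp add: fscale_def mult_single flip: mult.assoc)
  show "fscale 1 x = x" "fscale 0 x = 0" "fscale (-1) x = - x"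
    by (simp_all add: fscale_def single_uminus)
  show "x * fscale c y = fscale c (x * y)"
    unfolding fscale_def by (metis mult.assoc single_zero_commute)
qed

lemma fstar_fscale: "fstar (fscale c x) = fscale (cnj c) (fstar x)"
  by (simp add: fscale_def fstar_mult fstar_single single_zero_commute)

text \<open>Subsets playing the role of the ambient *-algebra.\<close>

locale star_subalgebra =
  fixes F :: "'g falg set"
  assumes one_mem: "1 \<in> F"
    and add_mem: "\<lbrakk>x \<in> F; y \<in> F\<rbrakk> \<Longrightarrow> x + y \<in> F"
    and mult_mem: "\<lbrakk>x \<in> F; y \<in> F\<rbrakk> \<Longrightarrow> x * y \<in> F"
    and fscale_mem: "x \<in> F \<Longrightarrow> fscale c x \<in> F"
    and fstar_mem: "x \<in> F \<Longrightarrow> fstar x \<in> F"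
begin

lemma zero_mem: "0 \<in> F"
  using fscale_mem[OF one_mem, of 0] by (simp add: fscale_simps)

lemma uminus_mem: "x \<in> F \<Longrightarrow> - x \<in> F"
  using fscale_mem[of x "-1"] by (simp add: fscale_simps)

lemma diff_mem: "\<lbrakk>x \<in> F; y \<in> F\<rbrakk> \<Longrightarrow> x - y \<in> F"
  using add_mem[of x "- y"] uminus_mem by simp

end

lemma star_subalgebra_free_algebra: "star_subalgebra (free_algebra X)"
proof
  fix x y :: "'a falg" and c
  assume x: "x \<in> free_algebra X"
  show "fstar x \<in> free_algebra X"
  proof -
    have "letter_gen ` set (letters w) \<subseteq> X" if "w \<in> Poly_Mapping.keys (fstar x)" for w
    proof -
      have "word_adj w \<in> Poly_Mapping.keys x"
        using that by (simp add: in_keys_iff lookup_fstar)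
      with x show ?thesis by (fastforce simp: free_algebra_def word_adj_def)
    qed
    then show ?thesis by (simp add: free_algebra_def)
  qed
  have mult: "x * y \<in> free_algebra X" if "x \<in> free_algebra X" "y \<in> free_algebra X" for x y :: "'a falg"
    using that keys_mult[of x y] by (fastforce simp: free_algebra_def plus_word_def)
  show "fscale c x \<in> free_algebra X"
    unfolding fscale_def
    by (rule mult) (use x in \<open>auto simp: free_algebra_def zero_word_def split: if_splits\<close>)
  assume "y \<in> free_algebra X"
  with x show "x * y \<in> free_algebra X" by (rule mult)
  show "x + y \<in> free_algebra X"
    using x \<open>y \<in> free_algebra X\<close> Poly_Mapping.keys_add[of x y] by (auto simp: free_algebra_def)
next
  show "(1 :: 'a falg) \<in> free_algebra X"
    by (auto simp: free_algebra_def zero_word_def)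
qed

lemma gen_mem: "g \<in> X \<Longrightarrow> gen g \<in> free_algebra X"
  by (auto simp: gen_def free_algebra_def)

locale star_seminorm = star_subalgebra F for F :: "'g falg set" +
  fixes N :: "'g falg \<Rightarrow> real"
  assumes seminorm: "cstar_seminorm F N"
begin

lemma N_add: "\<lbrakk>x \<in> F; y \<in> F\<rbrakk> \<Longrightarrow> N (x + y) \<le> N x + N y"
  and N_mult: "\<lbrakk>x \<in> F; y \<in> F\<rbrakk> \<Longrightarrow> N (x * y) \<le> N x * N y"
  and N_scale: "x \<in> F \<Longrightarrow> N (fscale c x) = cmod c * N x"
  and N_cstar: "x \<in> F \<Longrightarrow> N (fstar x * x) = (N x)\<^sup>2"
  using seminorm by (auto simp: cstar_seminorm_def)

lemma N_zero: "N 0 = 0"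
  using N_scale[OF zero_mem, of 0] by (simp add: fscale_simps)

lemma N_minus: "x \<in> F \<Longrightarrow> N (- x) = N x"
  using N_scale[of x "-1"] by (simp add: fscale_simps)

lemma N_nonneg: "x \<in> F \<Longrightarrow> 0 \<le> N x"
  using N_add[of x "- x"] by (simp add: uminus_mem N_zero N_minus)

lemma N_diff_commute: "\<lbrakk>x \<in> F; y \<in> F\<rbrakk> \<Longrightarrow> N (x - y) = N (y - x)"
  using N_minus[of "x - y"] by (simp add: diff_mem)

lemma N_triangle: "\<lbrakk>x \<in> F; y \<in> F; z \<in> F\<rbrakk> \<Longrightarrow> N (x - z) \<le> N (x - y) + N (y - z)"
  using N_add[of "x - y" "y - z"] by (simp add: diff_mem)

lemma N_diff_abs: "\<lbrakk>x \<in> F; y \<in> F\<rbrakk> \<Longrightarrow> \<bar>N x - N y\<bar> \<le> N (x - y)"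
  using N_add[of "x - y" y] N_add[of "y - x" x] N_diff_commute[of x y]
  by (simp add: diff_mem)

lemma N_star: assumes "x \<in> F" shows "N (fstar x) = N x"
proof -
  have le: "N z \<le> N (fstar z)" if "z \<in> F" for z
  proof (cases "N z = 0")
    case True
    with that show ?thesis by (simp add: N_nonneg fstar_mem)
  next
    case False
    then have "N z > 0" using N_nonneg[OF that] by simp
    moreover have "N z * N z \<le> N (fstar z) * N z"
      using N_mult[of "fstar z" z] N_cstar[OF that] that by (simp add: fstar_mem power2_eq_square)
    ultimately show ?thesis by simp
  qed
  show ?thesis using le[OF assms] le[of "fstar x"] assms by (simp add: fstar_mem)
qed

lemma N_mult_diff:
  assumes "x \<in> F" "y \<in> F" "x' \<in> F" "y' \<in> F"
  shows "N (x * y - x' * y') \<le> N x * N (y - y') + N (x - x') * N y'"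
proof -
  have "x * y - x' * y' = x * (y - y') + (x - x') * y'" by (simp add: algebra_simps)
  then show ?thesis
    using N_add[of "x * (y - y')" "(x - x') * y'"] N_mult[of x "y - y'"] N_mult[of "x - x'" y'] assms
    by (simp add: mult_mem diff_mem)
qed

abbreviation "C \<equiv> cauchy_seqs F N"
abbreviation "cls x \<equiv> null_rel F N `` {x}"

lemma C_mem: "x \<in> C \<Longrightarrow> x n \<in> F"
  by (simp add: cauchy_seqs_def)

lemma C_D: "\<lbrakk>x \<in> C; \<epsilon> > 0\<rbrakk> \<Longrightarrow> \<exists>M. \<forall>m\<ge>M. \<forall>n\<ge>M. N (x m - x n) < \<epsilon>"
  by (simp add: cauchy_seqs_def)

lemma CI: "\<lbrakk>\<And>n. x n \<in> F; \<And>\<epsilon>. \<epsilon> > 0 \<Longrightarrow> \<exists>M. \<forall>m\<ge>M. \<forall>n\<ge>M. N (x m - x n) < \<epsilon>\<rbrakk> \<Longrightarrow> x \<in> C"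
  by (simp add: cauchy_seqs_def)

lemma C_convergent: assumes "x \<in> C" shows "convergent (\<lambda>n. N (x n))"
proof (rule Cauchy_convergent, rule CauchyI)
  fix e :: real assume "0 < e"
  from C_D[OF assms this] show "\<exists>M. \<forall>m\<ge>M. \<forall>n\<ge>M. norm (N (x m) - N (x n)) < e"
    using N_diff_abs C_mem[OF assms] by (metis order.strict_trans1 real_norm_def)
qed

lemma C_bounded: assumes "x \<in> C" obtains B where "B > 0" "\<And>n. N (x n) \<le> B"
proof -
  have "Bseq (\<lambda>n. N (x n))" using C_convergent[OF assms] by (rule convergent_imp_Bseq)
  then obtain B where "B > 0" "\<forall>n. norm (N (x n)) \<le> B" by (auto simp: Bseq_def)
  with that show thesis by (metis abs_le_D1 real_norm_def)
qed

lemma const_C: "x \<in> F \<Longrightarrow> (\<lambda>n. x) \<in> C"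
  by (rule CI) (auto simp: N_zero)

lemma add_C: assumes "x \<in> C" "y \<in> C" shows "(\<lambda>n. x n + y n) \<in> C"
proof (rule CI)
  fix n show "x n + y n \<in> F" using assms by (simp add: C_mem add_mem)
next
  fix e :: real assume "e > 0"
  then have "e / 2 > 0" by simp
  obtain M where M: "\<And>m n. \<lbrakk>m \<ge> M; n \<ge> M\<rbrakk> \<Longrightarrow> N (x m - x n) < e / 2"
    using C_D[OF assms(1) \<open>e / 2 > 0\<close>] by blast
  obtain M' where M': "\<And>m n. \<lbrakk>m \<ge> M'; n \<ge> M'\<rbrakk> \<Longrightarrow> N (y m - y n) < e / 2"
    using C_D[OF assms(2) \<open>e / 2 > 0\<close>] by blast
  have "N (x m + y m - (x n + y n)) < e" if "m \<ge> max M M'" "n \<ge> max M M'" for m n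
  proof -
    have "x m + y m - (x n + y n) = (x m - x n) + (y m - y n)" by simp
    then have "N (x m + y m - (x n + y n)) = N ((x m - x n) + (y m - y n))" by (rule arg_cong)
    then show ?thesis
      using N_add[of "x m - x n" "y m - y n"] M[of m n] M'[of m n] that assms
      by (simp add: C_mem diff_mem)
  qed
  then show "\<exists>M. \<forall>m\<ge>M. \<forall>n\<ge>M. N (x m + y m - (x n + y n)) < e" by blast
qed

lemma mult_C: assumes "x \<in> C" "y \<in> C" shows "(\<lambda>n. x n * y n) \<in> C"
proof (rule CI)
  fix n show "x n * y n \<in> F" using assms by (simp add: C_mem mult_mem)
next
  fix e :: real assume e: "e > 0"
  obtain A where A: "A > 0" "\<And>n. N (x n) \<le> A" using C_bounded[OF assms(1)] by blast
  obtain B where B: "B > 0" "\<And>n. N (y n) \<le> B" using C_bounded[OF assms(2)] by blast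
  obtain M where M: "\<And>m n. \<lbrakk>m \<ge> M; n \<ge> M\<rbrakk> \<Longrightarrow> N (x m - x n) < e / (2 * B)"
    using C_D[OF assms(1), of "e / (2 * B)"] e B by auto
  obtain M' where M': "\<And>m n. \<lbrakk>m \<ge> M'; n \<ge> M'\<rbrakk> \<Longrightarrow> N (y m - y n) < e / (2 * A)"
    using C_D[OF assms(2), of "e / (2 * A)"] e A by auto
  have "N (x m * y m - x n * y n) < e" if "m \<ge> max M M'" "n \<ge> max M M'" for m n
  proof -
    have "N (x m * y m - x n * y n) \<le> N (x m) * N (y m - y n) + N (x m - x n) * N (y n)"
      using assms by (intro N_mult_diff) (auto simp: C_mem)
    also have "\<dots> \<le> A * N (y m - y n) + N (x m - x n) * B"
      using A B assms by (intro add_mono mult_right_mono mult_left_mono) (auto intro: N_nonneg diff_mem C_mem)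
    also have "\<dots> < A * (e / (2 * A)) + (e / (2 * B)) * B"
      using M[of m n] M'[of m n] that A(1) B(1)
      by (intro add_strict_mono mult_strict_left_mono mult_strict_right_mono) auto
    also have "\<dots> = e" using A B by simp
    finally show ?thesis .
  qed
  then show "\<exists>M. \<forall>m\<ge>M. \<forall>n\<ge>M. N (x m * y m - x n * y n) < e" by blast
qed

lemma scale_C: assumes "x \<in> C" shows "(\<lambda>n. fscale c (x n)) \<in> C"
proof -
  have "(\<lambda>n. fscale c 1 * x n) \<in> C"
    using assms by (intro mult_C const_C fscale_mem one_mem)
  then show ?thesis by (simp add: fscale_simps)
qed

lemma star_C: assumes "x \<in> C" shows "(\<lambda>n. fstar (x n)) \<in> C"
  using assms by (auto simp: cauchy_seqs_def fstar_mem diff_mem N_star simp flip: fstar_diff)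

lemma equiv_null: "equiv C (null_rel F N)"
proof (rule equivI)
  show "refl_on C (null_rel F N)" by (auto simp: refl_on_def null_rel_def N_zero)
  show "null_rel F N \<subseteq> C \<times> C" by (auto simp: null_rel_def)
  show "sym (null_rel F N)"
    by (auto simp: sym_def null_rel_def N_diff_commute C_mem)
  show "trans (null_rel F N)"
  proof (rule transI)
    fix x y z assume "(x, y) \<in> null_rel F N" "(y, z) \<in> null_rel F N"
    then have C: "x \<in> C" "y \<in> C" "z \<in> C"
      and lim: "(\<lambda>n. N (x n - y n)) \<longlonglongrightarrow> 0" "(\<lambda>n. N (y n - z n)) \<longlonglongrightarrow> 0"
      by (auto simp: null_rel_def)
    have "(\<lambda>n. N (x n - z n)) \<longlonglongrightarrow> 0"
    proof (rule tendsto_sandwich[OF _ _ tendsto_const tendsto_add_zero[OF lim]])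
      show "\<forall>\<^sub>F n in sequentially. 0 \<le> N (x n - z n)"
        using C by (simp add: N_nonneg diff_mem C_mem)
      show "\<forall>\<^sub>F n in sequentially. N (x n - z n) \<le> N (x n - y n) + N (y n - z n)"
        using C by (simp add: N_triangle C_mem)
    qed
    with C show "(x, z) \<in> null_rel F N" by (simp add: null_rel_def)
  qed
qed

lemma null_relI: "\<lbrakk>x \<in> C; y \<in> C; (\<lambda>n. N (x n - y n)) \<longlonglongrightarrow> 0\<rbrakk> \<Longrightarrow> (x, y) \<in> null_rel F N"
  by (simp add: null_rel_def)

lemma cls_eq_iff: "\<lbrakk>x \<in> C; y \<in> C\<rbrakk> \<Longrightarrow> cls x = cls y \<longleftrightarrow> (\<lambda>n. N (x n - y n)) \<longlonglongrightarrow> 0"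
  using eq_equiv_class_iff[OF equiv_null] by (auto simp: null_rel_def)

abbreviation "A \<equiv> completion F N"

lemma carrier_A: "carrier A = C // null_rel F N"
  by (simp add: completion_def)

lemma cls_closed: "x \<in> C \<Longrightarrow> cls x \<in> carrier A"
  by (simp add: carrier_A quotientI)

lemma A_cases: assumes "a \<in> carrier A" obtains x where "x \<in> C" "a = cls x"
  using assms by (auto simp: carrier_A elim: quotientE)

lemma tendsto_zero_le:
  assumes "f \<longlonglongrightarrow> 0" "\<And>n. 0 \<le> g n" "\<And>n. g n \<le> f n"
  shows "g \<longlonglongrightarrow> (0::real)"
  by (rule tendsto_sandwich[OF _ _ tendsto_const assms(1)]) (simp_all add: assms(2,3))

lemma cls_add:
  assumes "x \<in> C" "y \<in> C" shows "cls x \<oplus>\<^bsub>A\<^esub> cls y = cls (\<lambda>n. x n + y n)"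
proof -
  have "congruent2 (null_rel F N) (null_rel F N) (\<lambda>x y. cls (\<lambda>n. x n + y n))"
  proof (rule congruent2I[OF equiv_null equiv_null])
    fix x x' y assume a: "y \<in> C" "(x, x') \<in> null_rel F N"
    then have "x \<in> C" "x' \<in> C" "(\<lambda>n. N (x n - x' n)) \<longlonglongrightarrow> 0" by (auto simp: null_rel_def)
    with a show "cls (\<lambda>n. x n + y n) = cls (\<lambda>n. x' n + y n)"
      "cls (\<lambda>n. y n + x n) = cls (\<lambda>n. y n + x' n)"
      by (simp_all add: cls_eq_iff add_C)
  qed
  from UN_equiv_class2[OF equiv_null equiv_null this assms] show ?thesis
    by (simp add: completion_def)
qed

lemma cls_mult:
  assumes "x \<in> C" "y \<in> C" shows "cls x \<otimes>\<^bsub>A\<^esub> cls y = cls (\<lambda>n. x n * y n)"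
proof -
  have "congruent2 (null_rel F N) (null_rel F N) (\<lambda>x y. cls (\<lambda>n. x n * y n))"
  proof (rule congruent2I[OF equiv_null equiv_null])
    fix x x' y assume a: "y \<in> C" "(x, x') \<in> null_rel F N"
    then have C: "x \<in> C" "x' \<in> C" and lim: "(\<lambda>n. N (x n - x' n)) \<longlonglongrightarrow> 0" by (auto simp: null_rel_def)
    obtain B where B: "B > 0" "\<And>n. N (y n) \<le> B" using C_bounded[OF a(1)] by blast
    have le: "N (x n * y n - x' n * y n) \<le> N (x n - x' n) * B"
      "N (y n * x n - y n * x' n) \<le> B * N (x n - x' n)" for n
    proof -
      have "N ((x n - x' n) * y n) \<le> N (x n - x' n) * N (y n)"
        "N (y n * (x n - x' n)) \<le> N (y n) * N (x n - x' n)"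
        by (rule N_mult; use C a in \<open>simp add: diff_mem C_mem\<close>)+
      moreover have "N (x n - x' n) * N (y n) \<le> N (x n - x' n) * B"
        "N (y n) * N (x n - x' n) \<le> B * N (x n - x' n)"
        using C B by (simp_all add: mult_left_mono mult_right_mono N_nonneg diff_mem C_mem)
      ultimately show "N (x n * y n - x' n * y n) \<le> N (x n - x' n) * B"
        "N (y n * x n - y n * x' n) \<le> B * N (x n - x' n)"
        by (auto simp: algebra_simps)
    qed
    have "(\<lambda>n. N (x n * y n - x' n * y n)) \<longlonglongrightarrow> 0"
      by (rule tendsto_zero_le[OF tendsto_mult_left_zero[OF lim, of B]])
        (use C a le in \<open>simp_all add: N_nonneg diff_mem mult_mem C_mem\<close>)
    with C a show "cls (\<lambda>n. x n * y n) = cls (\<lambda>n. x' n * y n)"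
      by (simp add: cls_eq_iff mult_C)
    have "(\<lambda>n. N (y n * x n - y n * x' n)) \<longlonglongrightarrow> 0"
      by (rule tendsto_zero_le[OF tendsto_mult_right_zero[OF lim, of B]])
        (use C a le in \<open>simp_all add: N_nonneg diff_mem mult_mem C_mem\<close>)
    with C a show "cls (\<lambda>n. y n * x n) = cls (\<lambda>n. y n * x' n)"
      by (simp add: cls_eq_iff mult_C)
  qed
  from UN_equiv_class2[OF equiv_null equiv_null this assms] show ?thesis
    by (simp add: completion_def)
qed

lemma cls_scale:
  assumes "x \<in> C" shows "scale A c (cls x) = cls (\<lambda>n. fscale c (x n))"
proof -
  have "congruent (null_rel F N) (\<lambda>x. cls (\<lambda>n. fscale c (x n)))"
  proof (rule congruentI)
    fix x x' assume "(x, x') \<in> null_rel F N"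
    then have C: "x \<in> C" "x' \<in> C" and lim: "(\<lambda>n. N (x n - x' n)) \<longlonglongrightarrow> 0" by (auto simp: null_rel_def)
    have "(\<lambda>n. N (fscale c (x n) - fscale c (x' n))) \<longlonglongrightarrow> 0"
      using tendsto_mult_right_zero[OF lim, of "cmod c"] C
      by (simp add: N_scale diff_mem C_mem flip: fscale_simps(7))
    with C show "cls (\<lambda>n. fscale c (x n)) = cls (\<lambda>n. fscale c (x' n))"
      by (simp add: cls_eq_iff scale_C)
  qed
  from UN_equiv_class[OF equiv_null this assms] show ?thesis by (simp add: completion_def)
qed

lemma cls_star:
  assumes "x \<in> C" shows "star A (cls x) = cls (\<lambda>n. fstar (x n))"
proof -
  have "congruent (null_rel F N) (\<lambda>x. cls (\<lambda>n. fstar (x n)))"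
  proof (rule congruentI)
    fix x x' assume "(x, x') \<in> null_rel F N"
    then have C: "x \<in> C" "x' \<in> C" and lim: "(\<lambda>n. N (x n - x' n)) \<longlonglongrightarrow> 0" by (auto simp: null_rel_def)
    with C show "cls (\<lambda>n. fstar (x n)) = cls (\<lambda>n. fstar (x' n))"
      by (simp add: cls_eq_iff star_C N_star diff_mem C_mem flip: fstar_diff)
  qed
  from UN_equiv_class[OF equiv_null this assms] show ?thesis by (simp add: completion_def)
qed

lemma cls_zero: "\<zero>\<^bsub>A\<^esub> = cls (\<lambda>n. 0)" and cls_one: "\<one>\<^bsub>A\<^esub> = cls (\<lambda>n. 1)"
  by (simp_all add: completion_def)

lemma cls_nrm: assumes "x \<in> C" shows "(\<lambda>n. N (x n)) \<longlonglongrightarrow> nrm A (cls x)"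
proof -
  obtain l where l: "(\<lambda>n. N (x n)) \<longlonglongrightarrow> l" using C_convergent[OF assms] by (auto simp: convergent_def)
  have all: "(\<lambda>n. N (y n)) \<longlonglongrightarrow> l" if "y \<in> cls x" for y
  proof -
    from that have C: "y \<in> C" and lim: "(\<lambda>n. N (x n - y n)) \<longlonglongrightarrow> 0" by (auto simp: null_rel_def)
    have "(\<lambda>n. \<bar>N (x n) - N (y n)\<bar>) \<longlonglongrightarrow> 0"
      by (rule tendsto_zero_le[OF lim]) (use C assms in \<open>auto intro!: N_diff_abs C_mem\<close>)
    then have "(\<lambda>n. N (x n) - N (y n)) \<longlonglongrightarrow> 0" by (rule tendsto_rabs_zero_cancel)
    from tendsto_diff[OF l this] show ?thesis by simp
  qed
  have x: "x \<in> cls x" using equiv_class_self[OF equiv_null assms] .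
  have "nrm A (cls x) = (THE r. \<forall>y\<in>cls x. (\<lambda>n. N (y n)) \<longlonglongrightarrow> r)" by (simp add: completion_def)
  also have "\<dots> = l" using all x LIMSEQ_unique by (intro the_equality) blast+
  finally show ?thesis using l by simp
qed

lemmas C_intros = add_C mult_C scale_C star_C const_C zero_mem one_mem

lemma ring_A: "ring A"
proof (rule ringI)
  show "abelian_group A"
  proof (rule abelian_groupI)
    fix a assume "a \<in> carrier A"
    then obtain x where x: "x \<in> C" "a = cls x" by (rule A_cases)
    have "cls (\<lambda>n. fscale (-1) (x n)) \<oplus>\<^bsub>A\<^esub> a = \<zero>\<^bsub>A\<^esub>"
      using x by (simp add: cls_add C_intros cls_zero) (simp add: fscale_simps)
    then show "\<exists>b\<in>carrier A. b \<oplus>\<^bsub>A\<^esub> a = \<zero>\<^bsub>A\<^esub>"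
      using x by (intro bexI[of _ "cls (\<lambda>n. fscale (-1) (x n))"]) (auto intro: cls_closed scale_C)
  qed (auto elim!: A_cases simp: cls_add C_intros cls_closed cls_zero algebra_simps)
  show "Group.monoid A"
    by (rule monoidI) (auto elim!: A_cases simp: cls_mult C_intros cls_closed cls_one algebra_simps)
qed (auto elim!: A_cases simp: cls_mult cls_add C_intros cls_closed algebra_simps)

lemma minus_A: assumes "x \<in> C" "y \<in> C" shows "cls x \<ominus>\<^bsub>A\<^esub> cls y = cls (\<lambda>n. x n - y n)"
proof -
  interpret ring A by (rule ring_A)
  have "cls (\<lambda>n. fscale (-1) (y n)) \<oplus>\<^bsub>A\<^esub> cls y = \<zero>\<^bsub>A\<^esub>"
    using assms by (simp add: cls_add C_intros cls_zero) (simp add: fscale_simps)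
  then have "\<ominus>\<^bsub>A\<^esub> cls y = cls (\<lambda>n. fscale (-1) (y n))"
    using assms by (intro minus_equality) (auto simp: cls_closed C_intros)
  then have "cls x \<ominus>\<^bsub>A\<^esub> cls y = cls (\<lambda>n. x n + fscale (-1) (y n))"
    using assms by (simp add: a_minus_def cls_add C_intros)
  then show ?thesis by (simp add: fscale_simps)
qed

lemma diff_C: assumes "x \<in> C" "y \<in> C" shows "(\<lambda>n. x n - y n) \<in> C"
  using add_C[OF assms(1) scale_C[OF assms(2), of "-1"]] by (simp add: fscale_simps)

lemma nrm_const: "x \<in> F \<Longrightarrow> nrm A (cls (\<lambda>n. x)) = N x"
  using cls_nrm[OF const_C] by (simp add: LIMSEQ_const_iff)

lemma dense:
  assumes "x \<in> C" shows "(\<lambda>k. nrm A (cls x \<ominus>\<^bsub>A\<^esub> cls (\<lambda>n. x k))) \<longlonglongrightarrow> 0"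
proof (rule LIMSEQ_I)
  fix e :: real assume "e > 0"
  then obtain M where M: "\<And>m n. \<lbrakk>m \<ge> M; n \<ge> M\<rbrakk> \<Longrightarrow> N (x m - x n) < e / 2"
    using C_D[OF assms, of "e / 2"] by auto
  have "norm (nrm A (cls x \<ominus>\<^bsub>A\<^esub> cls (\<lambda>n. x k)) - 0) < e" if "k \<ge> M" for k
  proof -
    have k: "(\<lambda>n. x k) \<in> C" using assms by (simp add: const_C C_mem)
    have lim: "(\<lambda>n. N (x n - x k)) \<longlonglongrightarrow> nrm A (cls x \<ominus>\<^bsub>A\<^esub> cls (\<lambda>n. x k))"
      using cls_nrm[OF diff_C[OF assms k]] minus_A[OF assms k] by simp
    have "nrm A (cls x \<ominus>\<^bsub>A\<^esub> cls (\<lambda>n. x k)) \<le> e / 2"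
      by (rule LIMSEQ_le_const2[OF lim]) (use M that in \<open>auto intro!: exI[of _ M] less_imp_le\<close>)
    moreover have "0 \<le> nrm A (cls x \<ominus>\<^bsub>A\<^esub> cls (\<lambda>n. x k))"
      by (rule LIMSEQ_le_const[OF lim]) (use assms in \<open>simp add: N_nonneg diff_mem C_mem\<close>)
    ultimately show ?thesis using \<open>e > 0\<close> by simp
  qed
  then show "\<exists>no. \<forall>k\<ge>no. norm (nrm A (cls x \<ominus>\<^bsub>A\<^esub> cls (\<lambda>n. x k)) - 0) < e" by blast
qed


lemma nrm_le:
  assumes "x \<in> C" "y \<in> C" "w \<in> C" "\<And>n. N (x n) \<le> N (y n) + N (w n)"
  shows "nrm A (cls x) \<le> nrm A (cls y) + nrm A (cls w)"
  by (rule LIMSEQ_le[OF cls_nrm[OF assms(1)] tendsto_add[OF cls_nrm[OF assms(2)] cls_nrm[OF assms(3)]]])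
    (use assms(4) in simp)

lemma d_triangle:
  assumes "a \<in> carrier A" "b \<in> carrier A" "c \<in> carrier A"
  shows "nrm A (a \<ominus>\<^bsub>A\<^esub> c) \<le> nrm A (a \<ominus>\<^bsub>A\<^esub> b) + nrm A (b \<ominus>\<^bsub>A\<^esub> c)"
proof -
  obtain x y z where "x \<in> C" "a = cls x" "y \<in> C" "b = cls y" "z \<in> C" "c = cls z"
    using assms by (meson A_cases)
  then show ?thesis by (simp add: minus_A) (intro nrm_le diff_C N_triangle C_mem; assumption)
qed

lemma d_commute:
  assumes "a \<in> carrier A" "b \<in> carrier A"
  shows "nrm A (a \<ominus>\<^bsub>A\<^esub> b) = nrm A (b \<ominus>\<^bsub>A\<^esub> a)"
proof -
  obtain x y where xy: "x \<in> C" "a = cls x" "y \<in> C" "b = cls y"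
    using assms by (meson A_cases)
  have "(\<lambda>n. N (x n - y n)) = (\<lambda>n. N (y n - x n))"
    using xy by (simp add: N_diff_commute C_mem)
  then show ?thesis
    using xy cls_nrm[OF diff_C[of x y]] cls_nrm[OF diff_C[of y x]] LIMSEQ_unique by (fastforce simp: minus_A)
qed

lemma complete_A:
  assumes z: "\<And>n. z n \<in> carrier A"
    and cau: "\<And>\<epsilon>. \<epsilon> > 0 \<Longrightarrow> \<exists>M. \<forall>m\<ge>M. \<forall>n\<ge>M. nrm A (z m \<ominus>\<^bsub>A\<^esub> z n) < \<epsilon>"
  shows "\<exists>l\<in>carrier A. (\<lambda>n. nrm A (z n \<ominus>\<^bsub>A\<^esub> l)) \<longlonglongrightarrow> 0"
proof -
  let ?k = "\<lambda>y. cls (\<lambda>n. y)"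
  have "\<exists>y. y \<in> F \<and> nrm A (z n \<ominus>\<^bsub>A\<^esub> ?k y) < inverse (real (Suc n))" for n
  proof -
    obtain x where x: "x \<in> C" "z n = cls x" using z by (meson A_cases)
    from LIMSEQ_D[OF dense[OF x(1)], of "inverse (real (Suc n))"]
    obtain k where "norm (nrm A (cls x \<ominus>\<^bsub>A\<^esub> ?k (x k)) - 0) < inverse (real (Suc n))" by auto
    with x show ?thesis by (intro exI[of _ "x k"]) (simp add: C_mem)
  qed
  then obtain y where y: "\<And>n. y n \<in> F" "\<And>n. nrm A (z n \<ominus>\<^bsub>A\<^esub> ?k (y n)) < inverse (real (Suc n))"
    by metis
  have k: "?k (y n) \<in> carrier A" for n using y by (simp add: cls_closed const_C)
  have lim: "(\<lambda>n. nrm A (z n \<ominus>\<^bsub>A\<^esub> ?k (y n))) \<longlonglongrightarrow> 0"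
  proof (rule tendsto_zero_le[OF LIMSEQ_inverse_real_of_nat])
    fix n
    show "0 \<le> nrm A (z n \<ominus>\<^bsub>A\<^esub> ?k (y n))"
      using d_triangle[OF z[of n] k[of n] z[of n]] d_triangle[OF z[of n] z[of n] z[of n]] d_commute[OF z[of n] k[of n]]
      by linarith
    show "nrm A (z n \<ominus>\<^bsub>A\<^esub> ?k (y n)) \<le> inverse (real (Suc n))"
      using y(2)[of n] by simp
  qed
  have yC: "y \<in> C"
  proof (rule CI)
    fix e :: real assume e: "e > 0"
    obtain M where M: "\<And>m n. \<lbrakk>m \<ge> M; n \<ge> M\<rbrakk> \<Longrightarrow> nrm A (z m \<ominus>\<^bsub>A\<^esub> z n) < e / 3"
      using cau[of "e / 3"] e by auto
    obtain M' where M': "\<And>n. n \<ge> M' \<Longrightarrow> nrm A (z n \<ominus>\<^bsub>A\<^esub> ?k (y n)) < e / 3"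
      using LIMSEQ_D[OF lim, of "e / 3"] e by (metis abs_less_iff diff_zero real_norm_def zero_less_divide_iff zero_less_numeral)
    have "N (y m - y n) < e" if "m \<ge> max M M'" "n \<ge> max M M'" for m n
    proof -
      have "N (y m - y n) = nrm A (?k (y m) \<ominus>\<^bsub>A\<^esub> ?k (y n))"
        using y(1) by (simp add: minus_A const_C nrm_const diff_mem)
      also have "\<dots> \<le> nrm A (?k (y m) \<ominus>\<^bsub>A\<^esub> z m) + nrm A (z m \<ominus>\<^bsub>A\<^esub> z n) + nrm A (z n \<ominus>\<^bsub>A\<^esub> ?k (y n))"
        using d_triangle[OF k[of m] z[of m] k[of n]] d_triangle[OF z[of m] z[of n] k[of n]] by linarith
      also have "nrm A (?k (y m) \<ominus>\<^bsub>A\<^esub> z m) = nrm A (z m \<ominus>\<^bsub>A\<^esub> ?k (y m))"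
        by (rule d_commute[OF k z])
      finally show ?thesis using M[of m n] M'[of m] M'[of n] that by simp
    qed
    then show "\<exists>M. \<forall>m\<ge>M. \<forall>n\<ge>M. N (y m - y n) < e" by blast
  qed (rule y)
  have "(\<lambda>n. nrm A (?k (y n) \<ominus>\<^bsub>A\<^esub> cls y)) \<longlonglongrightarrow> 0"
    using dense[OF yC] d_commute[OF k cls_closed[OF yC]] by simp
  from tendsto_add_zero[OF lim this] have "(\<lambda>n. nrm A (z n \<ominus>\<^bsub>A\<^esub> cls y)) \<longlonglongrightarrow> 0"
  proof (rule tendsto_zero_le)
    fix n
    show "nrm A (z n \<ominus>\<^bsub>A\<^esub> cls y) \<le> nrm A (z n \<ominus>\<^bsub>A\<^esub> ?k (y n)) + nrm A (?k (y n) \<ominus>\<^bsub>A\<^esub> cls y)"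
      by (rule d_triangle[OF z k cls_closed[OF yC]])
    show "0 \<le> nrm A (z n \<ominus>\<^bsub>A\<^esub> cls y)"
      using d_triangle[OF z[of n] cls_closed[OF yC] z[of n]] d_triangle[OF z[of n] z[of n] z[of n]]
        d_commute[OF z[of n] cls_closed[OF yC]] by linarith
  qed
  then show ?thesis using cls_closed[OF yC] by blast
qed

lemma cstar_algebra_A: "cstar_algebra A"
proof (intro cstar_algebra.intro cstar_algebra_axioms.intro ring_A)
  show "\<exists>l\<in>carrier A. (\<lambda>n. nrm A (z n \<ominus>\<^bsub>A\<^esub> l)) \<longlonglongrightarrow> 0"
    if "\<And>n. z n \<in> carrier A" "\<And>\<epsilon>. \<epsilon> > 0 \<Longrightarrow> \<exists>M. \<forall>m\<ge>M. \<forall>n\<ge>M. nrm A (z m \<ominus>\<^bsub>A\<^esub> z n) < \<epsilon>" for z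
    using that by (rule complete_A)
  fix a c assume "a \<in> carrier A"
  then obtain x where x: "x \<in> C" "a = cls x" by (rule A_cases)
  show "nrm A a = 0 \<longleftrightarrow> a = \<zero>\<^bsub>A\<^esub>"
  proof
    assume "nrm A a = 0"
    with x cls_nrm[OF x(1)] show "a = \<zero>\<^bsub>A\<^esub>" by (simp add: cls_zero cls_eq_iff C_intros)
  next
    assume "a = \<zero>\<^bsub>A\<^esub>"
    then have "a = cls (\<lambda>n. 0)" by (simp only: cls_zero)
    then show "nrm A a = 0" using nrm_const[OF zero_mem] by (simp only: N_zero)
  qed
  have "(\<lambda>n. N (fscale c (x n))) \<longlonglongrightarrow> cmod c * nrm A a"
    using tendsto_mult_left[OF cls_nrm[OF x(1)], of "cmod c"] x by (simp add: N_scale C_mem)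
  then show "nrm A (scale A c a) = cmod c * nrm A a"
    using x cls_nrm[OF scale_C[OF x(1), of c]] LIMSEQ_unique by (auto simp: cls_scale)
  have "(\<lambda>n. N (fstar (x n) * x n)) \<longlonglongrightarrow> (nrm A a)\<^sup>2"
    using tendsto_power[OF cls_nrm[OF x(1)], of 2] x by (simp add: N_cstar C_mem)
  then show "nrm A (star A a \<otimes>\<^bsub>A\<^esub> a) = (nrm A a)\<^sup>2"
    using x cls_nrm[OF mult_C[OF star_C[OF x(1)] x(1)]] LIMSEQ_unique by (auto simp: cls_star cls_mult C_intros)
  fix b assume "b \<in> carrier A"
  then obtain y where y: "y \<in> C" "b = cls y" by (rule A_cases)
  show "nrm A (a \<oplus>\<^bsub>A\<^esub> b) \<le> nrm A a + nrm A b"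
    using x y by (simp add: cls_add) (intro nrm_le C_intros N_add C_mem; assumption)
  have "nrm A (cls (\<lambda>n. x n * y n)) \<le> nrm A (cls x) * nrm A (cls y)"
    by (rule LIMSEQ_le[OF cls_nrm[OF mult_C] tendsto_mult[OF cls_nrm cls_nrm]])
      (use x y in \<open>simp_all add: N_mult C_mem\<close>)
  then show "nrm A (a \<otimes>\<^bsub>A\<^esub> b) \<le> nrm A a * nrm A b"
    using x y by (simp add: cls_mult)
qed (auto elim!: A_cases simp: cls_mult cls_add cls_scale cls_star C_intros cls_closed fscale_simps
       fstar_add fstar_mult fstar_fscale)

end

lemma star_seminorm_if_rel: "p \<in> rel_seminorms X R \<Longrightarrow> star_seminorm (free_algebra X) p"
  by (intro star_seminorm.intro star_subalgebra_free_algebra star_seminorm_axioms.intro)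
    (simp add: rel_seminorms_def)

text \<open>If the generators are bounded uniformly over all admissible seminorms, then so is every
  element of the free *-algebra, and \<open>universal_cstar X R\<close> is a C*-algebra with the
  expected universal property.\<close>

locale bounded_presentation =
  fixes X :: "'g set" and R :: "('g falg \<times> 'g falg) set"
  assumes relations: "R \<subseteq> free_algebra X \<times> free_algebra X"
    and bounded: "g \<in> X \<Longrightarrow> \<exists>B. \<forall>p\<in>rel_seminorms X R. p (gen g) \<le> B"
begin

sublocale star_subalgebra "free_algebra X"
  by (rule star_subalgebra_free_algebra)

lemma single_le:
  assumes "letter_gen ` set ls \<subseteq> X"
  shows "Poly_Mapping.single (Word ls) c \<in> free_algebra X \<and>
     (\<exists>B. \<forall>p\<in>rel_seminorms X R. p (Poly_Mapping.single (Word ls) c) \<le> B)"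
  using assms
proof (induction ls arbitrary: c)
  case Nil
  have eq: "Poly_Mapping.single (Word []) c = fscale c 1"
    by (simp add: fscale_def zero_word_def)
  have "p (fscale c 1) \<le> cmod c" if "p \<in> rel_seminorms X R" for p
  proof -
    interpret p: star_seminorm "free_algebra X" p using that by (rule star_seminorm_if_rel)
    have "p 1 = (p 1)\<^sup>2" using p.N_cstar[OF one_mem] by simp
    then have "p 1 = 0 \<or> p 1 = 1" by (simp add: power2_eq_square)
    then show ?thesis using p.N_scale[OF one_mem, of c] by auto
  qed
  with eq one_mem fscale_mem show ?case by metis
next
  case (Cons a ls)
  then have IH: "Poly_Mapping.single (Word ls) c \<in> free_algebra X"
    and g: "letter_gen a \<in> X" by auto
  obtain B where B: "\<And>p. p \<in> rel_seminorms X R \<Longrightarrow> p (Poly_Mapping.single (Word ls) c) \<le> B"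
    using Cons by force
  obtain B' where B': "\<And>p. p \<in> rel_seminorms X R \<Longrightarrow> p (gen (letter_gen a)) \<le> B'"
    using bounded[OF g] by blast
  define l where "l = (Poly_Mapping.single (Word [a]) 1 :: 'g falg)"
  have l: "l = gen (letter_gen a) \<or> l = fstar (gen (letter_gen a))"
    by (cases a) (auto simp: l_def gen_def fstar_single word_adj_def)
  then have lF: "l \<in> free_algebra X" using gen_mem[OF g] fstar_mem by metis
  have eq: "Poly_Mapping.single (Word (a # ls)) c = l * Poly_Mapping.single (Word ls) c"
    by (simp add: l_def mult_single plus_word_def)
  have "p (l * Poly_Mapping.single (Word ls) c) \<le> \<bar>B'\<bar> * \<bar>B\<bar>" if p: "p \<in> rel_seminorms X R" for p
  proof -
    interpret p: star_seminorm "free_algebra X" p using p by (rule star_seminorm_if_rel)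
    have "p l \<le> \<bar>B'\<bar>" using l B'[OF p] p.N_star[OF gen_mem[OF g]] by auto
    moreover have "p (Poly_Mapping.single (Word ls) c) \<le> \<bar>B\<bar>" using B[OF p] by simp
    ultimately have "p l * p (Poly_Mapping.single (Word ls) c) \<le> \<bar>B'\<bar> * \<bar>B\<bar>"
      by (intro mult_mono p.N_nonneg IH) auto
    then show ?thesis using p.N_mult[OF lF IH] by linarith
  qed
  then show ?case using eq mult_mem[OF lF IH] by metis
qed

lemma bdd: assumes "x \<in> free_algebra X" shows "bdd_above ((\<lambda>p. p x) ` rel_seminorms X R)"
proof -
  have "x \<in> free_algebra X \<Longrightarrow> \<exists>B. \<forall>p\<in>rel_seminorms X R. p x \<le> B"
  proof (induction x rule: Poly_Mapping.update_induct)
    case const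
    show ?case using star_seminorm_if_rel star_seminorm.N_zero by (intro exI[of _ 0]) fastforce
  next
    case (update f a b)
    have eq: "Poly_Mapping.update a b f = f + Poly_Mapping.single a b"
      using update(1)
      by (intro poly_mapping_eqI) (auto simp: lookup_update lookup_add lookup_single when_def in_keys_iff)
    have keys: "Poly_Mapping.keys (Poly_Mapping.update a b f) = insert a (Poly_Mapping.keys f)"
      using update(2) by (auto simp: in_keys_iff lookup_update split: if_splits)
    have "\<forall>w\<in>insert a (Poly_Mapping.keys f). letter_gen ` set (letters w) \<subseteq> X"
      using update(4) by (simp only: free_algebra_def mem_Collect_eq keys)
    then have f: "f \<in> free_algebra X" and a: "letter_gen ` set (letters a) \<subseteq> X"
      by (simp_all add: free_algebra_def)
    obtain B where B: "\<And>p. p \<in> rel_seminorms X R \<Longrightarrow> p f \<le> B" using update(3)[OF f] by blast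
    obtain B' where s: "Poly_Mapping.single a b \<in> free_algebra X"
      and B': "\<And>p. p \<in> rel_seminorms X R \<Longrightarrow> p (Poly_Mapping.single a b) \<le> B'"
      using single_le[OF a, of b] by auto
    have "p (f + Poly_Mapping.single a b) \<le> B + B'" if "p \<in> rel_seminorms X R" for p
      using star_seminorm.N_add[OF star_seminorm_if_rel[OF that] f s] B[OF that] B'[OF that] by linarith
    then show ?case unfolding eq by blast
  qed
  with assms show ?thesis by (auto simp: bdd_above_def)
qed

lemma zero_rel_seminorm: "(\<lambda>_. 0) \<in> rel_seminorms X R"
  by (auto simp: rel_seminorms_def cstar_seminorm_def)

abbreviation "N \<equiv> universal_seminorm X R"

lemma le_N: "\<lbrakk>p \<in> rel_seminorms X R; x \<in> free_algebra X\<rbrakk> \<Longrightarrow> p x \<le> N x"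
  unfolding universal_seminorm_def by (rule cSUP_upper[OF _ bdd])

lemma N_le: "(\<And>p. p \<in> rel_seminorms X R \<Longrightarrow> p x \<le> B) \<Longrightarrow> N x \<le> B"
  unfolding universal_seminorm_def using zero_rel_seminorm by (intro cSUP_least) auto

lemma N_nonneg': "x \<in> free_algebra X \<Longrightarrow> 0 \<le> N x"
  using le_N[OF zero_rel_seminorm] .

sublocale star_seminorm "free_algebra X" N
proof
  show "cstar_seminorm (free_algebra X) N"
    unfolding cstar_seminorm_def
  proof (intro conjI ballI allI)
    fix x assume x: "x \<in> free_algebra X"
    show "N (fscale c x) = cmod c * N x" for c
    proof (rule antisym)
      have le: "N (fscale c x) \<le> cmod c * N x" if x: "x \<in> free_algebra X" for c x
        by (rule N_le) (simp add: star_seminorm.N_scale[OF star_seminorm_if_rel x] mult_left_mono le_N x)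
      show "N (fscale c x) \<le> cmod c * N x" using x by (rule le)
      show "cmod c * N x \<le> N (fscale c x)"
      proof (cases "c = 0")
        case True
        then show ?thesis using N_nonneg'[OF fscale_mem[OF x, of c]] by simp
      next
        case False
        then have "N x \<le> cmod (1 / c) * N (fscale c x)"
          using le[OF fscale_mem[OF x], of "1 / c" c] by (simp add: fscale_simps)
        with False show ?thesis by (simp add: norm_divide field_simps)
      qed
    qed
    show "N (fstar x * x) = (N x)\<^sup>2"
    proof (rule antisym)
      have "p (fstar x * x) \<le> (N x)\<^sup>2" if p: "p \<in> rel_seminorms X R" for p
      proof -
        interpret p: star_seminorm "free_algebra X" p using p by (rule star_seminorm_if_rel)
        show ?thesis using p.N_cstar[OF x] power_mono[OF le_N[OF p x] p.N_nonneg[OF x], of 2] by simp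
      qed
      then show "N (fstar x * x) \<le> (N x)\<^sup>2" by (rule N_le)
      have "p x \<le> sqrt (N (fstar x * x))" if p: "p \<in> rel_seminorms X R" for p
      proof -
        interpret p: star_seminorm "free_algebra X" p using p by (rule star_seminorm_if_rel)
        have "(p x)\<^sup>2 \<le> N (fstar x * x)"
          using p.N_cstar[OF x] le_N[OF p mult_mem[OF fstar_mem[OF x] x]] by simp
        then show ?thesis by (rule real_le_rsqrt)
      qed
      then have "N x \<le> sqrt (N (fstar x * x))" by (rule N_le)
      then have "(N x)\<^sup>2 \<le> (sqrt (N (fstar x * x)))\<^sup>2" using N_nonneg'[OF x] by (rule power_mono)
      then show "(N x)\<^sup>2 \<le> N (fstar x * x)" using N_nonneg'[OF mult_mem[OF fstar_mem[OF x] x]] by simp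
    qed
    fix y assume y: "y \<in> free_algebra X"
    show "N (x + y) \<le> N x + N y"
    proof (rule N_le)
      fix p assume p: "p \<in> rel_seminorms X R"
      show "p (x + y) \<le> N x + N y"
        using star_seminorm.N_add[OF star_seminorm_if_rel[OF p] x y] le_N[OF p x] le_N[OF p y] by linarith
    qed
    show "N (x * y) \<le> N x * N y"
    proof (rule N_le)
      fix p assume p: "p \<in> rel_seminorms X R"
      interpret p: star_seminorm "free_algebra X" p using p by (rule star_seminorm_if_rel)
      have "p x * p y \<le> N x * N y"
        by (intro mult_mono le_N p x y N_nonneg' p.N_nonneg)
      then show "p (x * y) \<le> N x * N y" using p.N_mult[OF x y] by linarith
    qed
  qed
qed

theorem cstar_algebra_universal: "cstar_algebra (universal_cstar X R)"
  unfolding universal_cstar_def by (rule cstar_algebra_A)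


text \<open>Uniqueness is stated among contractive homomorphisms; *-homomorphisms of C*-algebras are
  automatically contractive.\<close>

theorem universal_property:
  fixes B :: "('b, 'm) cstar_scheme"
  assumes B: "cstar_algebra B"
    and closed: "\<And>x. x \<in> free_algebra X \<Longrightarrow> \<pi> x \<in> carrier B"
    and add: "\<And>x y. \<lbrakk>x \<in> free_algebra X; y \<in> free_algebra X\<rbrakk> \<Longrightarrow> \<pi> (x + y) = \<pi> x \<oplus>\<^bsub>B\<^esub> \<pi> y"
    and mult: "\<And>x y. \<lbrakk>x \<in> free_algebra X; y \<in> free_algebra X\<rbrakk> \<Longrightarrow> \<pi> (x * y) = \<pi> x \<otimes>\<^bsub>B\<^esub> \<pi> y"
    and one: "\<pi> 1 = \<one>\<^bsub>B\<^esub>"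
    and scal: "\<And>c x. x \<in> free_algebra X \<Longrightarrow> \<pi> (fscale c x) = scale B c (\<pi> x)"
    and sta: "\<And>x. x \<in> free_algebra X \<Longrightarrow> \<pi> (fstar x) = star B (\<pi> x)"
    and rel: "\<And>x y. (x, y) \<in> R \<Longrightarrow> \<pi> x = \<pi> y"
  shows "\<exists>!h. h \<in> cstar_hom (universal_cstar X R) B \<and>
    h \<in> extensional (carrier (universal_cstar X R)) \<and>
    (\<forall>a\<in>carrier (universal_cstar X R). nrm B (h a) \<le> nrm (universal_cstar X R) a) \<and>
    (\<forall>x\<in>free_algebra X. h (const_class X R x) = \<pi> x)"
proof -
  interpret B: cstar_algebra B by (rule B)
  let ?F = "free_algebra X"
  let ?d = "\<lambda>a b. nrm B (a \<ominus>\<^bsub>B\<^esub> b)"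
  have zero: "\<pi> 0 = \<zero>\<^bsub>B\<^esub>"
    using scal[OF zero_mem, of 0] closed[OF zero_mem] B.nrm_zero_iff[OF closed[OF zero_mem]] B.nrm_scale[of "\<pi> 0" 0]
    by (simp add: fscale_simps)
  have diff: "\<pi> (x - y) = \<pi> x \<ominus>\<^bsub>B\<^esub> \<pi> y" if "x \<in> ?F" "y \<in> ?F" for x y
  proof -
    have "\<pi> (x - y) \<oplus>\<^bsub>B\<^esub> \<pi> y = \<pi> x" using add[OF diff_mem[OF that] that(2)] by simp
    then show ?thesis using closed that diff_mem[OF that]
      by (metis a_minus_def B.add.inv_closed B.add.m_assoc B.r_neg B.r_zero)
  qed
  have nn: "0 \<le> nrm B a" if "a \<in> carrier B" for a
  proof -
    have "nrm B (a \<oplus>\<^bsub>B\<^esub> scale B (-1) a) \<le> nrm B a + nrm B (scale B (-1) a)"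
      using that by (intro B.nrm_triangle B.scale_closed)
    moreover have "a \<oplus>\<^bsub>B\<^esub> scale B (-1) a = scale B 0 a"
      using B.scale_add_left[OF that, of 1 "-1"] B.scale_one[OF that] by simp
    ultimately show ?thesis using that by (simp add: B.nrm_scale)
  qed
  have tri: "?d a c \<le> ?d a b + ?d b c" if "a \<in> carrier B" "b \<in> carrier B" "c \<in> carrier B" for a b c
  proof -
    have "a \<ominus>\<^bsub>B\<^esub> c = (a \<ominus>\<^bsub>B\<^esub> b) \<oplus>\<^bsub>B\<^esub> (b \<ominus>\<^bsub>B\<^esub> c)"
      using that by (simp add: a_minus_def B.a_assoc[symmetric]) (simp add: B.a_assoc B.l_neg)
    then show ?thesis using B.nrm_triangle[of "a \<ominus>\<^bsub>B\<^esub> b" "b \<ominus>\<^bsub>B\<^esub> c"] that by simp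
  qed
  have neg: "\<ominus>\<^bsub>B\<^esub> a = scale B (-1) a" if "a \<in> carrier B" for a
  proof (rule B.minus_equality)
    have "scale B (-1) a \<oplus>\<^bsub>B\<^esub> a = scale B 0 a"
      using B.scale_add_left[OF that, of "-1" 1] B.scale_one[OF that] by simp
    also have "\<dots> = \<zero>\<^bsub>B\<^esub>"
      using that by (simp flip: B.nrm_zero_iff add: B.scale_closed B.nrm_scale)
    finally show "scale B (-1) a \<oplus>\<^bsub>B\<^esub> a = \<zero>\<^bsub>B\<^esub>" .
  qed (use that in \<open>auto intro: B.scale_closed\<close>)
  have sc_minus: "scale B c (a \<ominus>\<^bsub>B\<^esub> b) = scale B c a \<ominus>\<^bsub>B\<^esub> scale B c b"
    if "a \<in> carrier B" "b \<in> carrier B" for a b c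
    using that by (simp add: a_minus_def neg B.scale_closed B.scale_add_right B.scale_scale mult.commute)
  have comm: "?d a b = ?d b a" if "a \<in> carrier B" "b \<in> carrier B" for a b
  proof -
    have "b \<ominus>\<^bsub>B\<^esub> a = \<ominus>\<^bsub>B\<^esub> (a \<ominus>\<^bsub>B\<^esub> b)"
      using that by (simp add: a_minus_def B.minus_add B.a_comm)
    then show ?thesis using that by (simp add: neg B.nrm_scale)
  qed
  have nstar: "nrm B (star B a) = nrm B a" if a: "a \<in> carrier B" for a
  proof -
    have le: "nrm B z \<le> nrm B (star B z)" if z: "z \<in> carrier B" for z
    proof (cases "nrm B z = 0")
      case True
      with z show ?thesis by (simp add: nn B.star_closed)
    next
      case False
      then have "nrm B z > 0" using nn[OF z] by simp
      moreover have "nrm B z * nrm B z \<le> nrm B (star B z) * nrm B z"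
        using B.nrm_mult[of "star B z" z] B.nrm_cstar[OF z] z by (simp add: B.star_closed power2_eq_square)
      ultimately show ?thesis by simp
    qed
    show ?thesis using le[OF a] le[of "star B a"] a by (simp add: B.star_closed B.star_star)
  qed
  have eqI: "a = b" if "a \<in> carrier B" "b \<in> carrier B" "?d a b \<le> 0" for a b
  proof -
    have "a \<ominus>\<^bsub>B\<^esub> b = \<zero>\<^bsub>B\<^esub>" using that nn[of "a \<ominus>\<^bsub>B\<^esub> b"] by (simp flip: B.nrm_zero_iff)
    then show ?thesis using that B.minus_equality[of a "\<ominus>\<^bsub>B\<^esub> b"] by (simp add: a_minus_def)
  qed
  have le_univ: "nrm B (\<pi> x) \<le> N x" if "x \<in> ?F" for x
  proof (rule le_N[OF _ that])
    show "(\<lambda>x. nrm B (\<pi> x)) \<in> rel_seminorms X R"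
      unfolding rel_seminorms_def cstar_seminorm_def
    proof (intro CollectI conjI ballI allI)
      fix xy assume xy: "xy \<in> R"
      obtain x y where [simp]: "xy = (x, y)" by force
      have F: "x \<in> ?F" "y \<in> ?F" and eq: "\<pi> x = \<pi> y" using xy relations rel by auto
      have "\<pi> (x - y) = \<zero>\<^bsub>B\<^esub>"
        unfolding diff[OF F] eq using B.r_neg[OF closed[OF F(2)]] by (simp only: a_minus_def)
      then show "case xy of (x, y) \<Rightarrow> nrm B (\<pi> (x - y)) = 0" by (simp add: B.nrm_zero_iff)
    qed (simp_all add: add mult scal sta closed fstar_mem B.nrm_triangle B.nrm_mult B.nrm_scale B.nrm_cstar)
  qed
  have d_le: "?d (\<pi> x) (\<pi> y) \<le> N (x - y)" if "x \<in> ?F" "y \<in> ?F" for x y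
    using le_univ[OF diff_mem[OF that]] that by (simp add: diff)
  define L where "L x l \<longleftrightarrow> l \<in> carrier B \<and> (\<lambda>n. ?d (\<pi> (x n)) l) \<longlonglongrightarrow> 0" for x l
  have L_closed: "l \<in> carrier B" if "L x l" for x l using that by (simp add: L_def)
  have L_ex: "\<exists>l. L x l" if x: "x \<in> C" for x
  proof -
    have "\<exists>l\<in>carrier B. (\<lambda>n. ?d (\<pi> (x n)) l) \<longlonglongrightarrow> 0"
    proof (rule B.complete)
      fix e :: real assume "e > 0"
      from C_D[OF x this] show "\<exists>M. \<forall>m\<ge>M. \<forall>n\<ge>M. ?d (\<pi> (x m)) (\<pi> (x n)) < e"
        using d_le C_mem[OF x] by (meson order.strict_trans1)
    qed (use x in \<open>simp add: closed C_mem\<close>)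
    then show ?thesis by (auto simp: L_def)
  qed
  have L_unique: "l = l'" if C: "x \<in> C" "x' \<in> C" and L: "L x l" "L x' l'" and eq: "cls x = cls x'" for x x' l l'
  proof (rule eqI)
    have lim: "(\<lambda>n. ?d (\<pi> (x n)) l + N (x n - x' n) + ?d (\<pi> (x' n)) l') \<longlonglongrightarrow> 0 + 0 + 0"
      using L eq C by (intro tendsto_add) (auto simp: L_def cls_eq_iff)
    have "?d l l' \<le> ?d (\<pi> (x n)) l + N (x n - x' n) + ?d (\<pi> (x' n)) l'" for n
    proof -
      have x: "x n \<in> ?F" "x' n \<in> ?F" using C by (simp_all add: C_mem)
      note c = closed[OF x(1)] closed[OF x(2)] L_closed[OF L(1)] L_closed[OF L(2)]
      show ?thesis
        using tri[OF c(3,1,4)] tri[OF c(1,2,4)] d_le[OF x] comm[OF c(3,1)] by linarith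
    qed
    then show "?d l l' \<le> 0" using LIMSEQ_le_const[OF lim] by (metis add.right_neutral)
  qed (use L in \<open>auto simp: L_def\<close>)
  have L_add: "L (\<lambda>n. x n + y n) (l \<oplus>\<^bsub>B\<^esub> l')"
    if C: "x \<in> C" "y \<in> C" and L: "L x l" "L y l'" for x y l l'
  proof -
    have "(\<lambda>n. ?d (\<pi> (x n)) l + ?d (\<pi> (y n)) l') \<longlonglongrightarrow> 0"
      using L by (intro tendsto_add_zero) (auto simp: L_def)
    then have "(\<lambda>n. ?d (\<pi> (x n + y n)) (l \<oplus>\<^bsub>B\<^esub> l')) \<longlonglongrightarrow> 0"
    proof (rule tendsto_zero_le)
      fix n
      have x: "x n \<in> ?F" "y n \<in> ?F" using C by (simp_all add: C_mem)
      note c = closed[OF x(1)] closed[OF x(2)] L_closed[OF L(1)] L_closed[OF L(2)]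
      show "0 \<le> ?d (\<pi> (x n + y n)) (l \<oplus>\<^bsub>B\<^esub> l')" using c x by (simp add: nn add)
      have "(\<pi> (x n) \<oplus>\<^bsub>B\<^esub> \<pi> (y n)) \<ominus>\<^bsub>B\<^esub> (l \<oplus>\<^bsub>B\<^esub> l') = (\<pi> (x n) \<ominus>\<^bsub>B\<^esub> l) \<oplus>\<^bsub>B\<^esub> (\<pi> (y n) \<ominus>\<^bsub>B\<^esub> l')"
        using c by (simp add: a_minus_def B.minus_add B.a_ac)
      then show "?d (\<pi> (x n + y n)) (l \<oplus>\<^bsub>B\<^esub> l') \<le> ?d (\<pi> (x n)) l + ?d (\<pi> (y n)) l'"
        using c x by (simp add: add B.nrm_triangle)
    qed
    then show ?thesis using L by (simp add: L_def)
  qed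
  have L_mult: "L (\<lambda>n. x n * y n) (l \<otimes>\<^bsub>B\<^esub> l')"
    if C: "x \<in> C" "y \<in> C" and L: "L x l" "L y l'" for x y l l'
  proof -
    obtain K where K: "\<And>n. N (x n) \<le> K" using C_bounded[OF C(1)] by blast
    have "(\<lambda>n. K * ?d (\<pi> (y n)) l' + ?d (\<pi> (x n)) l * nrm B l') \<longlonglongrightarrow> 0"
      using L by (intro tendsto_add_zero tendsto_mult_right_zero tendsto_mult_left_zero) (auto simp: L_def)
    then have "(\<lambda>n. ?d (\<pi> (x n * y n)) (l \<otimes>\<^bsub>B\<^esub> l')) \<longlonglongrightarrow> 0"
    proof (rule tendsto_zero_le)
      fix n
      have x: "x n \<in> ?F" "y n \<in> ?F" using C by (simp_all add: C_mem)
      note c = closed[OF x(1)] closed[OF x(2)] L_closed[OF L(1)] L_closed[OF L(2)]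
      show "0 \<le> ?d (\<pi> (x n * y n)) (l \<otimes>\<^bsub>B\<^esub> l')" using c x by (simp add: nn mult)
      let ?u = "\<pi> (x n) \<otimes>\<^bsub>B\<^esub> (\<pi> (y n) \<ominus>\<^bsub>B\<^esub> l')" and ?v = "(\<pi> (x n) \<ominus>\<^bsub>B\<^esub> l) \<otimes>\<^bsub>B\<^esub> l'"
      have "(\<pi> (x n) \<otimes>\<^bsub>B\<^esub> \<pi> (y n)) \<ominus>\<^bsub>B\<^esub> (l \<otimes>\<^bsub>B\<^esub> l') = ?u \<oplus>\<^bsub>B\<^esub> ?v"
        using c by (simp add: a_minus_def B.r_distr B.l_distr B.r_minus B.l_minus B.a_assoc B.r_neg1)
      then have "?d (\<pi> (x n * y n)) (l \<otimes>\<^bsub>B\<^esub> l') \<le> nrm B ?u + nrm B ?v"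
        using c x by (simp add: mult B.nrm_triangle)
      also have "nrm B ?u \<le> nrm B (\<pi> (x n)) * ?d (\<pi> (y n)) l'" using c by (intro B.nrm_mult) auto
      also have "\<dots> \<le> K * ?d (\<pi> (y n)) l'"
        using le_univ[OF x(1)] K[of n] c by (intro mult_right_mono nn) auto
      also have "nrm B ?v \<le> ?d (\<pi> (x n)) l * nrm B l'" using c by (intro B.nrm_mult) auto
      finally show "?d (\<pi> (x n * y n)) (l \<otimes>\<^bsub>B\<^esub> l') \<le> K * ?d (\<pi> (y n)) l' + ?d (\<pi> (x n)) l * nrm B l'"
        by simp
    qed
    then show ?thesis using L by (simp add: L_def)
  qed
  have L_scale: "L (\<lambda>n. fscale c (x n)) (scale B c l)" if C: "x \<in> C" and L: "L x l" for x l c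
  proof -
    have "(\<lambda>n. cmod c * ?d (\<pi> (x n)) l) \<longlonglongrightarrow> 0"
      using L by (intro tendsto_mult_right_zero) (auto simp: L_def)
    then show ?thesis using L C
      by (simp add: L_def scal C_mem closed B.scale_closed B.nrm_scale flip: sc_minus)
  qed
  have L_star: "L (\<lambda>n. fstar (x n)) (star B l)" if C: "x \<in> C" and L: "L x l" for x l
  proof -
    have st: "star B (a \<ominus>\<^bsub>B\<^esub> b) = star B a \<ominus>\<^bsub>B\<^esub> star B b" if "a \<in> carrier B" "b \<in> carrier B" for a b
      using that by (simp add: a_minus_def neg B.star_add B.star_scale B.scale_closed B.star_closed)
    show ?thesis using L C
      by (simp add: L_def sta C_mem closed B.star_closed nstar flip: st)
  qed
  have L_const: "L (\<lambda>n. x) (\<pi> x)" if "x \<in> ?F" for x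
    using that closed[OF that] B.nrm_zero_iff[OF B.zero_closed] by (simp add: L_def a_minus_def B.r_neg)
  have L_nrm: "nrm B l \<le> nrm A (cls x)" if C: "x \<in> C" and L: "L x l" for x l
  proof -
    have lim: "(\<lambda>n. ?d (\<pi> (x n)) l + N (x n)) \<longlonglongrightarrow> 0 + nrm A (cls x)"
      using L cls_nrm[OF C] by (intro tendsto_add) (auto simp: L_def)
    have "nrm B l \<le> ?d (\<pi> (x n)) l + N (x n)" for n
    proof -
      have x: "x n \<in> ?F" using C by (simp add: C_mem)
      note c = closed[OF x] L_closed[OF L]
      have m0: "a \<ominus>\<^bsub>B\<^esub> \<zero>\<^bsub>B\<^esub> = a" if "a \<in> carrier B" for a using that by (simp add: a_minus_def)
      show ?thesis
        using tri[OF c(2,1) B.zero_closed] comm[OF c] le_univ[OF x] m0[OF c(1)] m0[OF c(2)] by simp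
    qed
    then show ?thesis using LIMSEQ_le_const[OF lim] by (metis add_0)
  qed
  define h where "h = (\<lambda>a\<in>carrier A. THE l. \<exists>x\<in>C. a = cls x \<and> L x l)"
  have h_eq: "h (cls x) = l" if "x \<in> C" "L x l" for x l
  proof -
    have "(THE l. \<exists>y\<in>C. cls x = cls y \<and> L y l) = l"
      using that L_unique by (intro the_equality) (blast, metis)
    then show ?thesis using that by (simp add: h_def cls_closed)
  qed
  have hom: "h \<in> cstar_hom A B"
    unfolding cstar_hom_def
  proof (intro CollectI conjI ballI allI)
    show "h \<in> ring_hom A B"
    proof (rule ring_hom_memI)
      fix a assume "a \<in> carrier A"
      then obtain x where x: "x \<in> C" "a = cls x" by (rule A_cases)
      obtain l where l: "L x l" using L_ex[OF x(1)] by blast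
      show "h a \<in> carrier B" using h_eq[OF x(1) l] L_closed[OF l] x by simp
      fix b assume "b \<in> carrier A"
      then obtain y where y: "y \<in> C" "b = cls y" by (rule A_cases)
      obtain l' where l': "L y l'" using L_ex[OF y(1)] by blast
      show "h (a \<otimes>\<^bsub>A\<^esub> b) = h a \<otimes>\<^bsub>B\<^esub> h b"
        using h_eq[OF mult_C[OF x(1) y(1)] L_mult[OF x(1) y(1) l l']] h_eq[OF x(1) l] h_eq[OF y(1) l'] x y
        by (simp add: cls_mult)
      show "h (a \<oplus>\<^bsub>A\<^esub> b) = h a \<oplus>\<^bsub>B\<^esub> h b"
        using h_eq[OF add_C[OF x(1) y(1)] L_add[OF x(1) y(1) l l']] h_eq[OF x(1) l] h_eq[OF y(1) l'] x y
        by (simp add: cls_add)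
    next
      show "h \<one>\<^bsub>A\<^esub> = \<one>\<^bsub>B\<^esub>"
        using h_eq[OF const_C[OF one_mem] L_const[OF one_mem]] one by (simp only: cls_one)
    qed
    fix a assume "a \<in> carrier A"
    then obtain x where x: "x \<in> C" "a = cls x" by (rule A_cases)
    obtain l where l: "L x l" using L_ex[OF x(1)] by blast
    show "h (scale A c a) = scale B c (h a)" for c
      using h_eq[OF scale_C[OF x(1)] L_scale[OF x(1) l]] h_eq[OF x(1) l] x by (simp add: cls_scale)
    show "h (star A a) = star B (h a)"
      using h_eq[OF star_C[OF x(1)] L_star[OF x(1) l]] h_eq[OF x(1) l] x by (simp add: cls_star)
  qed
  have ctr: "nrm B (h a) \<le> nrm A a" if "a \<in> carrier A" for a
  proof -
    from that obtain x where x: "x \<in> C" "a = cls x" by (rule A_cases)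
    obtain l where l: "L x l" using L_ex[OF x(1)] by blast
    show ?thesis using h_eq[OF x(1) l] L_nrm[OF x(1) l] x by simp
  qed
  have ext: "h (cls (\<lambda>n. x)) = \<pi> x" if "x \<in> ?F" for x
    using h_eq[OF const_C[OF that] L_const[OF that]] .
  have uniq: "h' = h"
    if h': "h' \<in> cstar_hom A B" "h' \<in> extensional (carrier A)"
      "\<And>a. a \<in> carrier A \<Longrightarrow> nrm B (h' a) \<le> nrm A a" "\<And>x. x \<in> ?F \<Longrightarrow> h' (cls (\<lambda>n. x)) = \<pi> x" for h'
  proof (rule extensionalityI[OF h'(2)])
    show "h \<in> extensional (carrier A)" by (simp add: h_def)
    fix a assume a: "a \<in> carrier A"
    then obtain x where x: "x \<in> C" "a = cls x" by (rule A_cases)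
    interpret A: cstar_algebra A by (rule cstar_algebra_A)
    have rh: "ring_hom_ring A B h'"
      using h'(1) by (intro ring_hom_ringI2) (auto simp: cstar_hom_def A.ring_axioms B.ring_axioms)
    interpret h': ring_hom_ring A B h' by (rule rh)
    have "(\<lambda>k. ?d (\<pi> (x k)) (h' a)) \<longlonglongrightarrow> 0"
    proof (rule tendsto_zero_le[OF dense[OF x(1)]])
      fix k
      have k: "cls (\<lambda>n. x k) \<in> carrier A" "x k \<in> ?F" using x by (simp_all add: cls_closed const_C C_mem)
      show "0 \<le> ?d (\<pi> (x k)) (h' a)" using k a by (simp add: nn closed)
      have "h' (a \<ominus>\<^bsub>A\<^esub> cls (\<lambda>n. x k)) = h' a \<ominus>\<^bsub>B\<^esub> \<pi> (x k)"
        using a k h'(4)[OF k(2)] by (simp add: a_minus_def a_minus_def)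
      then have "?d (h' a) (\<pi> (x k)) \<le> nrm A (a \<ominus>\<^bsub>A\<^esub> cls (\<lambda>n. x k))"
        using h'(3)[of "a \<ominus>\<^bsub>A\<^esub> cls (\<lambda>n. x k)"] a k by simp
      then show "?d (\<pi> (x k)) (h' a) \<le> nrm A (cls x \<ominus>\<^bsub>A\<^esub> cls (\<lambda>n. x k))"
        using comm[of "\<pi> (x k)" "h' a"] k a x closed by simp
    qed
    then have "L x (h' a)" using a by (simp add: L_def)
    then show "h' a = h a" using h_eq[OF x(1)] x by simp
  qed
  have U: "universal_cstar X R = A" "\<And>x. const_class X R x = cls (\<lambda>n. x)"
    by (simp_all add: universal_cstar_def const_class_def)
  show ?thesis
    unfolding U
  proof (rule ex1I[of _ h], intro conjI ballI hom ctr ext)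
    show "h \<in> extensional (carrier A)" by (simp add: h_def)
  next
    fix h' assume "h' \<in> cstar_hom A B \<and> h' \<in> extensional (carrier A) \<and>
      (\<forall>a\<in>carrier A. nrm B (h' a) \<le> nrm A a) \<and> (\<forall>x\<in>?F. h' (cls (\<lambda>n. x)) = \<pi> x)"
    then show "h' = h" by (elim conjE) (rule uniq; blast)
  qed
qed

end

section \<open>Paths\<close>

text \<open>For an edge \<open>e\<close>, the range is \<open>r(e) = head E e\<close> and the source is \<open>s(e) = tail E e\<close>.
  A path \<open>\<mu> = \<mu>\<^sub>1\<dots>\<mu>\<^sub>k\<close> satisfies \<open>s(\<mu>\<^sub>i) = r(\<mu>\<^sub>i\<^sub>+\<^sub>1)\<close>, so it runs against the direction of
  the library's walks. It is encoded as the pair \<open>(r(\<mu>), [\<mu>\<^sub>1, \<dots>, \<mu>\<^sub>k])\<close>; the vertex \<open>v\<close> is the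
  path \<open>(v, [])\<close> of length 0.\<close>

type_synonym ('v, 'e) path = "'v \<times> 'e list"

fun walk :: "('v, 'e) pre_digraph \<Rightarrow> 'v \<Rightarrow> 'e list \<Rightarrow> bool" where
  "walk E v [] \<longleftrightarrow> v \<in> verts E"
| "walk E v (e # es) \<longleftrightarrow> e \<in> arcs E \<and> head E e = v \<and> walk E (tail E e) es"

definition paths :: "('v, 'e) pre_digraph \<Rightarrow> ('v, 'e) path set" where
  "paths E = {(v, es). v \<in> verts E \<and> walk E v es}"

definition rng :: "('v, 'e) path \<Rightarrow> 'v" where
  "rng \<mu> = fst \<mu>"

definition src :: "('v, 'e) pre_digraph \<Rightarrow> ('v, 'e) path \<Rightarrow> 'v" where
  "src E \<mu> = (if snd \<mu> = [] then fst \<mu> else tail E (last (snd \<mu>)))"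

definition len :: "('v, 'e) path \<Rightarrow> nat" where
  "len \<mu> = length (snd \<mu>)"

text \<open>Only meaningful if \<open>src E \<mu> = rng \<nu>\<close>.\<close>

definition cat :: "('v, 'e) path \<Rightarrow> ('v, 'e) path \<Rightarrow> ('v, 'e) path" where
  "cat \<mu> \<nu> = (fst \<mu>, snd \<mu> @ snd \<nu>)"

definition edge_path :: "('v, 'e) pre_digraph \<Rightarrow> 'e \<Rightarrow> ('v, 'e) path" where
  "edge_path E e = (head E e, [e])"

definition paths_from :: "('v, 'e) pre_digraph \<Rightarrow> 'v \<Rightarrow> ('v, 'e) path set" where
  "paths_from E v = {\<mu> \<in> paths E. rng \<mu> = v}"

definition edges_from :: "('v, 'e) pre_digraph \<Rightarrow> 'v \<Rightarrow> 'e set" where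
  "edges_from E v = {e \<in> arcs E. head E e = v}"

definition no_sources :: "('v, 'e) pre_digraph \<Rightarrow> bool" where
  "no_sources E \<longleftrightarrow> (\<forall>v\<in>verts E. edges_from E v \<noteq> {})"


section \<open>Exel-Pardo self-similar groups on graphs\<close>

locale self_similar_group =
  group K + wf_digraph E +
  vertex_action: group_action K "verts E" \<sigma>0 + edge_action: group_action K "arcs E" \<sigma>1
  for K :: "('k, 'm) monoid_scheme" (structure) and E :: "('v, 'e) pre_digraph"
    and \<sigma>0 :: "'k \<Rightarrow> 'v \<Rightarrow> 'v" and \<sigma>1 :: "'k \<Rightarrow> 'e \<Rightarrow> 'e" and \<phi> :: "'k \<Rightarrow> 'e \<Rightarrow> 'k" +
  assumes no_sources: "no_sources E"
    and head_equivariant: "\<lbrakk>k \<in> carrier K; e \<in> arcs E\<rbrakk> \<Longrightarrow> head E (\<sigma>1 k e) = \<sigma>0 k (head E e)"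
    and tail_equivariant: "\<lbrakk>k \<in> carrier K; e \<in> arcs E\<rbrakk> \<Longrightarrow> tail E (\<sigma>1 k e) = \<sigma>0 k (tail E e)"
    and cocycle_closed: "\<lbrakk>k \<in> carrier K; e \<in> arcs E\<rbrakk> \<Longrightarrow> \<phi> k e \<in> carrier K"
    and cocycle: "\<lbrakk>k \<in> carrier K; l \<in> carrier K; e \<in> arcs E\<rbrakk> \<Longrightarrow>
          \<phi> (k \<otimes> l) e = \<phi> k (\<sigma>1 l e) \<otimes> \<phi> l e"
    and cocycle_vertex: "\<lbrakk>k \<in> carrier K; e \<in> arcs E; v \<in> verts E\<rbrakk> \<Longrightarrow> \<sigma>0 (\<phi> k e) v = \<sigma>0 k v"

text \<open>The pair \<open>(\<sigma>s, \<phi>s)\<close> extends \<open>(\<sigma>, \<phi>)\<close> to all paths. The value of \<open>\<phi>s\<close> on vertices is left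
  open; the usual normalisation is \<open>\<phi>s k (v, []) = k\<close>.\<close>

locale path_extension =
  self_similar_group K E \<sigma>0 \<sigma>1 \<phi> + path_action: group_action K "paths E" \<sigma>s
  for K :: "('k, 'm) monoid_scheme" (structure) and E :: "('v, 'e) pre_digraph"
    and \<sigma>0 \<sigma>1 \<phi> and \<sigma>s :: "'k \<Rightarrow> ('v, 'e) path \<Rightarrow> ('v, 'e) path"
    and \<phi>s :: "'k \<Rightarrow> ('v, 'e) path \<Rightarrow> 'k" +
  assumes act_vertex: "\<lbrakk>k \<in> carrier K; v \<in> verts E\<rbrakk> \<Longrightarrow> \<sigma>s k (v, []) = (\<sigma>0 k v, [])"
    and act_edge: "\<lbrakk>k \<in> carrier K; e \<in> arcs E\<rbrakk> \<Longrightarrow> \<sigma>s k (edge_path E e) = edge_path E (\<sigma>1 k e)"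
    and coc_edge: "\<lbrakk>k \<in> carrier K; e \<in> arcs E\<rbrakk> \<Longrightarrow> \<phi>s k (edge_path E e) = \<phi> k e"
    and coc_closed: "\<lbrakk>k \<in> carrier K; \<mu> \<in> paths E\<rbrakk> \<Longrightarrow> \<phi>s k \<mu> \<in> carrier K"
    and coc_mult: "\<lbrakk>k \<in> carrier K; l \<in> carrier K; \<mu> \<in> paths E\<rbrakk> \<Longrightarrow>
          \<phi>s (k \<otimes> l) \<mu> = \<phi>s k (\<sigma>s l \<mu>) \<otimes> \<phi>s l \<mu>"
    and act_len: "\<lbrakk>k \<in> carrier K; \<mu> \<in> paths E\<rbrakk> \<Longrightarrow> len (\<sigma>s k \<mu>) = len \<mu>"
    and act_rng: "\<lbrakk>k \<in> carrier K; \<mu> \<in> paths E\<rbrakk> \<Longrightarrow> rng (\<sigma>s k \<mu>) = \<sigma>0 k (rng \<mu>)"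
    and act_src: "\<lbrakk>k \<in> carrier K; \<mu> \<in> paths E\<rbrakk> \<Longrightarrow> src E (\<sigma>s k \<mu>) = \<sigma>0 k (src E \<mu>)"
    and coc_vertex: "\<lbrakk>k \<in> carrier K; \<mu> \<in> paths E; v \<in> verts E\<rbrakk> \<Longrightarrow> \<sigma>0 (\<phi>s k \<mu>) v = \<sigma>0 k v"
    and act_cat: "\<lbrakk>k \<in> carrier K; \<mu> \<in> paths E; \<nu> \<in> paths E; src E \<mu> = rng \<nu>\<rbrakk> \<Longrightarrow>
          \<sigma>s k (cat \<mu> \<nu>) = cat (\<sigma>s k \<mu>) (\<sigma>s (\<phi>s k \<mu>) \<nu>)"
    and coc_cat: "\<lbrakk>k \<in> carrier K; \<mu> \<in> paths E; \<nu> \<in> paths E; src E \<mu> = rng \<nu>\<rbrakk> \<Longrightarrow>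
          \<phi>s k (cat \<mu> \<nu>) = \<phi>s (\<phi>s k \<mu>) \<nu>"

lemma src_Nil [simp]: "src E (v, []) = v"
  and src_Cons [simp]: "src E (v, e # es) = src E (tail E e, es)"
  by (simp_all add: src_def)

lemma src_edge_path [simp]: "src E (edge_path E e) = tail E e"
  by (simp add: edge_path_def)

lemma cat_edge_path: "cat (edge_path E e) (v, es) = (head E e, e # es)"
  by (simp add: edge_path_def cat_def)

lemma src_cat: "src E \<mu> = rng \<nu> \<Longrightarrow> src E (cat \<mu> \<nu>) = src E \<nu>"
  by (cases \<mu>; cases \<nu>) (auto simp: src_def cat_def rng_def)

lemma len_cat: "len (cat \<mu> \<nu>) = len \<mu> + len \<nu>" and rng_cat: "rng (cat \<mu> \<nu>) = rng \<mu>"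
  by (simp_all add: len_def cat_def rng_def)

context wf_digraph
begin

lemma walk_verts: "walk G v es \<Longrightarrow> v \<in> verts G"
  by (cases es) auto

lemma paths_iff: "(v, es) \<in> paths G \<longleftrightarrow> walk G v es"
  by (auto simp: paths_def walk_verts)

lemma src_closed: "\<mu> \<in> paths G \<Longrightarrow> src G \<mu> \<in> verts G"
proof (cases \<mu>)
  fix v es assume "\<mu> = (v, es)" "\<mu> \<in> paths G"
  then have "walk G v es" by (simp add: paths_iff)
  then have "src G (v, es) \<in> verts G" by (induction es arbitrary: v) auto
  with \<open>\<mu> = (v, es)\<close> show ?thesis by simp
qed

lemma edge_path_closed: "e \<in> arcs G \<Longrightarrow> edge_path G e \<in> paths G"
  by (simp add: edge_path_def paths_iff)

lemma walk_append: "walk G v (xs @ ys) \<longleftrightarrow> walk G v xs \<and> walk G (src G (v, xs)) ys"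
  by (induction xs arbitrary: v) (auto simp: walk_verts)

lemma cat_closed: "\<lbrakk>\<mu> \<in> paths G; \<nu> \<in> paths G; src G \<mu> = rng \<nu>\<rbrakk> \<Longrightarrow> cat \<mu> \<nu> \<in> paths G"
  by (cases \<mu>; cases \<nu>) (simp add: cat_def paths_iff walk_append rng_def)

end

text \<open>The extension exists, with the usual normalisation on vertices, and is unique up to the values
  of the cocycle on vertices.\<close>

fun ext_edges :: "('k \<Rightarrow> 'e \<Rightarrow> 'e) \<Rightarrow> ('k \<Rightarrow> 'e \<Rightarrow> 'k) \<Rightarrow> 'k \<Rightarrow> 'e list \<Rightarrow> 'e list" where
  "ext_edges \<sigma>1 \<phi> k [] = []"
| "ext_edges \<sigma>1 \<phi> k (e # es) = \<sigma>1 k e # ext_edges \<sigma>1 \<phi> (\<phi> k e) es"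

fun ext_cocycle :: "('k \<Rightarrow> 'e \<Rightarrow> 'k) \<Rightarrow> 'k \<Rightarrow> 'e list \<Rightarrow> 'k" where
  "ext_cocycle \<phi> k [] = k"
| "ext_cocycle \<phi> k (e # es) = ext_cocycle \<phi> (\<phi> k e) es"

context self_similar_group
begin

lemma walk_arcs: "walk E v es \<Longrightarrow> set es \<subseteq> arcs E"
  by (induction es arbitrary: v) auto

lemma v_closed: "\<lbrakk>k \<in> carrier K; v \<in> verts E\<rbrakk> \<Longrightarrow> \<sigma>0 k v \<in> verts E"
  using vertex_action.element_image by blast

lemma e_closed: "\<lbrakk>k \<in> carrier K; e \<in> arcs E\<rbrakk> \<Longrightarrow> \<sigma>1 k e \<in> arcs E"
  using edge_action.element_image by blast

lemma c_closed: "\<lbrakk>k \<in> carrier K; set es \<subseteq> arcs E\<rbrakk> \<Longrightarrow> ext_cocycle \<phi> k es \<in> carrier K"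
  by (induction es arbitrary: k) (auto simp: cocycle_closed)

lemma c_vertex: "\<lbrakk>k \<in> carrier K; set es \<subseteq> arcs E; v \<in> verts E\<rbrakk> \<Longrightarrow> \<sigma>0 (ext_cocycle \<phi> k es) v = \<sigma>0 k v"
  by (induction es arbitrary: k) (auto simp: cocycle_closed cocycle_vertex)

lemma x_walk: "\<lbrakk>k \<in> carrier K; walk E v es\<rbrakk> \<Longrightarrow> walk E (\<sigma>0 k v) (ext_edges \<sigma>1 \<phi> k es)"
proof (induction es arbitrary: k v)
  case (Cons e es)
  have "walk E (\<sigma>0 (\<phi> k e) (tail E e)) (ext_edges \<sigma>1 \<phi> (\<phi> k e) es)"
    using Cons by (auto simp: cocycle_closed)
  with Cons.prems show ?case by (auto simp: e_closed head_equivariant tail_equivariant cocycle_vertex)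
qed (simp add: v_closed)

lemma x_arcs: "\<lbrakk>k \<in> carrier K; set es \<subseteq> arcs E\<rbrakk> \<Longrightarrow> set (ext_edges \<sigma>1 \<phi> k es) \<subseteq> arcs E"
  by (induction es arbitrary: k) (auto simp: e_closed cocycle_closed)

lemma x_mult: "\<lbrakk>k \<in> carrier K; l \<in> carrier K; set es \<subseteq> arcs E\<rbrakk> \<Longrightarrow> ext_edges \<sigma>1 \<phi> (k \<otimes> l) es = ext_edges \<sigma>1 \<phi> k (ext_edges \<sigma>1 \<phi> l es)"
  by (induction es arbitrary: k l)
    (auto simp: cocycle cocycle_closed e_closed edge_action.composition_rule)

lemma c_mult: "\<lbrakk>k \<in> carrier K; l \<in> carrier K; set es \<subseteq> arcs E\<rbrakk> \<Longrightarrow> ext_cocycle \<phi> (k \<otimes> l) es = ext_cocycle \<phi> k (ext_edges \<sigma>1 \<phi> l es) \<otimes> ext_cocycle \<phi> l es"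
  by (induction es arbitrary: k l) (auto simp: cocycle cocycle_closed e_closed)

lemma cocycle_one: assumes "e \<in> arcs E" shows "\<phi> \<one> e = \<one>"
proof -
  have "\<sigma>1 \<one> e = e" using edge_action.id_eq_one assms by (metis restrict_apply')
  then have "\<phi> \<one> e \<otimes> \<phi> \<one> e = \<phi> \<one> e"
    using cocycle[OF one_closed one_closed assms] by simp
  then show ?thesis using cocycle_closed[OF one_closed assms] by simp
qed

lemma x_one: "set es \<subseteq> arcs E \<Longrightarrow> ext_edges \<sigma>1 \<phi> \<one> es = es"
proof (induction es)
  case (Cons e es)
  then show ?case using edge_action.id_eq_one by (auto simp: cocycle_one) (metis restrict_apply')
qed simp

lemma x_append: "ext_edges \<sigma>1 \<phi> k (es @ fs) = ext_edges \<sigma>1 \<phi> k es @ ext_edges \<sigma>1 \<phi> (ext_cocycle \<phi> k es) fs"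
  by (induction es arbitrary: k) auto

lemma c_append: "ext_cocycle \<phi> k (es @ fs) = ext_cocycle \<phi> (ext_cocycle \<phi> k es) fs"
  by (induction es arbitrary: k) auto

lemma x_src: "\<lbrakk>k \<in> carrier K; walk E v es\<rbrakk> \<Longrightarrow> src E (\<sigma>0 k v, ext_edges \<sigma>1 \<phi> k es) = \<sigma>0 k (src E (v, es))"
proof (induction es arbitrary: k v)
  case (Cons e es)
  then have e: "e \<in> arcs E" and w: "walk E (tail E e) es" by auto
  have "src E (\<sigma>0 k v, ext_edges \<sigma>1 \<phi> k (e # es)) = src E (\<sigma>0 (\<phi> k e) (tail E e), ext_edges \<sigma>1 \<phi> (\<phi> k e) es)"
    using Cons.prems(1) e by (simp add: tail_equivariant cocycle_vertex)
  also have "\<dots> = \<sigma>0 (\<phi> k e) (src E (tail E e, es))"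
    using Cons.prems(1) e w by (intro Cons.IH) (auto simp: cocycle_closed)
  also have "\<dots> = \<sigma>0 k (src E (tail E e, es))"
    using Cons.prems(1) e w by (intro cocycle_vertex src_closed) (auto simp: paths_iff)
  finally show ?case by simp
qed simp

lemma len_x: "length (ext_edges \<sigma>1 \<phi> k es) = length es"
  by (induction es arbitrary: k) auto

theorem path_extension_exists:
  "\<exists>\<sigma>s \<phi>s. path_extension K E \<sigma>0 \<sigma>1 \<phi> \<sigma>s \<phi>s \<and> (\<forall>k\<in>carrier K. \<forall>v\<in>verts E. \<phi>s k (v, []) = k)"
proof -
  define \<sigma>s where "\<sigma>s k = (\<lambda>(v, es)\<in>paths E. (\<sigma>0 k v, ext_edges \<sigma>1 \<phi> k es))" for k
  define \<phi>s where "\<phi>s k = (\<lambda>(v :: 'v, es). ext_cocycle \<phi> k es)" for k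
  have s: "\<sigma>s k (v, es) = (\<sigma>0 k v, ext_edges \<sigma>1 \<phi> k es)" if "walk E v es" for k v es
    using that by (simp add: \<sigma>s_def paths_iff)
  have closed: "\<sigma>s k \<mu> \<in> paths E" if "k \<in> carrier K" "\<mu> \<in> paths E" for k \<mu>
    using that by (cases \<mu>) (simp add: s paths_iff x_walk)
  have mult: "\<sigma>s (k \<otimes> l) \<mu> = \<sigma>s k (\<sigma>s l \<mu>)" if "k \<in> carrier K" "l \<in> carrier K" "\<mu> \<in> paths E" for k l \<mu>
    using that by (cases \<mu>)
      (simp add: s paths_iff x_walk x_mult walk_arcs walk_verts vertex_action.composition_rule)
  have one: "\<sigma>s \<one> \<mu> = \<mu>" if "\<mu> \<in> paths E" for \<mu>
  proof (cases \<mu>)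
    case (Pair v es)
    have "\<sigma>0 \<one> v = v" if "v \<in> verts E" using vertex_action.id_eq_one that by (metis restrict_apply')
    with Pair that show ?thesis by (simp add: s paths_iff x_one walk_arcs walk_verts)
  qed
  have Bij: "\<sigma>s k \<in> Bij (paths E)" if k: "k \<in> carrier K" for k
  proof -
    have "bij_betw (\<sigma>s k) (paths E) (paths E)"
      by (rule bij_betw_byWitness[where f' = "\<sigma>s (inv k)"])
        (use k in \<open>auto simp: closed one simp flip: mult\<close>)
    then show ?thesis by (simp add: Bij_def \<sigma>s_def)
  qed
  have "\<sigma>s \<in> hom K (BijGroup (paths E))"
  proof (rule homI)
    fix k l assume "k \<in> carrier K" "l \<in> carrier K"
    then show "\<sigma>s (k \<otimes> l) = \<sigma>s k \<otimes>\<^bsub>BijGroup (paths E)\<^esub> \<sigma>s l"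
      by (auto simp: BijGroup_def Bij compose_def mult intro!: extensionalityI[of _ "paths E"])
        (auto simp: \<sigma>s_def)
  qed (simp add: BijGroup_def Bij)
  then have act: "group_action K (paths E) \<sigma>s"
    by (intro group_action.intro group_hom.intro group_hom_axioms.intro group_BijGroup) (rule group_axioms)
  have "path_extension K E \<sigma>0 \<sigma>1 \<phi> \<sigma>s \<phi>s"
  proof (intro path_extension.intro path_extension_axioms.intro act self_similar_group_axioms)
    fix k assume k: "k \<in> carrier K"
    show "\<sigma>s k (v, []) = (\<sigma>0 k v, [])" if "v \<in> verts E" for v using that by (simp add: s)
    show "\<sigma>s k (edge_path E e) = edge_path E (\<sigma>1 k e)" if "e \<in> arcs E" for e
      using that k by (simp add: edge_path_def s head_equivariant)
    show "\<phi>s k (edge_path E e) = \<phi> k e" for e by (simp add: edge_path_def \<phi>s_def)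
    fix \<mu> :: "('v, 'e) path" assume \<mu>: "\<mu> \<in> paths E"
    obtain v es where [simp]: "\<mu> = (v, es)" by (cases \<mu>)
    have w: "walk E v es" using \<mu> by (simp add: paths_iff)
    show "\<phi>s k \<mu> \<in> carrier K" using w k by (simp add: \<phi>s_def c_closed walk_arcs)
    show "\<phi>s (k \<otimes> l) \<mu> = \<phi>s k (\<sigma>s l \<mu>) \<otimes> \<phi>s l \<mu>" if "l \<in> carrier K" for l
      using w k that by (simp add: \<phi>s_def s c_mult walk_arcs)
    show "len (\<sigma>s k \<mu>) = len \<mu>" using w by (simp add: s len_def len_x)
    show "rng (\<sigma>s k \<mu>) = \<sigma>0 k (rng \<mu>)" using w by (simp add: s rng_def)
    show "src E (\<sigma>s k \<mu>) = \<sigma>0 k (src E \<mu>)" using w k by (simp add: s x_src)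
    show "\<sigma>0 (\<phi>s k \<mu>) u = \<sigma>0 k u" if "u \<in> verts E" for u
      using w k that by (simp add: \<phi>s_def c_vertex walk_arcs)
    fix \<nu> :: "('v, 'e) path" assume \<nu>: "\<nu> \<in> paths E" and sr: "src E \<mu> = rng \<nu>"
    obtain u fs where [simp]: "\<nu> = (u, fs)" by (cases \<nu>)
    have "walk E u fs" "walk E v (es @ fs)" using \<nu> sr w by (simp_all add: paths_iff rng_def walk_append)
    with w show "\<sigma>s k (cat \<mu> \<nu>) = cat (\<sigma>s k \<mu>) (\<sigma>s (\<phi>s k \<mu>) \<nu>)"
      by (simp add: cat_def s \<phi>s_def x_append)
    show "\<phi>s k (cat \<mu> \<nu>) = \<phi>s (\<phi>s k \<mu>) \<nu>" by (simp add: cat_def \<phi>s_def c_append)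
  qed
  then show ?thesis by (intro exI[of _ \<sigma>s] exI[of _ \<phi>s]) (simp add: \<phi>s_def)
qed

end

context path_extension
begin

lemma path_act_eq: "\<lbrakk>k \<in> carrier K; walk E v es\<rbrakk> \<Longrightarrow> \<sigma>s k (v, es) = (\<sigma>0 k v, ext_edges \<sigma>1 \<phi> k es)"
proof (induction es arbitrary: k v)
  case (Cons e es)
  then have e: "e \<in> arcs E" and v: "v = head E e" and w: "walk E (tail E e) es" by auto
  have "\<sigma>s k (cat (edge_path E e) (tail E e, es)) =
      cat (\<sigma>s k (edge_path E e)) (\<sigma>s (\<phi>s k (edge_path E e)) (tail E e, es))"
    using Cons.prems(1) e w by (intro act_cat) (auto simp: edge_path_closed paths_iff rng_def)
  also have "\<dots> = cat (edge_path E (\<sigma>1 k e)) (\<sigma>0 (\<phi> k e) (tail E e), ext_edges \<sigma>1 \<phi> (\<phi> k e) es)"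
    using Cons.prems(1) e w by (simp add: act_edge coc_edge Cons.IH cocycle_closed)
  finally show ?case using Cons.prems(1) e by (simp add: cat_edge_path v head_equivariant)
qed (simp add: act_vertex)

lemma path_cocycle_eq: "\<lbrakk>k \<in> carrier K; walk E v es; es \<noteq> []\<rbrakk> \<Longrightarrow> \<phi>s k (v, es) = ext_cocycle \<phi> k es"
proof (induction es arbitrary: k v)
  case (Cons e es)
  then have e: "e \<in> arcs E" and v: "v = head E e" and w: "walk E (tail E e) es" by auto
  show ?case
  proof (cases "es = []")
    case True
    then show ?thesis using coc_edge[OF Cons.prems(1) e] by (simp add: edge_path_def v)
  next
    case False
    have "\<phi>s k (cat (edge_path E e) (tail E e, es)) = \<phi>s (\<phi>s k (edge_path E e)) (tail E e, es)"
      using Cons.prems(1) e w by (intro coc_cat) (auto simp: edge_path_closed paths_iff rng_def)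
    then show ?thesis using Cons.prems(1) e w False
      by (simp add: cat_edge_path v coc_edge Cons.IH cocycle_closed)
  qed
qed simp

end

section \<open>Groupoids and self-similar groupoid actions\<close>

record ('g, 'v) gpd =
  arr :: "'g set"
  obj :: "'v set"
  dm :: "'g \<Rightarrow> 'v"
  cd :: "'g \<Rightarrow> 'v"
  cmp :: "'g \<Rightarrow> 'g \<Rightarrow> 'g"
  idn :: "'v \<Rightarrow> 'g"

locale groupoid =
  fixes G :: "('g, 'v, 'm) gpd_scheme"
  assumes dm_closed: "g \<in> arr G \<Longrightarrow> dm G g \<in> obj G"
    and cd_closed: "g \<in> arr G \<Longrightarrow> cd G g \<in> obj G"
    and cmp_closed: "\<lbrakk>g \<in> arr G; h \<in> arr G; dm G g = cd G h\<rbrakk> \<Longrightarrow> cmp G g h \<in> arr G"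
    and dm_cmp: "\<lbrakk>g \<in> arr G; h \<in> arr G; dm G g = cd G h\<rbrakk> \<Longrightarrow> dm G (cmp G g h) = dm G h"
    and cd_cmp: "\<lbrakk>g \<in> arr G; h \<in> arr G; dm G g = cd G h\<rbrakk> \<Longrightarrow> cd G (cmp G g h) = cd G g"
    and cmp_assoc: "\<lbrakk>g \<in> arr G; h \<in> arr G; k \<in> arr G; dm G g = cd G h; dm G h = cd G k\<rbrakk> \<Longrightarrow>
          cmp G (cmp G g h) k = cmp G g (cmp G h k)"
    and idn_closed: "v \<in> obj G \<Longrightarrow> idn G v \<in> arr G"
    and dm_idn: "v \<in> obj G \<Longrightarrow> dm G (idn G v) = v"
    and cd_idn: "v \<in> obj G \<Longrightarrow> cd G (idn G v) = v"
    and idn_left: "g \<in> arr G \<Longrightarrow> cmp G (idn G (cd G g)) g = g"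
    and idn_right: "g \<in> arr G \<Longrightarrow> cmp G g (idn G (dm G g)) = g"
    and inverse: "g \<in> arr G \<Longrightarrow> \<exists>h\<in>arr G. dm G h = cd G g \<and> cd G h = dm G g \<and>
          cmp G h g = idn G (dm G g) \<and> cmp G g h = idn G (cd G g)"

definition transformation_groupoid ::
  "('k, 'm) monoid_scheme \<Rightarrow> 'v set \<Rightarrow> ('k \<Rightarrow> 'v \<Rightarrow> 'v) \<Rightarrow> ('k \<times> 'v, 'v) gpd" where
  "transformation_groupoid K V \<sigma> =
    \<lparr>arr = carrier K \<times> V,
     obj = V,
     dm = \<lambda>(k, v). v,
     cd = \<lambda>(k, v). \<sigma> k v,
     cmp = \<lambda>(k, w) (l, v). (k \<otimes>\<^bsub>K\<^esub> l, v),
     idn = \<lambda>v. (\<one>\<^bsub>K\<^esub>, v)\<rparr>"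

text \<open>Partial isomorphisms \<open>vE\<^sup>* \<rightarrow> wE\<^sup>*\<close> of the path forest.\<close>

definition partial_iso ::
  "('v, 'e) pre_digraph \<Rightarrow> 'v \<Rightarrow> 'v \<Rightarrow> (('v, 'e) path \<Rightarrow> ('v, 'e) path) \<Rightarrow> bool" where
  "partial_iso E v w g \<longleftrightarrow>
     bij_betw g (paths_from E v) (paths_from E w) \<and>
     (\<forall>k. bij_betw g {\<mu> \<in> paths_from E v. len \<mu> = k} {\<mu> \<in> paths_from E w. len \<mu> = k}) \<and>
     (\<forall>\<mu>\<in>paths_from E v. \<forall>e\<in>edges_from E (src E \<mu>).
        \<exists>f\<in>edges_from E (src E (g \<mu>)). g (cat \<mu> (edge_path E e)) = cat (g \<mu>) (edge_path E f))"

text \<open>The arrow \<open>(w, g, v)\<close> is \<open>g : vE\<^sup>* \<rightarrow> wE\<^sup>*\<close>; \<open>g\<close> is taken extensional so that arrows are equal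
  iff they agree as maps.\<close>

definition PIso ::
  "('v, 'e) pre_digraph \<Rightarrow> ('v \<times> (('v, 'e) path \<Rightarrow> ('v, 'e) path) \<times> 'v, 'v) gpd" where
  "PIso E =
    \<lparr>arr = {(w, g, v). v \<in> verts E \<and> w \<in> verts E \<and> g \<in> extensional (paths_from E v) \<and>
                       partial_iso E v w g},
     obj = verts E,
     dm = \<lambda>(w, g, v). v,
     cd = \<lambda>(w, g, v). w,
     cmp = \<lambda>(w, g, v) (v', h, u). (w, compose (paths_from E u) g h, u),
     idn = \<lambda>v. (v, \<lambda>\<mu>\<in>paths_from E v. \<mu>, v)\<rparr>"

locale groupoid_hom = dom: groupoid G + cod: groupoid H
  for G :: "('g, 'v, 'm) gpd_scheme" and H :: "('h, 'v, 'n) gpd_scheme" +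
  fixes \<alpha> :: "'g \<Rightarrow> 'h"
  assumes hom_closed: "g \<in> arr G \<Longrightarrow> \<alpha> g \<in> arr H"
    and hom_cmp: "\<lbrakk>g \<in> arr G; h \<in> arr G; dm G g = cd G h\<rbrakk> \<Longrightarrow>
          dm H (\<alpha> g) = cd H (\<alpha> h) \<and> \<alpha> (cmp G g h) = cmp H (\<alpha> g) (\<alpha> h)"

text \<open>Preservation of domains and codomains follows; see \<open>dm_act\<close> and \<open>cd_act\<close> below.\<close>

locale groupoid_action = groupoid_hom G "PIso E" \<alpha>
  for G :: "('g, 'v, 'm) gpd_scheme" and E :: "('v, 'e) pre_digraph" and \<alpha> +
  assumes obj: "obj G = verts E"
    and unit_preserving: "v \<in> obj G \<Longrightarrow> \<alpha> (idn G v) = idn (PIso E) v"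

definition faithful :: "('g, 'v, 'm) gpd_scheme \<Rightarrow> ('g \<Rightarrow> 'h) \<Rightarrow> bool" where
  "faithful G \<alpha> \<longleftrightarrow> inj_on \<alpha> (arr G)"

definition app ::
  "('g \<Rightarrow> 'v \<times> (('v, 'e) path \<Rightarrow> ('v, 'e) path) \<times> 'v) \<Rightarrow> 'g \<Rightarrow> ('v, 'e) path \<Rightarrow> ('v, 'e) path" where
  "app \<alpha> g \<mu> = fst (snd (\<alpha> g)) \<mu>"

text \<open>\<open>h\<close> is a restriction \<open>g|\<^sub>\<mu>\<close>; the conditions on \<open>dm\<close> and \<open>cd\<close> say that \<open>h \<cdot> \<nu>\<close> and
  \<open>(g \<cdot> \<mu>)(h \<cdot> \<nu>)\<close> are defined for \<open>\<nu> \<in> s(\<mu>)E\<^sup>*\<close>.\<close>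

definition is_restriction where
  "is_restriction G E \<alpha> g \<mu> h \<longleftrightarrow>
     h \<in> arr G \<and> dm G h = src E \<mu> \<and> cd G h = src E (app \<alpha> g \<mu>) \<and>
     (\<forall>\<nu>\<in>paths_from E (src E \<mu>). app \<alpha> g (cat \<mu> \<nu>) = cat (app \<alpha> g \<mu>) (app \<alpha> h \<nu>))"

locale self_similar_groupoid_action = groupoid_action G E \<alpha>
  for G :: "('g, 'v, 'm) gpd_scheme" and E :: "('v, 'e) pre_digraph" and \<alpha> +
  assumes faithful: "faithful G \<alpha>"
    and restriction_ex: "\<lbrakk>g \<in> arr G; e \<in> edges_from E (dm G g)\<rbrakk> \<Longrightarrow>
          \<exists>h. is_restriction G E \<alpha> g (edge_path E e) h"

text \<open>The edge \<open>g \<cdot> e\<close>, and the restriction \<open>g|\<^sub>e\<close>, which is unique if the action is faithful.\<close>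

definition edge_act where
  "edge_act E \<alpha> g e = hd (snd (app \<alpha> g (edge_path E e)))"

definition edge_restr where
  "edge_restr G E \<alpha> g e = (THE h. is_restriction G E \<alpha> g (edge_path E e) h)"

definition transformation_act ::
  "('v, 'e) pre_digraph \<Rightarrow> ('k \<Rightarrow> 'v \<Rightarrow> 'v) \<Rightarrow> ('k \<Rightarrow> ('v, 'e) path \<Rightarrow> ('v, 'e) path) \<Rightarrow>
   'k \<times> 'v \<Rightarrow> 'v \<times> (('v, 'e) path \<Rightarrow> ('v, 'e) path) \<times> 'v" where
  "transformation_act E \<sigma>0 \<sigma>s = (\<lambda>(k, v). (\<sigma>0 k v, \<lambda>\<mu>\<in>paths_from E v. \<sigma>s k \<mu>, v))"


section \<open>The algebras of a self-similar group and of a self-similar groupoid action\<close>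

datatype ('g, 'v, 'e) ck_gen = UGen 'g | PGen 'v | SGen 'e

abbreviation gU :: "'g \<Rightarrow> ('g, 'v, 'e) ck_gen falg" where "gU g \<equiv> gen (UGen g)"
abbreviation gP :: "'v \<Rightarrow> ('g, 'v, 'e) ck_gen falg" where "gP v \<equiv> gen (PGen v)"
abbreviation gS :: "'e \<Rightarrow> ('g, 'v, 'e) ck_gen falg" where "gS e \<equiv> gen (SGen e)"

text \<open>Cuntz-Krieger \<open>E\<close>-families \<open>(p, s)\<close> with \<open>\<Sum>\<^sub>v p\<^sub>v = 1\<close>, for a finite graph without sources.\<close>

definition ck_relations ::
  "('v, 'e) pre_digraph \<Rightarrow> (('g, 'v, 'e) ck_gen falg \<times> ('g, 'v, 'e) ck_gen falg) set" where
  "ck_relations E =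
     {(gP v * gP v, gP v) | v. v \<in> verts E} \<union>
     {(fstar (gP v), gP v) | v. v \<in> verts E} \<union>
     {(gP v * gP w, 0) | v w. v \<in> verts E \<and> w \<in> verts E \<and> v \<noteq> w} \<union>
     {(gS e * fstar (gS e) * gS e, gS e) | e. e \<in> arcs E} \<union>
     {(fstar (gS e) * gS e, gP (tail E e)) | e. e \<in> arcs E} \<union>
     {(gP v, \<Sum>e\<in>edges_from E v. gS e * fstar (gS e)) | v. v \<in> verts E} \<union>
     {(\<Sum>v\<in>verts E. gP v, 1)}"

definition ck_generators :: "'g set \<Rightarrow> ('v, 'e) pre_digraph \<Rightarrow> ('g, 'v, 'e) ck_gen set" where
  "ck_generators A E = UGen ` A \<union> PGen ` verts E \<union> SGen ` arcs E"

definition exel_pardo_relations ::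
  "('k, 'm) monoid_scheme \<Rightarrow> ('v, 'e) pre_digraph \<Rightarrow> ('k \<Rightarrow> 'v \<Rightarrow> 'v) \<Rightarrow> ('k \<Rightarrow> 'e \<Rightarrow> 'e) \<Rightarrow> ('k \<Rightarrow> 'e \<Rightarrow> 'k) \<Rightarrow>
   (('k, 'v, 'e) ck_gen falg \<times> ('k, 'v, 'e) ck_gen falg) set" where
  "exel_pardo_relations K E \<sigma>0 \<sigma>1 \<phi> =
     ck_relations E \<union>
     {(gU (k \<otimes>\<^bsub>K\<^esub> l), gU k * gU l) | k l. k \<in> carrier K \<and> l \<in> carrier K} \<union>
     {(fstar (gU k) * gU k, 1) | k. k \<in> carrier K} \<union>
     {(gU k * fstar (gU k), 1) | k. k \<in> carrier K} \<union>
     {(gU k * gS e, gS (\<sigma>1 k e) * gU (\<phi> k e)) | k e. k \<in> carrier K \<and> e \<in> arcs E} \<union>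
     {(gU k * gP v, gP (\<sigma>0 k v) * gU k) | k v. k \<in> carrier K \<and> v \<in> verts E}"

definition exel_pardo_algebra ::
  "('k, 'm) monoid_scheme \<Rightarrow> ('v, 'e) pre_digraph \<Rightarrow> ('k \<Rightarrow> 'v \<Rightarrow> 'v) \<Rightarrow> ('k \<Rightarrow> 'e \<Rightarrow> 'e) \<Rightarrow> ('k \<Rightarrow> 'e \<Rightarrow> 'k) \<Rightarrow>
   (nat \<Rightarrow> ('k, 'v, 'e) ck_gen falg) set cstar" where
  "exel_pardo_algebra K E \<sigma>0 \<sigma>1 \<phi> =
     universal_cstar (ck_generators (carrier K) E) (exel_pardo_relations K E \<sigma>0 \<sigma>1 \<phi>)"

definition groupoid_relations ::
  "('g, 'v, 'm) gpd_scheme \<Rightarrow> ('v, 'e) pre_digraph \<Rightarrow>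
   ('g \<Rightarrow> 'v \<times> (('v, 'e) path \<Rightarrow> ('v, 'e) path) \<times> 'v) \<Rightarrow>
   (('g, 'v, 'e) ck_gen falg \<times> ('g, 'v, 'e) ck_gen falg) set" where
  "groupoid_relations G E \<alpha> =
     ck_relations E \<union>
     {(gU (idn G v) * gU (idn G v), gU (idn G v)) | v. v \<in> obj G} \<union>
     {(fstar (gU (idn G v)), gU (idn G v)) | v. v \<in> obj G} \<union>
     {(gU g * fstar (gU g) * gU g, gU g) | g. g \<in> arr G} \<union>
     {(fstar (gU g) * gU g, gU (idn G (dm G g))) | g. g \<in> arr G} \<union>
     {(gU g * fstar (gU g), gU (idn G (cd G g))) | g. g \<in> arr G} \<union>
     {(gU g * gU h, gU (cmp G g h)) | g h. g \<in> arr G \<and> h \<in> arr G \<and> dm G g = cd G h} \<union>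
     {(gU g * gU h, 0) | g h. g \<in> arr G \<and> h \<in> arr G \<and> dm G g \<noteq> cd G h} \<union>
     {(gU (idn G v), gP v) | v. v \<in> verts E} \<union>
     {(gU g * gS e, gS (edge_act E \<alpha> g e) * gU (edge_restr G E \<alpha> g e)) | g e.
        g \<in> arr G \<and> e \<in> arcs E \<and> dm G g = head E e} \<union>
     {(gU g * gS e, 0) | g e. g \<in> arr G \<and> e \<in> arcs E \<and> dm G g \<noteq> head E e}"

definition groupoid_algebra ::
  "('g, 'v, 'm) gpd_scheme \<Rightarrow> ('v, 'e) pre_digraph \<Rightarrow>
   ('g \<Rightarrow> 'v \<times> (('v, 'e) path \<Rightarrow> ('v, 'e) path) \<times> 'v) \<Rightarrow> (nat \<Rightarrow> ('g, 'v, 'e) ck_gen falg) set cstar" where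
  "groupoid_algebra G E \<alpha> =
     universal_cstar (ck_generators (arr G) E) (groupoid_relations G E \<alpha>)"

lemma (in groupoid_action) dm_act: "g \<in> arr G \<Longrightarrow> dm (PIso E) (\<alpha> g) = dm G g"
  using hom_cmp[of g "idn G (dm G g)"]
  by (simp add: dom.idn_closed dom.cd_idn dom.dm_closed unit_preserving PIso_def)

lemma (in groupoid_action) cd_act: "g \<in> arr G \<Longrightarrow> cd (PIso E) (\<alpha> g) = cd G g"
  using hom_cmp[of "idn G (cd G g)" g]
  by (simp add: dom.idn_closed dom.dm_idn dom.cd_closed unit_preserving PIso_def)

lemma (in wf_digraph) groupoid_PIso: "groupoid (PIso G)"
proof
  let ?F = "paths_from G"
  note defs = PIso_def partial_iso_def
  fix g h k assume g: "g \<in> arr (PIso G)"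
  obtain w a v where ga: "g = (w, a, v)" by (cases g)
  have v: "v \<in> verts G" "w \<in> verts G" and ext: "a \<in> extensional (?F v)"
    and bij: "bij_betw a (?F v) (?F w)"
    and lev: "\<And>n. bij_betw a {\<mu> \<in> ?F v. len \<mu> = n} {\<mu> \<in> ?F w. len \<mu> = n}"
    and edge: "\<And>\<mu> e. \<lbrakk>\<mu> \<in> ?F v; e \<in> edges_from G (src G \<mu>)\<rbrakk> \<Longrightarrow>
        \<exists>f\<in>edges_from G (src G (a \<mu>)). a (cat \<mu> (edge_path G e)) = cat (a \<mu>) (edge_path G f)"
    using g by (auto simp: defs ga)
  have a: "a \<mu> \<in> ?F w" if "\<mu> \<in> ?F v" for \<mu> using bij that by (auto simp: bij_betw_def)
  show "dm (PIso G) g \<in> obj (PIso G)" "cd (PIso G) g \<in> obj (PIso G)"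
    using v by (simp_all add: PIso_def ga)
  show "cmp (PIso G) (idn (PIso G) (cd (PIso G) g)) g = g" "cmp (PIso G) g (idn (PIso G) (dm (PIso G) g)) = g"
    using ext a by (auto simp: PIso_def ga compose_def extensional_def fun_eq_iff)
  show "\<exists>h\<in>arr (PIso G). dm (PIso G) h = cd (PIso G) g \<and> cd (PIso G) h = dm (PIso G) g \<and>
      cmp (PIso G) h g = idn (PIso G) (dm (PIso G) g) \<and> cmp (PIso G) g h = idn (PIso G) (cd (PIso G) g)"
  proof -
    define b where "b = (\<lambda>\<mu>\<in>?F w. inv_into (?F v) a \<mu>)"
    have inj: "inj_on a (?F v)" and im: "a ` ?F v = ?F w" using bij by (auto simp: bij_betw_def)
    have ab: "a (b \<mu>) = \<mu>" "b \<mu> \<in> ?F v" if "\<mu> \<in> ?F w" for \<mu>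
      using that im by (auto simp: b_def f_inv_into_f inv_into_into)
    have ba: "b (a \<mu>) = \<mu>" if "\<mu> \<in> ?F v" for \<mu>
      using that inj a by (simp add: b_def)
    have len: "len (a \<mu>) = len \<mu>" if "\<mu> \<in> ?F v" for \<mu>
      using lev[of "len \<mu>"] that by (auto simp: bij_betw_def)
    have bij': "bij_betw b (?F w) (?F v)"
      by (rule bij_betw_byWitness[where f' = a]) (auto simp: ab ba a)
    have lev': "bij_betw b {\<mu> \<in> ?F w. len \<mu> = n} {\<mu> \<in> ?F v. len \<mu> = n}" for n
    proof (rule bij_betw_byWitness[where f' = a])
      show "b ` {\<mu> \<in> ?F w. len \<mu> = n} \<subseteq> {\<mu> \<in> ?F v. len \<mu> = n}"
        by (auto simp: ab) (metis ab len)
    qed (auto simp: ab ba a len)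
    have edge': "\<exists>f\<in>edges_from G (src G (b \<mu>)). b (cat \<mu> (edge_path G e)) = cat (b \<mu>) (edge_path G f)"
      if \<mu>: "\<mu> \<in> ?F w" and e: "e \<in> edges_from G (src G \<mu>)" for \<mu> e
    proof -
      have \<mu>e: "cat \<mu> (edge_path G e) \<in> ?F w"
        using \<mu> e by (auto simp: paths_from_def edges_from_def rng_cat edge_path_closed
            intro!: cat_closed) (simp add: edge_path_def rng_def)
      define \<nu> where "\<nu> = b (cat \<mu> (edge_path G e))"
      have \<nu>: "\<nu> \<in> ?F v" "a \<nu> = cat \<mu> (edge_path G e)" using ab[OF \<mu>e] by (auto simp: \<nu>_def)
      have "len \<nu> = Suc (len \<mu>)" using len[OF \<nu>(1)] \<nu>(2) by (simp add: len_cat) (simp add: len_def edge_path_def)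
      then obtain es f where sn: "snd \<nu> = es @ [f]"
        by (metis len_def append_butlast_last_id length_0_conv nat.distinct(1))
      have w: "walk G v (es @ [f])" using \<nu>(1) sn by (cases \<nu>) (auto simp: paths_from_def rng_def paths_iff)
      have \<nu>': "(v, es) \<in> ?F v" and f: "f \<in> edges_from G (src G (v, es))"
        using w by (auto simp: walk_append paths_from_def paths_iff rng_def edges_from_def)
      have \<nu>_eq: "\<nu> = cat (v, es) (edge_path G f)"
        using sn \<nu>(1) by (cases \<nu>) (auto simp: cat_def edge_path_def paths_from_def rng_def)
      obtain e' where "a \<nu> = cat (a (v, es)) (edge_path G e')"
        using edge[OF \<nu>' f] by (auto simp: \<nu>_eq)
      with \<nu>(2) have "a (v, es) = \<mu>"
        by (cases "a (v, es)"; cases \<mu>) (auto simp: cat_def edge_path_def)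
      then have "b \<mu> = (v, es)" using ba[OF \<nu>'] by simp
      then show ?thesis using f \<nu>_eq by (auto simp: \<nu>_def)
    qed
    have "(v, b, w) \<in> arr (PIso G)"
      using v bij' lev' edge' by (auto simp: defs b_def)
    moreover have "compose (?F v) b a = (\<lambda>\<mu>\<in>?F v. \<mu>)" "compose (?F w) a b = (\<lambda>\<mu>\<in>?F w. \<mu>)"
      by (auto simp: compose_def ab ba fun_eq_iff)
    ultimately show ?thesis by (intro bexI[of _ "(v, b, w)"]) (auto simp: PIso_def ga)
  qed
  assume h: "h \<in> arr (PIso G)" and dc: "dm (PIso G) g = cd (PIso G) h"
  obtain b u where hb: "h = (v, b, u)" using dc by (cases h) (auto simp: PIso_def ga)
  have u: "u \<in> verts G" and extb: "b \<in> extensional (?F u)"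
    and bijb: "bij_betw b (?F u) (?F v)"
    and levb: "\<And>n. bij_betw b {\<mu> \<in> ?F u. len \<mu> = n} {\<mu> \<in> ?F v. len \<mu> = n}"
    and edgeb: "\<And>\<mu> e. \<lbrakk>\<mu> \<in> ?F u; e \<in> edges_from G (src G \<mu>)\<rbrakk> \<Longrightarrow>
        \<exists>f\<in>edges_from G (src G (b \<mu>)). b (cat \<mu> (edge_path G e)) = cat (b \<mu>) (edge_path G f)"
    using h by (auto simp: defs hb)
  have b: "b \<mu> \<in> ?F v" if "\<mu> \<in> ?F u" for \<mu> using bijb that by (auto simp: bij_betw_def)
  have lev2: "bij_betw (compose (?F u) a b) {\<mu> \<in> ?F u. len \<mu> = n} {\<mu> \<in> ?F w. len \<mu> = n}" for n
    using bij_betw_trans[OF levb[of n] lev[of n]]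
    by (rule bij_betw_cong[THEN iffD1, rotated]) (simp add: compose_def)
  have bij2: "bij_betw (compose (?F u) a b) (?F u) (?F w)"
    using bij_betw_trans[OF bijb bij]
    by (rule bij_betw_cong[THEN iffD1, rotated]) (simp add: compose_def)
  have edge2: "\<exists>f\<in>edges_from G (src G (compose (?F u) a b \<mu>)).
      compose (?F u) a b (cat \<mu> (edge_path G e)) = cat (compose (?F u) a b \<mu>) (edge_path G f)"
    if \<mu>: "\<mu> \<in> ?F u" and e: "e \<in> edges_from G (src G \<mu>)" for \<mu> e
  proof -
    have "cat \<mu> (edge_path G e) \<in> ?F u"
      using \<mu> e by (auto simp: paths_from_def edges_from_def rng_cat edge_path_closed
          intro!: cat_closed) (simp add: edge_path_def rng_def)
    then show ?thesis using edgeb[OF \<mu> e] edge[OF b[OF \<mu>]] \<mu> by (auto simp: compose_def)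
  qed
  show "cmp (PIso G) g h \<in> arr (PIso G)"
    using u v bij2 lev2 edge2 by (auto simp: defs ga hb)
  show "dm (PIso G) (cmp (PIso G) g h) = dm (PIso G) h" "cd (PIso G) (cmp (PIso G) g h) = cd (PIso G) g"
    by (simp_all add: PIso_def ga hb)
  assume k: "k \<in> arr (PIso G)" and dc2: "dm (PIso G) h = cd (PIso G) k"
  obtain c t where kc: "k = (u, c, t)" using dc2 by (cases k) (auto simp: PIso_def hb)
  have c: "c \<mu> \<in> ?F u" if "\<mu> \<in> ?F t" for \<mu>
    using k that by (auto simp: defs kc bij_betw_def)
  show "cmp (PIso G) (cmp (PIso G) g h) k = cmp (PIso G) g (cmp (PIso G) h k)"
    using c by (auto simp: PIso_def ga hb kc compose_def fun_eq_iff)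
next
  fix v assume v: "v \<in> obj (PIso G)"
  have bij: "bij_betw (\<lambda>\<mu>\<in>paths_from G v. \<mu>) S S" if "S \<subseteq> paths_from G v" for S
    by (rule bij_betw_cong[THEN iffD1, OF _ bij_betw_id]) (use that in auto)
  have "cat \<mu> (edge_path G e) \<in> paths_from G v"
    if "\<mu> \<in> paths_from G v" "e \<in> edges_from G (src G \<mu>)" for \<mu> e
    using that by (auto simp: paths_from_def edges_from_def rng_cat edge_path_closed
        intro!: cat_closed) (simp add: edge_path_def rng_def)
  then show "idn (PIso G) v \<in> arr (PIso G)"
    using v bij[OF subset_refl] by (auto simp: PIso_def partial_iso_def simp del: bij_betw_restrict_eq intro!: bij)
  show "dm (PIso G) (idn (PIso G) v) = v" "cd (PIso G) (idn (PIso G) v) = v"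
    by (simp_all add: PIso_def)
qed

lemma transformation_groupoid:
  assumes "group_action K V \<sigma>"
  shows "groupoid (transformation_groupoid K V \<sigma>)"
proof -
  interpret group_action K V \<sigma> by (rule assms)
  interpret group K using group_hom by (simp add: group_hom_def)
  have cl: "\<sigma> k v \<in> V" if "k \<in> carrier K" "v \<in> V" for k v using element_image that by blast
  have one: "\<sigma> \<one>\<^bsub>K\<^esub> v = v" if "v \<in> V" for v using id_eq_one that by (metis restrict_apply')
  have inv: "\<sigma> (inv\<^bsub>K\<^esub> k) (\<sigma> k v) = v" if "k \<in> carrier K" "v \<in> V" for k v
    using that composition_rule[of v "inv\<^bsub>K\<^esub> k" k] by (simp add: one)
  show ?thesis
  proof (unfold_locales, goal_cases)
    case (12 g)
    then show ?case
      by (intro bexI[of _ "(inv\<^bsub>K\<^esub> (fst g), \<sigma> (fst g) (snd g))"])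
        (auto simp: transformation_groupoid_def cl inv)
  qed (auto simp: transformation_groupoid_def cl one composition_rule m_assoc)
qed

lemma finite_edges_from: "fin_digraph E \<Longrightarrow> finite (edges_from E v)"
  by (simp add: edges_from_def fin_digraph.finite_arcs)

text \<open>Both presentations are bounded, so the two algebras are C*-algebras with the universal
  property.\<close>

lemma rel_eq:
  assumes p: "p \<in> rel_seminorms X R" and xy: "(x, y) \<in> R" and R: "R \<subseteq> free_algebra X \<times> free_algebra X"
  shows "p x = p y"
proof -
  interpret p: star_seminorm "free_algebra X" p
    using p by (rule star_seminorm_if_rel)
  have "p (x - y) = 0" using p xy by (auto simp: rel_seminorms_def)
  moreover have "x \<in> free_algebra X" "y \<in> free_algebra X" using xy R by auto
  ultimately show ?thesis using p.N_diff_abs[of x y] by simp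
qed

lemma le_one_if_cstar:
  assumes p: "p \<in> rel_seminorms X R" and x: "x \<in> free_algebra X" and le: "p (fstar x * x) \<le> 1"
  shows "p x \<le> 1"
proof -
  interpret p: star_seminorm "free_algebra X" p
    using p by (rule star_seminorm_if_rel)
  show ?thesis using p.N_cstar[OF x] le by (metis one_power2 p.N_nonneg[OF x] power2_le_imp_le zero_le_one)
qed

lemma le_one_if_projection:
  assumes p: "p \<in> rel_seminorms X R" and x: "x \<in> free_algebra X"
    and "p (x * x - x) = 0" "p (fstar x - x) = 0"
  shows "p x \<le> 1"
proof -
  interpret p: star_seminorm "free_algebra X" p
    using p by (rule star_seminorm_if_rel)
  note m = p.mult_mem p.fstar_mem p.diff_mem x
  have "fstar x * x - x = (fstar x - x) * x + (x * x - x)" by (simp add: algebra_simps)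
  then have "p (fstar x * x - x) \<le> p (fstar x - x) * p x + p (x * x - x)"
    using order_trans[OF p.N_add[of "(fstar x - x) * x" "x * x - x"] add_right_mono[OF p.N_mult[of "fstar x - x" x]]] m
    by (simp only:)
  then have "p (fstar x * x) \<le> p x"
    using p.N_diff_abs[of "fstar x * x" x] m assms by simp
  then have "(p x)\<^sup>2 \<le> p x" using p.N_cstar[OF x] by simp
  then show ?thesis using p.N_nonneg[OF x]
    by (metis mult.commute mult_cancel_right1 mult_le_cancel_right_pos mult_right_le_imp_le nless_le power2_eq_square zero_less_one mult_1)
qed

lemma one_le_one: "p \<in> rel_seminorms X R \<Longrightarrow> p 1 \<le> 1"
proof -
  assume p: "p \<in> rel_seminorms X R"
  interpret p: star_seminorm "free_algebra X" p
    using p by (rule star_seminorm_if_rel)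
  show ?thesis using p.N_cstar[OF p.one_mem] p.N_nonneg[OF p.one_mem]
    by (metis fstar_one mult_1 mult_cancel_left1 order_refl power2_eq_square zero_le_one)
qed

lemma (in star_subalgebra) sum_mem: "(\<And>i. i \<in> I \<Longrightarrow> f i \<in> F) \<Longrightarrow> sum f I \<in> F"
  by (induction I rule: infinite_finite_induct) (auto simp: zero_mem add_mem)

lemma bounded_ck:
  assumes R: "ck_relations E \<subseteq> R" "R \<subseteq> free_algebra X \<times> free_algebra X" and E: "wf_digraph E"
    and p: "p \<in> rel_seminorms X R"
  shows "v \<in> verts E \<Longrightarrow> PGen v \<in> X \<Longrightarrow> p (gP v) \<le> 1"
    and "e \<in> arcs E \<Longrightarrow> SGen e \<in> X \<Longrightarrow> PGen (tail E e) \<in> X \<Longrightarrow> p (gS e) \<le> 1"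
proof -
  have P: "p (gP v) \<le> 1" if "v \<in> verts E" "PGen v \<in> X" for v
  proof (rule le_one_if_projection[OF p gen_mem[OF that(2)]])
    have "(gP v * gP v, gP v) \<in> R" "(fstar (gP v), gP v) \<in> R"
      using R(1) that(1) by (auto simp: ck_relations_def)
    then show "p (gP v * gP v - gP v) = 0" "p (fstar (gP v) - gP v) = 0"
      using p by (auto simp: rel_seminorms_def)
  qed
  then show "v \<in> verts E \<Longrightarrow> PGen v \<in> X \<Longrightarrow> p (gP v) \<le> 1" .
  show "e \<in> arcs E \<Longrightarrow> SGen e \<in> X \<Longrightarrow> PGen (tail E e) \<in> X \<Longrightarrow> p (gS e) \<le> 1"
  proof (rule le_one_if_cstar[OF p gen_mem])
    assume e: "e \<in> arcs E" "PGen (tail E e) \<in> X"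
    have "(fstar (gS e) * gS e, gP (tail E e)) \<in> R"
      using R(1) e by (auto simp: ck_relations_def)
    from rel_eq[OF p this R(2)] show "p (fstar (gS e) * gS e) \<le> 1"
      using P[of "tail E e"] e E by (simp add: wf_digraph.tail_in_verts)
  qed
qed

lemma ck_relations_closed:
  assumes "wf_digraph E" "PGen ` verts E \<subseteq> X" "SGen ` arcs E \<subseteq> X"
  shows "ck_relations E \<subseteq> free_algebra X \<times> free_algebra X"
proof -
  interpret star_subalgebra "free_algebra X" by (rule star_subalgebra_free_algebra)
  have "gP v \<in> free_algebra X" if "v \<in> verts E" for v using assms(2) that by (intro gen_mem) auto
  moreover have "gS e \<in> free_algebra X" if "e \<in> arcs E" for e using assms(3) that by (intro gen_mem) auto
  ultimately show ?thesis
    unfolding ck_relations_def using assms(1)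
    by (auto intro!: mult_mem fstar_mem zero_mem one_mem sum_mem
        simp: wf_digraph.tail_in_verts edges_from_def)
qed

lemma gen_mem_ck:
  "g \<in> A \<Longrightarrow> gU g \<in> free_algebra (ck_generators A E)"
  "v \<in> verts E \<Longrightarrow> gP v \<in> free_algebra (ck_generators A E)"
  "e \<in> arcs E \<Longrightarrow> gS e \<in> free_algebra (ck_generators A E)"
  by (simp_all add: gen_mem ck_generators_def)

lemma (in self_similar_group) exel_pardo_presentation:
  "bounded_presentation (ck_generators (carrier K) E) (exel_pardo_relations K E \<sigma>0 \<sigma>1 \<phi>)"
    (is "bounded_presentation ?X ?R")
proof
  interpret star_subalgebra "free_algebra ?X" by (rule star_subalgebra_free_algebra)
  have "ck_relations E \<subseteq> free_algebra ?X \<times> free_algebra ?X"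
    by (rule ck_relations_closed) (auto simp: ck_generators_def wf_digraph)
  then show R: "?R \<subseteq> free_algebra ?X \<times> free_algebra ?X"
    unfolding exel_pardo_relations_def
    by (auto intro!: mult_mem fstar_mem one_mem gen_mem_ck e_closed v_closed cocycle_closed)
  fix g assume g: "g \<in> ?X"
  have "p (gen g) \<le> 1" if p: "p \<in> rel_seminorms ?X ?R" for p
  proof -
    have ck: "ck_relations E \<subseteq> ?R" by (auto simp: exel_pardo_relations_def)
    note b = bounded_ck[OF ck R wf_digraph p]
    have "p (gU k) \<le> 1" if k: "k \<in> carrier K" for k
    proof (rule le_one_if_cstar[OF p gen_mem_ck(1)[OF k]])
      have "(fstar (gU k) * gU k, 1) \<in> ?R" using k by (auto simp: exel_pardo_relations_def)
      from rel_eq[OF p this R] show "p (fstar (gU k) * gU k) \<le> 1" using one_le_one[OF p] by simp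
    qed
    with g b show ?thesis by (auto simp: ck_generators_def)
  qed
  then show "\<exists>B. \<forall>p\<in>rel_seminorms ?X ?R. p (gen g) \<le> B" by blast
qed

theorem (in self_similar_group) cstar_algebra_exel_pardo: "cstar_algebra (exel_pardo_algebra K E \<sigma>0 \<sigma>1 \<phi>)"
  unfolding exel_pardo_algebra_def
  using exel_pardo_presentation by (rule bounded_presentation.cstar_algebra_universal)

lemma (in groupoid_action) app_closed:
  assumes "g \<in> arr G" "\<mu> \<in> paths_from E (dm G g)"
  shows "app \<alpha> g \<mu> \<in> paths_from E (cd G g)" and "len (app \<alpha> g \<mu>) = len \<mu>"
proof -
  obtain w a v where a: "\<alpha> g = (w, a, v)" by (cases "\<alpha> g")
  have wv: "w = cd G g" "v = dm G g"
    using cd_act[OF assms(1)] dm_act[OF assms(1)] by (simp_all add: a PIso_def)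
  have "bij_betw a (paths_from E v) (paths_from E w)"
    "\<And>k. bij_betw a {\<mu> \<in> paths_from E v. len \<mu> = k} {\<mu> \<in> paths_from E w. len \<mu> = k}"
    using hom_closed[OF assms(1)] by (auto simp: a PIso_def partial_iso_def)
  then show "app \<alpha> g \<mu> \<in> paths_from E (cd G g)" "len (app \<alpha> g \<mu>) = len \<mu>"
    using assms(2) unfolding bij_betw_def wv by (auto simp: app_def a)
qed

lemma (in self_similar_groupoid_action) restriction_unique:
  assumes h: "is_restriction G E \<alpha> g \<mu> h" and h': "is_restriction G E \<alpha> g \<mu> h'"
  shows "h = h'"
proof -
  have arr: "h \<in> arr G" "h' \<in> arr G" and dm: "dm G h = src E \<mu>" "dm G h' = src E \<mu>"
    and cd: "cd G h = cd G h'"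
    using h h' by (auto simp: is_restriction_def)
  have "app \<alpha> h \<nu> = app \<alpha> h' \<nu>" if \<nu>: "\<nu> \<in> paths_from E (src E \<mu>)" for \<nu>
  proof (rule prod_eqI)
    have "cat (app \<alpha> g \<mu>) (app \<alpha> h \<nu>) = cat (app \<alpha> g \<mu>) (app \<alpha> h' \<nu>)"
      using h h' \<nu> by (simp add: is_restriction_def)
    then show "snd (app \<alpha> h \<nu>) = snd (app \<alpha> h' \<nu>)" by (simp add: cat_def)
    show "fst (app \<alpha> h \<nu>) = fst (app \<alpha> h' \<nu>)"
      using app_closed(1)[OF arr(1)] app_closed(1)[OF arr(2)] \<nu> dm cd
      by (auto simp: paths_from_def rng_def)
  qed
  moreover obtain w a v where a: "\<alpha> h = (w, a, v)" by (cases "\<alpha> h")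
  moreover obtain w' a' v' where a': "\<alpha> h' = (w', a', v')" by (cases "\<alpha> h'")
  moreover have "v = src E \<mu>" "v' = src E \<mu>" "w = w'"
    using dm_act[OF arr(1)] dm_act[OF arr(2)] cd_act[OF arr(1)] cd_act[OF arr(2)] dm cd a a'
    by (simp_all add: PIso_def)
  moreover have "a \<in> extensional (paths_from E v)" "a' \<in> extensional (paths_from E v')"
    using hom_closed[OF arr(1)] hom_closed[OF arr(2)] by (auto simp: a a' PIso_def)
  ultimately have "\<alpha> h = \<alpha> h'" by (auto simp: app_def intro: extensionalityI)
  then show ?thesis using faithful arr by (auto simp: faithful_def dest: inj_onD)
qed

lemma (in self_similar_groupoid_action) edge_restr:
  assumes "g \<in> arr G" "e \<in> edges_from E (dm G g)"
  shows "is_restriction G E \<alpha> g (edge_path E e) (edge_restr G E \<alpha> g e)"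
  unfolding edge_restr_def
  using restriction_ex[OF assms] restriction_unique by (rule theI'[OF ex_ex1I])

lemma (in self_similar_groupoid_action) edge_act:
  assumes "wf_digraph E" "g \<in> arr G" "e \<in> edges_from E (dm G g)"
  shows "edge_act E \<alpha> g e \<in> arcs E"
    and "app \<alpha> g (edge_path E e) = edge_path E (edge_act E \<alpha> g e)"
proof -
  interpret wf_digraph E by (rule assms)
  let ?\<mu> = "app \<alpha> g (edge_path E e)"
  have "edge_path E e \<in> paths_from E (dm G g)"
    using assms(3) by (auto simp: paths_from_def edges_from_def edge_path_closed)
      (simp add: edge_path_def rng_def)
  from app_closed[OF assms(2) this] have \<mu>: "?\<mu> \<in> paths E" "length (snd ?\<mu>) = Suc 0"
    by (auto simp: paths_from_def len_def edge_path_def)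
  then obtain v f where eq: "?\<mu> = (v, [f])"
    by (cases ?\<mu>) (auto simp: length_Suc_conv)
  with \<mu> have "f \<in> arcs E" "head E f = v" by (auto simp: paths_iff)
  with eq show "edge_act E \<alpha> g e \<in> arcs E" "?\<mu> = edge_path E (edge_act E \<alpha> g e)"
    by (simp_all add: edge_act_def edge_path_def)
qed

lemma (in self_similar_groupoid_action) groupoid_presentation:
  assumes E: "wf_digraph E"
  shows "bounded_presentation (ck_generators (arr G) E) (groupoid_relations G E \<alpha>)"
    (is "bounded_presentation ?X ?R")
proof
  interpret star_subalgebra "free_algebra ?X" by (rule star_subalgebra_free_algebra)
  have "ck_relations E \<subseteq> free_algebra ?X \<times> free_algebra ?X"
    by (rule ck_relations_closed) (auto simp: ck_generators_def E)
  moreover have "edge_restr G E \<alpha> g e \<in> arr G" "edge_act E \<alpha> g e \<in> arcs E"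
    if "g \<in> arr G" "e \<in> arcs E" "dm G g = head E e" for g e
    using edge_restr[of g e] edge_act(1)[OF E, of g e] that
    by (auto simp: is_restriction_def edges_from_def)
  moreover have idn: "idn G v \<in> arr G" if "v \<in> verts E" for v
    using dom.idn_closed that obj by simp
  ultimately show R: "?R \<subseteq> free_algebra ?X \<times> free_algebra ?X"
    unfolding groupoid_relations_def
    by (auto intro!: mult_mem fstar_mem zero_mem gen_mem_ck simp: dom.cmp_closed obj idn
        dom.dm_closed[unfolded obj] dom.cd_closed[unfolded obj])
  fix g assume g: "g \<in> ?X"
  have "p (gen g) \<le> 1" if p: "p \<in> rel_seminorms ?X ?R" for p
  proof -
    have ck: "ck_relations E \<subseteq> ?R" by (auto simp: groupoid_relations_def)
    note b = bounded_ck[OF ck R E p]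
    have "p (gU k) \<le> 1" if k: "k \<in> arr G" for k
    proof (rule le_one_if_cstar[OF p gen_mem_ck(1)[OF k]])
      have v: "dm G k \<in> verts E" using dom.dm_closed[OF k] obj by simp
      have "(fstar (gU k) * gU k, gU (idn G (dm G k))) \<in> ?R" "(gU (idn G (dm G k)), gP (dm G k)) \<in> ?R"
        using k v unfolding groupoid_relations_def by blast+
      from rel_eq[OF p this(1) R] rel_eq[OF p this(2) R] show "p (fstar (gU k) * gU k) \<le> 1"
        using b(1)[OF v] v by (simp add: ck_generators_def)
    qed
    with g b E show ?thesis by (auto simp: ck_generators_def wf_digraph.tail_in_verts)
  qed
  then show "\<exists>B. \<forall>p\<in>rel_seminorms ?X ?R. p (gen g) \<le> B" by blast
qed

theorem (in self_similar_groupoid_action) cstar_algebra_groupoid: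
  "wf_digraph E \<Longrightarrow> cstar_algebra (groupoid_algebra G E \<alpha>)"
  unfolding groupoid_algebra_def
  by (rule bounded_presentation.cstar_algebra_universal[OF groupoid_presentation])

end

theory Submission
  imports Defs
begin

text \<open>
  The mutually inverse isomorphisms are given on generators by \<open>u\<^bsub>(k,v)\<^esub> \<mapsto> u\<^sub>k p\<^sub>v\<close> and
  \<open>u\<^sub>k \<mapsto> \<Sum>\<^sub>v u\<^bsub>(k,v)\<^esub>\<close>. Matching the relations is algebra modulo the universal C*-seminorms, with
  one exception: \<open>u\<^bsub>(k,v)\<^esub> s\<^sub>e = 0\<close> for \<open>v \<noteq> r(e)\<close> requires \<open>p\<^bsub>r(e)\<^esub> s\<^sub>e = s\<^sub>e\<close>, that is, a projection
  which is a sum of projections dominates each of them. With \<open>q = 1 - p\<close>, the elements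
  \<open>a\<^sub>i = q s\<^sub>i s\<^sub>i\<^sup>* q\<close> satisfy \<open>\<parallel>q - a\<^sub>i\<parallel> \<le> 1\<close> and have sum \<open>0\<close>. This forces \<open>\<parallel>q \<plusminus> a\<^sub>i / n\<parallel> \<le> 1\<close>,
  where \<open>n\<close> is the number of summands, and then \<open>a\<^sub>i = 0\<close> by an elementary norm estimate that avoids
  spectral theory.
\<close>

section \<open>Equality modulo a C*-seminorm\<close>

text \<open>Classically the exception is immediate: positive elements with sum 0 all vanish. But
  that sums of positive elements are positive already rests on spectral theory, and here there is
  only a C*-seminorm on a free *-algebra. The substitute is that 1 is an extreme point of the unit
  ball: if a is self-adjoint and both 1 + a and 1 - a have norm at most 1, then a = 0. The odd
  polynomial (3x + x^3)/2 sends such elements to such elements and stretches the norm by at least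
  7/6, while their norms never exceed 1; iteration leaves only 0. Relations are verified in the free
  algebra modulo the seminorm, so completions enter only through the universal property. Its
  uniqueness clause concerns contractive homomorphisms, which is why norm bounds accompany both
  homomorphisms. The locales for the two kinds of families share \<open>p\<close>, \<open>s\<close>
  and one ambient pair \<open>F\<close>, \<open>N\<close>: each translation between them happens
  inside a single algebra and is then instantiated at a universal one.\<close>

lemma fscale_uminus: "fscale c (- x) = - fscale c x"
  by (simp add: fscale_def)

context star_seminorm
begin

text \<open>Membership in \<open>F\<close> is built in, so each congruence also certifies that both
  sides lie in \<open>F\<close>. This is how \<open>p_mem\<close>, \<open>s_mem\<close>,
  \<open>u_mem\<close> and \<open>U_mem\<close> are read off from the relations.\<close>

definition eqv :: "'g falg \<Rightarrow> 'g falg \<Rightarrow> bool" (infix "\<doteq>" 50) where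
  "x \<doteq> y \<longleftrightarrow> x \<in> F \<and> y \<in> F \<and> N (x - y) = 0"

lemma eqv_closed: "x \<doteq> y \<Longrightarrow> x \<in> F" "x \<doteq> y \<Longrightarrow> y \<in> F"
  by (simp_all add: eqv_def)

lemma eqvI: "\<lbrakk>x \<in> F; y \<in> F; N (x - y) \<le> 0\<rbrakk> \<Longrightarrow> x \<doteq> y"
  using N_nonneg[OF diff_mem[of x y]] by (simp add: eqv_def)

lemma eqv_refl: "x \<in> F \<Longrightarrow> x \<doteq> x"
  by (simp add: eqv_def N_zero)

lemma eqv_sym: "x \<doteq> y \<Longrightarrow> y \<doteq> x"
  by (auto simp: eqv_def N_diff_commute)

lemma eqv_trans [trans]: "\<lbrakk>x \<doteq> y; y \<doteq> z\<rbrakk> \<Longrightarrow> x \<doteq> z"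
  using N_triangle[of x y z] by (intro eqvI) (auto simp: eqv_def)

lemma eqv_N: "x \<doteq> y \<Longrightarrow> N x = N y"
  using N_diff_abs[of x y] by (simp add: eqv_def)

lemma eqv_zero_iff: "x \<in> F \<Longrightarrow> x \<doteq> 0 \<longleftrightarrow> N x = 0"
  by (simp add: eqv_def zero_mem)

lemma eqv_add: "\<lbrakk>x \<doteq> x'; y \<doteq> y'\<rbrakk> \<Longrightarrow> x + y \<doteq> x' + y'"
  using N_add[of "x - x'" "y - y'"]
  by (intro eqvI) (auto simp: eqv_def add_mem diff_mem algebra_simps)

lemma eqv_fscale: "x \<doteq> y \<Longrightarrow> fscale c x \<doteq> fscale c y"
  by (auto simp: eqv_def fscale_mem N_scale diff_mem simp flip: fscale_simps(7))

lemma eqv_uminus: "x \<doteq> y \<Longrightarrow> - x \<doteq> - y"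
  using eqv_fscale[of x y "-1"] by (simp add: fscale_simps)

lemma eqv_diff: "\<lbrakk>x \<doteq> x'; y \<doteq> y'\<rbrakk> \<Longrightarrow> x - y \<doteq> x' - y'"
  using eqv_add[of x x' "- y" "- y'"] by (simp add: eqv_uminus)

lemma eqv_mult: "\<lbrakk>x \<doteq> x'; y \<doteq> y'\<rbrakk> \<Longrightarrow> x * y \<doteq> x' * y'"
  using N_mult_diff[of x y x' y'] by (intro eqvI) (auto simp: eqv_def mult_mem)

lemma eqv_fstar: "x \<doteq> y \<Longrightarrow> fstar x \<doteq> fstar y"
  by (auto simp: eqv_def fstar_mem N_star diff_mem simp flip: fstar_diff)

lemma eqv_sum: "(\<And>i. i \<in> I \<Longrightarrow> f i \<doteq> g i) \<Longrightarrow> sum f I \<doteq> sum g I"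
  by (induction I rule: infinite_finite_induct) (auto intro: eqv_add eqv_refl zero_mem)

lemma eqv_sum_single:
  assumes "finite I" "j \<in> I" "f j \<in> F" "\<And>i. \<lbrakk>i \<in> I; i \<noteq> j\<rbrakk> \<Longrightarrow> f i \<doteq> 0"
  shows "sum f I \<doteq> f j"
proof -
  have "sum f I \<doteq> (\<Sum>i\<in>I. if i = j then f j else 0)"
    using assms by (intro eqv_sum) (auto intro: eqv_refl)
  then show ?thesis using assms by simp
qed

lemma eqv_zero_mult: "\<lbrakk>x \<doteq> 0; y \<in> F\<rbrakk> \<Longrightarrow> x * y \<doteq> 0" "\<lbrakk>x \<doteq> 0; y \<in> F\<rbrakk> \<Longrightarrow> y * x \<doteq> 0"
  using eqv_mult[of x 0 y y] eqv_mult[of y y x 0] by (simp_all add: eqv_refl)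

lemma eqv_mult_left: "\<lbrakk>x \<doteq> y; z \<in> F\<rbrakk> \<Longrightarrow> z * x \<doteq> z * y"
  and eqv_mult_right: "\<lbrakk>x \<doteq> y; z \<in> F\<rbrakk> \<Longrightarrow> x * z \<doteq> y * z"
  by (simp_all add: eqv_mult eqv_refl)

section \<open>Extremality of the unit in the unit ball, by norm estimates\<close>

lemma N_self_adjoint_square: "\<lbrakk>a \<in> F; fstar a = a\<rbrakk> \<Longrightarrow> N (a * a) = (N a)\<^sup>2"
  using N_cstar[of a] by simp

text \<open>As 1 is a self-adjoint idempotent, its seminorm is 0 or 1. The zero seminorm is
  admissible, so equality with 1 cannot be claimed.\<close>

lemma N_one_le: "N 1 \<le> 1"
  using N_self_adjoint_square[OF one_mem] N_nonneg[OF one_mem]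
  by (metis fstar_one mult_1 mult_cancel_left1 order_refl power2_eq_square zero_le_one)

lemma N_sum_le: "\<lbrakk>\<And>i. i \<in> I \<Longrightarrow> f i \<in> F; \<And>i. i \<in> I \<Longrightarrow> N (f i) \<le> c\<rbrakk> \<Longrightarrow> N (sum f I) \<le> real (card I) * c"
proof (induction I rule: infinite_finite_induct)
  case (insert i I)
  then show ?case using N_add[of "f i" "sum f I"] sum_mem[of I f] by (simp add: algebra_simps) (smt (verit))
qed (simp_all add: N_zero)

lemma N_scaled_le: "\<lbrakk>x \<in> F; N x \<le> b\<rbrakk> \<Longrightarrow> N (fscale c x) \<le> cmod c * b"
  by (simp add: N_scale mult_left_mono)

lemma N_mult_le_one: "\<lbrakk>x \<in> F; y \<in> F; N x \<le> 1; N y \<le> 1\<rbrakk> \<Longrightarrow> N (x * y) \<le> 1"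
  using N_mult[of x y] mult_le_one[of "N x" "N y"] N_nonneg[of y] by simp

text \<open>Spectral reading: the spectrum of such an \<open>a\<close> lies in [-2, 0] and in
  [0, 2], so only 0 qualifies.\<close>

abbreviation small_both :: "'g falg \<Rightarrow> bool" where
  "small_both a \<equiv> a \<in> F \<and> fstar a = a \<and> N (1 + a) \<le> 1 \<and> N (1 - a) \<le> 1"

lemma N_twice: "x \<in> F \<Longrightarrow> N (x + x) = 2 * N x"
  using N_scale[of x 2] fscale_simps(2)[of 1 1 x] by (simp add: fscale_simps)

lemma N_thrice: "x \<in> F \<Longrightarrow> N (x + x + x) = 3 * N x"
  using N_scale[of x 3] fscale_simps(2)[of 2 1 x] fscale_simps(2)[of 1 1 x] by (simp add: fscale_simps)

lemma N_cube_le_one: "\<lbrakk>x \<in> F; N x \<le> 1\<rbrakk> \<Longrightarrow> N (x * x * x) \<le> 1"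
  by (intro N_mult_le_one mult_mem)

text \<open>The average of (1 + b)^3 and (1 - b)^3 is 1 + 3b^2. Taking b = a gives the first bound,
  and b = \<i>a the second, since (\<i>a)^2 = -a^2.\<close>

lemma small_both_cube_bounds:
  assumes "small_both a"
  shows "N (1 + (a * a + a * a + a * a)) \<le> 1" and "N (1 - (a * a + a * a + a * a)) \<le> 1"
proof -
  have cubes: "x * x * x + y * y * y = (1 + (b * b + b * b + b * b)) + (1 + (b * b + b * b + b * b))"
    if "x = 1 + b" "y = 1 - b" for x y b :: "'g falg"
    unfolding that by (simp add: algebra_simps)
  have le: "N (1 + (b * b + b * b + b * b)) \<le> 1" if b: "b \<in> F" "N (1 + b) \<le> 1" "N (1 - b) \<le> 1" for b
  proof -
    let ?x = "1 + b" and ?y = "1 - b"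
    have F: "?x \<in> F" "?y \<in> F" using b by (auto intro: add_mem diff_mem one_mem)
    have "2 * N (1 + (b * b + b * b + b * b)) = N (?x * ?x * ?x + ?y * ?y * ?y)"
      using cubes[OF refl refl, of b] b by (simp add: N_twice one_mem add_mem mult_mem)
    also have "\<dots> \<le> N (?x * ?x * ?x) + N (?y * ?y * ?y)" using F by (intro N_add mult_mem)
    also have "\<dots> \<le> 2" using N_cube_le_one[of ?x] N_cube_le_one[of ?y] F b by simp
    finally show ?thesis by simp
  qed
  show "N (1 + (a * a + a * a + a * a)) \<le> 1" using assms by (intro le) auto
  let ?i = "fscale \<i> a"
  \<comment> \<open>This controls 1 \<plusminus> \<i>a: by the C*-identity its squared norm is the
    norm of 1 + a^2, which is the average of (1 + a)^2 and (1 - a)^2.\<close>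
  have sq: "N (1 + a * a) \<le> 1"
  proof -
    have "2 * N (1 + a * a) = N ((1 + a) * (1 + a) + (1 - a) * (1 - a))"
      using assms by (subst N_twice[symmetric]) (auto simp: algebra_simps intro!: add_mem one_mem mult_mem)
    also have "\<dots> \<le> N ((1 + a) * (1 + a)) + N ((1 - a) * (1 - a))"
      using assms by (intro N_add) (auto intro: mult_mem add_mem diff_mem one_mem)
    also have "\<dots> \<le> 2"
      using N_mult_le_one[of "1 + a" "1 + a"] N_mult_le_one[of "1 - a" "1 - a"] assms
      by (simp add: add_mem diff_mem one_mem)
    finally show ?thesis by simp
  qed
  have ii: "?i * ?i = - (a * a)"
    by (simp add: fscale_simps flip: fscale_simps(8))
  have "fstar (1 + ?i) * (1 + ?i) = 1 + a * a" "fstar (1 - ?i) * (1 - ?i) = 1 + a * a"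
    using assms ii by (simp_all add: fstar_add fstar_diff fstar_fscale algebra_simps)
      (simp_all add: fscale_simps flip: fscale_simps(2))
  then have "(N (1 + ?i))\<^sup>2 \<le> 1" "(N (1 - ?i))\<^sup>2 \<le> 1"
    using N_cstar[of "1 + ?i"] N_cstar[of "1 - ?i"] assms sq
    by (simp_all add: add_mem diff_mem one_mem fscale_mem)
  then have "N (1 + ?i) \<le> 1" "N (1 - ?i) \<le> 1"
    by (simp_all add: abs_le_square_iff[of _ 1, simplified, symmetric] abs_le_iff)
  from le[OF _ this] show "N (1 - (a * a + a * a + a * a)) \<le> 1"
    using assms ii by (simp add: fscale_mem algebra_simps)
qed

text \<open>\<open>1 + (3a + a\<^sup>3) / 2\<close> is a convex combination of \<open>(1 + a)\<^sup>3\<close> and \<open>(1 \<plusminus> \<i>a)\<^sup>3\<close>.\<close>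

lemma small_both_step:
  assumes "small_both a"
  obtains h where "small_both h" "7 / 6 * N a \<le> N h"
proof
  define h where "h b = fscale (1/2) (b + b + b + b * b * b)" for b :: "'g falg"
  let ?s = "a * a + a * a + a * a"
  have a: "a \<in> F" "fstar a = a" using assms by auto
  have hF: "h a \<in> F" using a by (simp add: h_def fscale_mem add_mem mult_mem)
  have le: "N (1 + h b) \<le> 1"
    if b: "b \<in> F" "N (1 + b) \<le> 1" "N (1 - (b * b + b * b + b * b)) \<le> 1" for b
  proof -
    let ?x = "1 + b" and ?y = "1 - (b * b + b * b + b * b)"
    have F: "?x \<in> F" "?y \<in> F" using b by (auto intro: add_mem diff_mem one_mem mult_mem)
    have h2: "h b + h b = b + b + b + b * b * b"
      unfolding h_def by (simp add: fscale_simps(4) flip: fscale_simps(2))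
    have "?x * ?x * ?x + ?y = (1 + h b) + (1 + h b)"
      using h2 by (simp add: algebra_simps)
    moreover have "h b \<in> F" using b by (simp add: h_def fscale_mem add_mem mult_mem)
    ultimately have "2 * N (1 + h b) = N (?x * ?x * ?x + ?y)"
      by (simp only: N_twice add_mem one_mem)
    also have "\<dots> \<le> N (?x * ?x * ?x) + N ?y" using F by (intro N_add mult_mem)
    also have "\<dots> \<le> 2" using N_cube_le_one[OF F(1) b(2)] b(3) by simp
    finally show ?thesis by simp
  qed
  \<comment> \<open>Since \<open>h\<close> is odd, the bound on 1 - h a is the bound on 1 + h (-
    a).\<close>
  have "h (- a) = - h a"
    unfolding h_def fscale_uminus[symmetric] by (rule arg_cong) simp
  moreover have "fstar (h a) = h a"
    using a by (simp add: h_def fstar_fscale fstar_add fstar_mult mult.assoc)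
  ultimately show "small_both (h a)"
    using le[of a] le[of "- a"] small_both_cube_bounds(2)[OF assms] assms hF by (simp add: uminus_mem)
  have aa: "N (a * a) = (N a)\<^sup>2" using N_self_adjoint_square[OF a] .
  \<comment> \<open>Origin of 7/6: this yields 3 (N a)^2 \<le> 2, so the cubic term of
    \<open>h a\<close> costs at most 2/3 N a before halving, and (3 - 2/3)/2 = 7/6 remains.\<close>
  have "N ?s \<le> N (1 + ?s) + N 1"
    using N_add[of "1 + ?s" "- 1"] a by (simp add: add_mem mult_mem one_mem uminus_mem N_minus)
  then have small: "3 * (N a)\<^sup>2 \<le> 2"
    using small_both_cube_bounds(1)[OF assms] N_one_le N_thrice[of "a * a"] a aa by (simp add: mult_mem)
  have "h a + h a = a + a + a + a * a * a"
    unfolding h_def by (simp add: fscale_simps(4) flip: fscale_simps(2))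
  then have "a + a + a = (h a + h a) + - (a * a * a)" by simp
  then have "3 * N a \<le> 2 * N (h a) + N (a * a * a)"
    using N_add[of "h a + h a" "- (a * a * a)"] a hF N_minus[of "a * a * a"]
      N_twice[OF hF] N_thrice[OF a(1)]
    by (simp only: add_mem mult_mem uminus_mem)
  moreover have "N (a * a * a) \<le> (N a)\<^sup>2 * N a" using N_mult[of "a * a" a] a aa by (simp add: mult_mem)
  moreover have "(N a)\<^sup>2 * N a \<le> 2 / 3 * N a" using small N_nonneg[OF a(1)] by (intro mult_right_mono) auto
  ultimately show "7 / 6 * N a \<le> N (h a)" by simp
qed

lemma small_both_le_one: "small_both a \<Longrightarrow> N a \<le> 1"
proof -
  assume a: "small_both a"
  have "(1 + a) + - (1 - a) = a + a" by simp
  then have "2 * N a \<le> N (1 + a) + N (- (1 - a))"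
    using N_add[of "1 + a" "- (1 - a)"] N_twice[of a] a
    by (simp only: add_mem diff_mem one_mem uminus_mem)
  then show "N a \<le> 1" using a N_minus[of "1 - a"] diff_mem[OF one_mem, of a] by linarith
qed

text \<open>Iterating \<open>small_both_step\<close> n times gives an element of norm at least
  (7/6)^n N a, yet \<open>small_both_le_one\<close> caps every such norm by 1.\<close>

theorem small_both_zero:
  assumes "small_both a" shows "N a = 0"
proof -
  have "(7 / 6) ^ n * N a \<le> 1" for n
    using assms
  proof (induction n arbitrary: a)
    case 0
    then show ?case using small_both_le_one[OF 0] by simp
  next
    case (Suc n)
    obtain h where h: "small_both h" "7 / 6 * N a \<le> N h" using small_both_step[OF Suc.prems] .
    have "(7 / 6) ^ Suc n * N a = (7 / 6) ^ n * (7 / 6 * N a)" by simp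
    also have "\<dots> \<le> (7 / 6) ^ n * N h" using h by (intro mult_left_mono) auto
    also have "\<dots> \<le> 1" using Suc.IH[OF h(1)] .
    finally show ?case .
  qed
  note le = this
  have "N a \<le> 0"
  proof (rule ccontr)
    assume "\<not> N a \<le> 0"
    then have pos: "N a > 0" by simp
    obtain n where "1 / N a < (7 / 6) ^ n" using real_arch_pow[of "7 / 6" "1 / N a"] by auto
    then have "1 < (7 / 6) ^ n * N a" using pos by (simp add: pos_divide_less_eq)
    with le[of n] show False by simp
  qed
  then show ?thesis using N_nonneg[of a] assms by simp
qed

text \<open>With n terms and b = a_j / n, both n(1 + b) and n(1 - b) are sums of n elements of norm
  at most 1. As the a_i sum to 0, the former is congruent to 1 plus all 1 - a_i with i other than j;
  the latter is n - 1 copies of 1 plus 1 - a_j. Hence \<open>small_both_zero\<close> applies to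
  b.\<close>

lemma sum_zero_imp_zero:
  assumes fin: "finite I"
    and a: "\<And>i. i \<in> I \<Longrightarrow> a i \<in> F" "\<And>i. i \<in> I \<Longrightarrow> fstar (a i) = a i" "\<And>i. i \<in> I \<Longrightarrow> N (1 - a i) \<le> 1"
    and zero: "sum a I \<doteq> 0" and j: "j \<in> I"
  shows "a j \<doteq> 0"
proof -
  let ?n = "card I"
  define b where "b = fscale (1 / of_nat ?n) (a j)"
  have n: "?n > 0" using fin j by (auto simp: card_gt_0_iff)
  have aj: "a j = fscale (of_nat ?n) b" using n by (simp add: b_def fscale_simps)
  have of_nat: "fscale (of_nat m) 1 = of_nat m" for m :: nat
    by (induction m) (simp_all add: fscale_simps)
  have b: "b \<in> F" "fstar b = b" using a j by (simp_all add: b_def fscale_mem fstar_fscale)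
  have "of_nat ?n + a j \<doteq> of_nat ?n + a j - sum a I"
    using eqv_diff[OF eqv_refl eqv_sym[OF zero], of "of_nat ?n + a j"] a(1)[OF j]
    by (simp add: add_mem fscale_mem one_mem flip: of_nat)
  also have "of_nat ?n + a j - sum a I = 1 + (\<Sum>i\<in>I - {j}. 1 - a i)"
    using fin j n by (simp add: sum_subtractf sum.remove[of I j] of_nat_diff card_Diff_singleton_if)
  finally have "N (of_nat ?n + a j) = N (1 + (\<Sum>i\<in>I - {j}. 1 - a i))" by (rule eqv_N)
  also have "\<dots> \<le> N 1 + N (\<Sum>i\<in>I - {j}. 1 - a i)"
    using a by (intro N_add sum_mem one_mem diff_mem) auto
  also have "\<dots> \<le> 1 + real (card (I - {j})) * 1"
    using a by (intro add_mono N_one_le N_sum_le diff_mem one_mem) auto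
  also have "\<dots> = real ?n" using fin j n by (simp add: of_nat_diff)
  finally have "N (fscale (of_nat ?n) (1 + b)) \<le> real ?n"
    by (simp add: fscale_simps of_nat aj)
  then have plus: "N (1 + b) \<le> 1" using n b by (simp add: N_scale add_mem one_mem)
  have "fscale (of_nat ?n) (1 - b) = of_nat (?n - 1) + (1 - a j)"
    using n by (simp add: fscale_simps of_nat aj of_nat_diff)
  also have "N \<dots> \<le> N (of_nat (?n - 1)) + N (1 - a j)"
    using a(1)[OF j] by (intro N_add) (auto simp: diff_mem one_mem fscale_mem simp flip: of_nat)
  also have "\<dots> \<le> real (?n - 1) * 1 + 1"
    using a(3)[OF j] N_scaled_le[OF one_mem N_one_le, of "of_nat (?n - 1)"] by (simp add: of_nat)
  finally have "N (1 - b) \<le> 1" using n b by (simp add: N_scale diff_mem one_mem of_nat_diff)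
  then have "N b = 0" using b plus small_both_zero by blast
  then show ?thesis using aj b a(1)[OF j] by (simp add: eqv_zero_iff N_scale)
qed

section \<open>Projections, corners, and ranges below a sum of range projections\<close>

lemma N_projection_le_one:
  assumes "x * x \<doteq> x" "fstar x \<doteq> x" shows "N x \<le> 1"
proof -
  have x: "x \<in> F" using assms(1) by (rule eqv_closed)
  have "fstar x * x \<doteq> x * x" using assms(2) x by (rule eqv_mult_right)
  also note assms(1)
  finally have "(N x)\<^sup>2 = N x" using N_cstar[OF x] eqv_N by simp
  then have "N x = 0 \<or> N x = 1" by (simp add: power2_eq_square)
  then show ?thesis by auto
qed

lemma eqv_complement:
  assumes "p * p \<doteq> p" "fstar p \<doteq> p"
  shows "(1 - p) * (1 - p) \<doteq> 1 - p" "fstar (1 - p) \<doteq> 1 - p"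
proof -
  have p: "p \<in> F" using assms(1) by (rule eqv_closed)
  have "1 - p - p + p * p \<doteq> 1 - p - p + p"
    using p assms(1) by (intro eqv_add eqv_refl) (auto intro: diff_mem one_mem)
  then show "(1 - p) * (1 - p) \<doteq> 1 - p" by (simp add: algebra_simps)
  show "fstar (1 - p) \<doteq> 1 - p"
    using eqv_diff[OF eqv_refl[OF one_mem] assms(2)] by (simp add: fstar_diff)
qed

text \<open>\<open>x \<mapsto> qx\<close> is a *-homomorphism from the commutant of a projection \<open>q\<close> onto the corner
  with unit \<open>q\<close>; pulling back the seminorm lets \<open>1\<close> play the role of \<open>q\<close>.\<close>

definition commutant :: "'g falg \<Rightarrow> 'g falg set" where
  "commutant q = {x \<in> F. q * x \<doteq> x * q \<and> q * fstar x \<doteq> fstar x * q}"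

text \<open>Commuting with \<open>q\<close> turns q x y into (q x)(q y) modulo \<open>N\<close>,
  which gives submultiplicativity; commuting \<open>q\<close> past the adjoint of x gives the
  C*-identity.\<close>

lemma star_seminorm_commutant:
  assumes q: "q * q \<doteq> q" "fstar q \<doteq> q"
  shows "star_seminorm (commutant q) (\<lambda>x. N (q * x))"
proof (intro star_seminorm.intro star_subalgebra.intro star_seminorm_axioms.intro)
  have qF: "q \<in> F" using q(1) by (rule eqv_closed)
  note mem = one_mem add_mem mult_mem fscale_mem fstar_mem qF
  have mult: "q * (x * y) \<doteq> (x * y) * q" if "q * x \<doteq> x * q" "q * y \<doteq> y * q" "x \<in> F" "y \<in> F" for x y
  proof -
    have "q * x * y \<doteq> x * q * y" using that by (intro eqv_mult_right)
    also have "x * q * y = x * (q * y)" by (simp add: mult.assoc)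
    also have "x * (q * y) \<doteq> x * (y * q)" using that by (intro eqv_mult_left)
    finally show ?thesis by (simp add: mult.assoc)
  qed
  show "1 \<in> commutant q" by (simp add: commutant_def mem eqv_refl)
  fix x y c assume x: "x \<in> commutant q"
  then have x': "x \<in> F" "q * x \<doteq> x * q" "q * fstar x \<doteq> fstar x * q" by (auto simp: commutant_def)
  show "fscale c x \<in> commutant q"
    using x' by (auto simp: commutant_def mem fstar_fscale fscale_simps intro: eqv_fscale)
  show "fstar x \<in> commutant q" using x' by (simp add: commutant_def mem)
  assume y: "y \<in> commutant q"
  then have y': "y \<in> F" "q * y \<doteq> y * q" "q * fstar y \<doteq> fstar y * q" by (auto simp: commutant_def)
  show "x + y \<in> commutant q"
    using x' y' by (auto simp: commutant_def mem fstar_add distrib_left distrib_right intro: eqv_add)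
  show "x * y \<in> commutant q"
    using x' y' mult[of x y] mult[of "fstar y" "fstar x"] by (auto simp: commutant_def mem fstar_mult)
next
  have qF: "q \<in> F" using q(1) by (rule eqv_closed)
  note mem = one_mem add_mem mult_mem fscale_mem fstar_mem qF
  show "cstar_seminorm (commutant q) (\<lambda>x. N (q * x))"
    unfolding cstar_seminorm_def
  proof (intro conjI ballI allI)
    fix x y c assume "x \<in> commutant q"
    then have x: "x \<in> F" "q * x \<doteq> x * q" "q * fstar x \<doteq> fstar x * q" by (auto simp: commutant_def)
    show "N (q * fscale c x) = cmod c * N (q * x)" using x by (simp add: fscale_simps N_scale mem)
    have "fstar x * fstar q * (q * x) \<doteq> fstar x * q * (q * x)"
      using x q by (intro eqv_mult eqv_refl mem)
    also have "\<dots> = fstar x * (q * q) * x" by (simp add: mult.assoc)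
    also have "\<dots> \<doteq> fstar x * q * x" using x q by (intro eqv_mult eqv_refl mem)
    also have "\<dots> \<doteq> q * fstar x * x" using x by (intro eqv_mult_right eqv_sym[OF x(3)])
    finally have "N (fstar x * fstar q * (q * x)) = N (q * fstar x * x)" by (rule eqv_N)
    then show "N (q * (fstar x * x)) = (N (q * x))\<^sup>2"
      using N_cstar[of "q * x"] x by (simp add: fstar_mult mem mult.assoc)
    assume "y \<in> commutant q"
    then have y: "y \<in> F" by (auto simp: commutant_def)
    show "N (q * (x + y)) \<le> N (q * x) + N (q * y)"
      using N_add[of "q * x" "q * y"] x y by (simp add: distrib_left mem)
    have "q * (x * y) = q * x * y" by (simp add: mult.assoc)
    also have "\<dots> \<doteq> q * q * x * y" using x y q by (intro eqv_mult eqv_refl eqv_sym[OF q(1)])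
    also have "\<dots> = q * (q * x) * y" by (simp add: mult.assoc)
    also have "\<dots> \<doteq> q * (x * q) * y" using x y by (intro eqv_mult_right eqv_mult_left mem)
    also have "\<dots> = (q * x) * (q * y)" by (simp add: mult.assoc)
    finally have "N (q * (x * y)) = N (q * x * (q * y))" by (rule eqv_N)
    then show "N (q * (x * y)) \<le> N (q * x) * N (q * y)"
      using N_mult[of "q * x" "q * y"] x y by (simp only: mem)
  qed
qed

text \<open>Were the ranges of the s_i known to be mutually orthogonal, multiplying the sum by s_j
  would suffice. The hypotheses only say that the range projections add up to a projection.\<close>

theorem range_le_sum:
  assumes fin: "finite I"
    and s: "\<And>i. i \<in> I \<Longrightarrow> s i * fstar (s i) * s i \<doteq> s i"
    and p: "p * p \<doteq> p" "fstar p \<doteq> p" "p \<doteq> (\<Sum>i\<in>I. s i * fstar (s i))"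
    and j: "j \<in> I"
  shows "p * s j \<doteq> s j"
proof -
  define q where "q = 1 - p"
  have q: "q * q \<doteq> q" "fstar q \<doteq> q" using eqv_complement p by (simp_all add: q_def)
  have pF: "p \<in> F" and qF: "q \<in> F" using p(1) q(1) by (auto dest: eqv_closed)
  have sF: "s i \<in> F" if "i \<in> I" for i using s[OF that] by (rule eqv_closed)
  note mem = one_mem add_mem mult_mem diff_mem fstar_mem pF qF sF
  interpret M: star_seminorm "commutant q" "\<lambda>x. N (q * x)"
    using q by (rule star_seminorm_commutant)
  let ?e = "\<lambda>i. s i * fstar (s i)"
  \<comment> \<open>The left factor is \<open>fstar q\<close> because \<open>q\<close> is
    self-adjoint only modulo \<open>N\<close>, while \<open>sum_zero_imp_zero\<close> asks for
    \<open>fstar (a i) = a i\<close> exactly.\<close>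
  define a where "a i = fstar q * ?e i * q" for i
  have a_eq: "a i \<doteq> q * ?e i * q" if "i \<in> I" for i
    unfolding a_def using q that by (intro eqv_mult eqv_refl mem)
  have aq: "q * a i \<doteq> a i" "a i * q \<doteq> a i" if i: "i \<in> I" for i
  proof -
    have "q * a i \<doteq> q * (q * ?e i * q)" using a_eq i by (intro eqv_mult_left mem)
    also have "\<dots> = (q * q) * ?e i * q" by (simp add: mult.assoc)
    also have "\<dots> \<doteq> q * ?e i * q" using q i by (intro eqv_mult eqv_refl mem)
    also have "\<dots> \<doteq> a i" using a_eq[OF i] by (rule eqv_sym)
    finally show "q * a i \<doteq> a i" .
    have "a i * q = fstar q * ?e i * (q * q)" by (simp add: a_def mult.assoc)
    also have "\<dots> \<doteq> fstar q * ?e i * q" using q i by (intro eqv_mult eqv_refl mem)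
    finally show "a i * q \<doteq> a i" by (simp add: a_def)
  qed
  have a_star: "fstar (a i) = a i" for i by (simp add: a_def fstar_mult mult.assoc)
  have aF: "a i \<in> F" if "i \<in> I" for i using aq[OF that] by (auto dest: eqv_closed)
  have aM: "a i \<in> commutant q" if "i \<in> I" for i
    using aq[OF that] aF[OF that] by (auto simp: commutant_def a_star intro: eqv_trans eqv_sym)
  have "M.eqv (a j) 0"
  proof (rule M.sum_zero_imp_zero[OF fin aM a_star _ _ j])
    fix i assume i: "i \<in> I"
    have ee: "?e i * ?e i \<doteq> ?e i" "fstar (?e i) \<doteq> ?e i"
      using eqv_mult_right[OF s[OF i] fstar_mem[OF sF[OF i]]] i
      by (simp_all add: mult.assoc fstar_mult eqv_refl mem)
    have "q * (1 - a i) = q - q * a i" by (simp add: algebra_simps)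
    also have "q - q * a i \<doteq> q * q - q * ?e i * q"
      using q i aq a_eq by (intro eqv_diff) (auto intro: eqv_sym eqv_trans)
    also have "q * q - q * ?e i * q = q * (1 - ?e i) * q" by (simp add: algebra_simps)
    finally have "N (q * (1 - a i)) = N (q * (1 - ?e i) * q)" by (rule eqv_N)
    also have "\<dots> \<le> 1"
      using i q eqv_complement[OF ee] by (intro N_mult_le_one N_projection_le_one mem)
    finally show "N (q * (1 - a i)) \<le> 1" .
  next
    have "sum a I = fstar q * (\<Sum>i\<in>I. ?e i) * q"
      by (simp add: a_def sum_distrib_left sum_distrib_right)
    also have "\<dots> \<doteq> fstar q * p * q" using p by (intro eqv_mult eqv_refl mem eqv_sym[OF p(3)])
    also have "\<dots> = fstar q * (p - p * p)" by (simp add: q_def algebra_simps)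
    also have "\<dots> \<doteq> fstar q * (p - p)" using p by (intro eqv_mult_left eqv_diff eqv_refl mem)
    finally have "q * sum a I \<doteq> 0" using eqv_zero_mult(2)[OF _ qF] by simp
    then have "N (q * sum a I) = 0" using eqv_N N_zero by metis
    moreover have "sum a I \<in> commutant q" using aM by (rule M.sum_mem)
    ultimately show "M.eqv (sum a I) 0" by (simp add: M.eqv_zero_iff)
  qed
  then have "N (q * a j) = 0" using aM[OF j] by (simp add: M.eqv_zero_iff)
  then have "N (a j) = 0" using eqv_N[OF aq(1)[OF j]] by simp
  \<comment> \<open>With t = \<open>fstar (s j) * q\<close> this reads a_j =
    \<open>fstar t * t\<close>, so the C*-identity carries the vanishing of a_j to t, and taking
    adjoints carries it to \<open>q * s j\<close>.\<close>
  moreover have "a j = fstar (fstar (s j) * q) * (fstar (s j) * q)"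
    by (simp add: a_def fstar_mult mult.assoc)
  ultimately have "N (fstar (s j) * q) = 0"
    using N_cstar[of "fstar (s j) * q"] j by (simp add: mem)
  then have "fstar (fstar (s j) * q) \<doteq> 0"
    using eqv_fstar[of "fstar (s j) * q" 0] j by (simp add: eqv_zero_iff mem)
  then have "fstar q * s j \<doteq> 0" by (simp add: fstar_mult)
  moreover have "q * s j \<doteq> fstar q * s j" using q j by (intro eqv_mult_right eqv_sym[OF q(2)] mem)
  ultimately have "q * s j \<doteq> 0" by (rule eqv_trans[rotated])
  then have "q * s j + p * s j \<doteq> 0 + p * s j" using j by (intro eqv_add eqv_refl mem)
  then show ?thesis by (auto simp: q_def algebra_simps intro: eqv_sym)
qed

end

section \<open>Substitution homomorphisms\<close>

fun letter_subst :: "('g \<Rightarrow> 'h falg) \<Rightarrow> 'g letter \<Rightarrow> 'h falg" where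
  "letter_subst f (Gen g) = f g"
| "letter_subst f (Adj g) = fstar (f g)"

definition word_subst :: "('g \<Rightarrow> 'h falg) \<Rightarrow> 'g word \<Rightarrow> 'h falg" where
  "word_subst f w = prod_list (map (letter_subst f) (letters w))"

text \<open>The unital *-homomorphism of free *-algebras determined by \<open>f\<close>: evaluation
  of noncommutative polynomials in the generators and their adjoints.\<close>

definition subst :: "('g \<Rightarrow> 'h falg) \<Rightarrow> 'g falg \<Rightarrow> 'h falg" where
  "subst f x = (\<Sum>w\<in>Poly_Mapping.keys x. fscale (Poly_Mapping.lookup x w) (word_subst f w))"

lemma fscale_zero_right [simp]: "fscale c 0 = 0"
  by (simp add: fscale_def)

lemma fstar_sum: "fstar (sum f I) = (\<Sum>i\<in>I. fstar (f i))"
  by (induction I rule: infinite_finite_induct) (simp_all add: fstar_add)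

lemma word_subst_zero [simp]: "word_subst f 0 = 1"
  by (simp add: word_subst_def zero_word_def)

lemma word_subst_plus: "word_subst f (u + w) = word_subst f u * word_subst f w"
  by (simp add: word_subst_def plus_word_def)

lemma word_subst_adj: "word_subst f (word_adj w) = fstar (word_subst f w)"
proof -
  have letter: "letter_subst f (letter_adj a) = fstar (letter_subst f a)" for a
    by (cases a) simp_all
  have "prod_list (map (letter_subst f) (rev (map letter_adj ls))) = fstar (prod_list (map (letter_subst f) ls))" for ls
    by (induction ls) (simp_all add: fstar_mult letter)
  then show ?thesis by (simp add: word_subst_def word_adj_def)
qed

lemma subst_superset:
  assumes "finite W" "Poly_Mapping.keys x \<subseteq> W"
  shows "subst f x = (\<Sum>w\<in>W. fscale (Poly_Mapping.lookup x w) (word_subst f w))"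
  unfolding subst_def using assms
  by (intro sum.mono_neutral_left) (auto simp: in_keys_iff fscale_simps)

lemma subst_add: "subst f (x + y) = subst f x + subst f y"
proof -
  let ?W = "Poly_Mapping.keys x \<union> Poly_Mapping.keys y"
  have "subst f z = (\<Sum>w\<in>?W. fscale (Poly_Mapping.lookup z w) (word_subst f w))"
    if "z \<in> {x, y, x + y}" for z
    using that Poly_Mapping.keys_add[of x y] by (intro subst_superset) auto
  then show ?thesis by (simp add: lookup_add fscale_simps sum.distrib)
qed

lemma subst_single: "subst f (Poly_Mapping.single w c) = fscale c (word_subst f w)"
  using subst_superset[of "{w}" "Poly_Mapping.single w c" f] by simp

lemma subst_zero [simp]: "subst f 0 = 0"
  by (simp add: subst_def)

lemma subst_one [simp]: "subst f 1 = 1"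
  by (simp flip: single_one add: subst_single fscale_simps)

lemma subst_gen [simp]: "subst f (gen g) = f g"
  by (simp add: gen_def subst_single word_subst_def fscale_simps)

lemma subst_mult: "subst f (x * y) = subst f x * subst f y"
proof (induction x rule: falg_induct)
  case (add_single x w c)
  have "subst f (Poly_Mapping.single w c * y) = subst f (Poly_Mapping.single w c) * subst f y"
  proof (induction y rule: falg_induct)
    case (add_single y v d)
    then show ?case
      by (simp add: distrib_left subst_add mult_single subst_single word_subst_plus fscale_simps mult.commute[of d])
  qed simp
  with add_single show ?case by (simp add: distrib_right subst_add)
qed simp

lemma subst_fstar: "subst f (fstar x) = fstar (subst f x)"
  by (induction x rule: falg_induct)
    (simp_all add: fstar_add subst_add fstar_single subst_single word_subst_adj fstar_fscale)

lemma subst_fscale: "subst f (fscale c x) = fscale c (subst f x)"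
proof -
  have "subst f (Poly_Mapping.single 0 c) = fscale c 1"
    by (simp add: subst_single)
  then show ?thesis by (simp add: fscale_def[of c x] subst_mult fscale_simps)
qed

lemma subst_sum: "subst f (sum h I) = (\<Sum>i\<in>I. subst f (h i))"
  by (induction I rule: infinite_finite_induct) (simp_all add: subst_add)

lemma (in star_subalgebra) subst_closed:
  assumes f: "\<And>g. g \<in> X \<Longrightarrow> f g \<in> F" and x: "x \<in> free_algebra X"
  shows "subst f x \<in> F"
proof -
  have "prod_list (map (letter_subst f) ls) \<in> F" if "letter_gen ` set ls \<subseteq> X" for ls
    using that
  proof (induction ls)
    case (Cons a ls)
    then show ?case by (cases a) (auto intro: f mult_mem fstar_mem)
  qed (simp add: one_mem)
  then show ?thesis
    using x unfolding subst_def free_algebra_def word_subst_def by (intro sum_mem fscale_mem) auto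
qed

section \<open>Isomorphic presentations\<close>

context bounded_presentation
begin

lemma eqv_relation: "(x, y) \<in> R \<Longrightarrow> eqv x y"
proof -
  assume xy: "(x, y) \<in> R"
  have "N (x - y) \<le> 0" using xy by (intro N_le) (auto simp: rel_seminorms_def)
  then show ?thesis using xy relations by (intro eqvI) auto
qed

text \<open>Congruences on generators spread to words by multiplicativity and to all elements by
  linearity. Applied to a composite of two substitutions, this reduces mutual inverseness to a check
  on generators.\<close>

lemma eqv_subst_self:
  assumes f: "\<And>g. g \<in> X \<Longrightarrow> eqv (f g) (gen g)" and x: "x \<in> free_algebra X"
  shows "eqv (subst f x) x"
proof -
  have word: "eqv (word_subst f w) (Poly_Mapping.single w 1)" if "letter_gen ` set (letters w) \<subseteq> X" for w
  proof -
    obtain ls where w: "w = Word ls" by (cases w)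
    have "eqv (word_subst f (Word ls)) (Poly_Mapping.single (Word ls) 1)" if "letter_gen ` set ls \<subseteq> X"
      using that
    proof (induction ls)
      case Nil
      have "Word [] = (0 :: 'g word)" by (simp add: zero_word_def)
      then show ?case by (simp add: eqv_refl one_mem)
    next
      case (Cons a ls)
      have "eqv (letter_subst f a) (Poly_Mapping.single (Word [a]) 1)"
        using f[of "letter_gen a"] Cons.prems eqv_fstar[of "f (letter_gen a)" "gen (letter_gen a)"]
        by (cases a) (simp_all add: gen_def fstar_single word_adj_def)
      moreover have "Poly_Mapping.single (Word (a # ls)) (1 :: complex) =
          Poly_Mapping.single (Word [a]) 1 * Poly_Mapping.single (Word ls) 1"
        by (simp add: mult_single plus_word_def)
      ultimately show ?case using Cons by (auto simp: word_subst_def intro: eqv_mult)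
    qed
    with that w show ?thesis by simp
  qed
  have single: "Poly_Mapping.single w c = fscale c (Poly_Mapping.single w 1)" for w :: "'g word" and c
    by (simp add: fscale_def mult_single)
  have "subst f x = (\<Sum>w\<in>Poly_Mapping.keys x. fscale (Poly_Mapping.lookup x w) (word_subst f w))"
    by (simp add: subst_def)
  also have "eqv \<dots> (\<Sum>w\<in>Poly_Mapping.keys x. fscale (Poly_Mapping.lookup x w) (Poly_Mapping.single w 1))"
    using x by (intro eqv_sum eqv_fscale word) (auto simp: free_algebra_def)
  also have "\<dots> = x"
    by (rule poly_mapping_eqI)
      (simp flip: single add: lookup_sum lookup_single when_def in_keys_iff)
  finally show ?thesis .
qed

lemma const_class_eq_iff:
  "\<lbrakk>x \<in> free_algebra X; y \<in> free_algebra X\<rbrakk> \<Longrightarrow> const_class X R x = const_class X R y \<longleftrightarrow> eqv x y"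
  unfolding const_class_def by (subst cls_eq_iff) (auto simp: const_C eqv_def LIMSEQ_const_iff)

lemma const_class_closed: "x \<in> free_algebra X \<Longrightarrow> const_class X R x \<in> carrier (universal_cstar X R)"
  by (simp add: universal_cstar_def const_class_def cls_closed const_C)

lemma subst_universal_hom:
  fixes f :: "'h \<Rightarrow> 'g falg"
  assumes Y: "bounded_presentation Y S"
    and f: "\<And>g. g \<in> Y \<Longrightarrow> f g \<in> free_algebra X"
    and rel: "\<And>x y. (x, y) \<in> S \<Longrightarrow> eqv (subst f x) (subst f y)"
  obtains h where "h \<in> cstar_hom (universal_cstar Y S) (universal_cstar X R)"
    "\<forall>a\<in>carrier (universal_cstar Y S). nrm (universal_cstar X R) (h a) \<le> nrm (universal_cstar Y S) a"
    "\<forall>x\<in>free_algebra Y. h (const_class Y S x) = const_class X R (subst f x)"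
proof -
  let ?\<pi> = "\<lambda>x. const_class X R (subst f x)"
  have cl: "subst f x \<in> free_algebra X" if "x \<in> free_algebra Y" for x
    using f that by (rule subst_closed)
  have U: "universal_cstar X R = A" "\<And>x. const_class X R x = cls (\<lambda>n. x)"
    by (simp_all add: universal_cstar_def const_class_def)
  have "\<exists>!h. h \<in> cstar_hom (universal_cstar Y S) (universal_cstar X R) \<and>
    h \<in> extensional (carrier (universal_cstar Y S)) \<and>
    (\<forall>a\<in>carrier (universal_cstar Y S). nrm (universal_cstar X R) (h a) \<le> nrm (universal_cstar Y S) a) \<and>
    (\<forall>x\<in>free_algebra Y. h (const_class Y S x) = ?\<pi> x)"
  proof (rule bounded_presentation.universal_property[OF Y cstar_algebra_universal])
    fix x y assume xy: "(x, y) \<in> S"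
    then have "x \<in> free_algebra Y" "y \<in> free_algebra Y"
      using bounded_presentation.relations[OF Y] by auto
    then show "?\<pi> x = ?\<pi> y" using rel[OF xy] by (simp add: const_class_eq_iff cl)
  qed (simp_all add: U cl const_C cls_closed cls_add cls_mult cls_scale cls_star cls_one
      subst_add subst_mult subst_fscale subst_fstar)
  then show thesis using that by blast
qed

text \<open>Both \<open>h\<close> and the identity extend the canonical map from the free *-algebra,
  so the uniqueness clause of the universal property identifies them.\<close>

lemma cstar_endo_eq_id:
  assumes h: "h \<in> cstar_hom (universal_cstar X R) (universal_cstar X R)"
    and contr: "\<And>a. a \<in> carrier (universal_cstar X R) \<Longrightarrow> nrm (universal_cstar X R) (h a) \<le> nrm (universal_cstar X R) a"
    and const: "\<And>x. x \<in> free_algebra X \<Longrightarrow> h (const_class X R x) = const_class X R x"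
    and a: "a \<in> carrier (universal_cstar X R)"
  shows "h a = a"
proof -
  let ?B = "universal_cstar X R"
  interpret B: cstar_algebra ?B by (rule cstar_algebra_universal)
  have U: "?B = A" "\<And>x. const_class X R x = cls (\<lambda>n. x)"
    by (simp_all add: universal_cstar_def const_class_def)
  have "\<exists>!h. h \<in> cstar_hom ?B ?B \<and> h \<in> extensional (carrier ?B) \<and>
    (\<forall>a\<in>carrier ?B. nrm ?B (h a) \<le> nrm ?B a) \<and>
    (\<forall>x\<in>free_algebra X. h (const_class X R x) = const_class X R x)"
  proof (rule universal_property[OF cstar_algebra_universal])
    show "const_class X R x = const_class X R y" if xy: "(x, y) \<in> R" for x y
      using eqv_relation[OF xy] by (simp add: const_class_eq_iff eqv_closed)
  qed (simp_all add: U const_C cls_closed cls_add cls_mult cls_scale cls_star cls_one)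
  \<comment> \<open>Uniqueness is stated for maps extensional on the carrier, so \<open>h\<close>
    and the identity are compared after restriction to it.\<close>
  moreover have "restrict g (carrier ?B) \<in> cstar_hom ?B ?B \<and> restrict g (carrier ?B) \<in> extensional (carrier ?B) \<and>
      (\<forall>a\<in>carrier ?B. nrm ?B (restrict g (carrier ?B) a) \<le> nrm ?B a) \<and>
      (\<forall>x\<in>free_algebra X. restrict g (carrier ?B) (const_class X R x) = const_class X R x)"
    if g: "g \<in> cstar_hom ?B ?B" "\<And>a. a \<in> carrier ?B \<Longrightarrow> nrm ?B (g a) \<le> nrm ?B a"
      "\<And>x. x \<in> free_algebra X \<Longrightarrow> g (const_class X R x) = const_class X R x" for g
    using g by (auto simp: cstar_hom_def ring_hom_def B.scale_closed B.star_closed const_class_closed Pi_iff)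
  note restr = this
  have "restrict h (carrier ?B) = restrict (\<lambda>a. a) (carrier ?B)"
    using calculation restr[OF h contr const] restr[of "\<lambda>a. a"]
    by (auto simp: cstar_hom_def ring_hom_def)
  then show ?thesis using a by (metis restrict_apply')
qed

end

lemma cstar_hom_comp: "\<lbrakk>f \<in> cstar_hom A B; g \<in> cstar_hom B C\<rbrakk> \<Longrightarrow> (\<lambda>x. g (f x)) \<in> cstar_hom A C"
  by (auto simp: cstar_hom_def ring_hom_def Pi_iff)

text \<open>The universal property turns both substitutions into homomorphisms of the completions.
  Both composites fix the classes of constant sequences, hence are identities by
  \<open>cstar_endo_eq_id\<close>.\<close>

theorem cstar_isomorphic_presentations:
  fixes f :: "'g \<Rightarrow> 'h falg" and g :: "'h \<Rightarrow> 'g falg"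
  assumes X: "bounded_presentation X R" and Y: "bounded_presentation Y S"
    and f: "\<And>a. a \<in> X \<Longrightarrow> f a \<in> free_algebra Y" and g: "\<And>b. b \<in> Y \<Longrightarrow> g b \<in> free_algebra X"
    and rel_f: "\<And>x y. (x, y) \<in> R \<Longrightarrow> star_seminorm.eqv (free_algebra Y) (universal_seminorm Y S) (subst f x) (subst f y)"
    and rel_g: "\<And>x y. (x, y) \<in> S \<Longrightarrow> star_seminorm.eqv (free_algebra X) (universal_seminorm X R) (subst g x) (subst g y)"
    and gf: "\<And>a. a \<in> X \<Longrightarrow> star_seminorm.eqv (free_algebra X) (universal_seminorm X R) (subst g (f a)) (gen a)"
    and fg: "\<And>b. b \<in> Y \<Longrightarrow> star_seminorm.eqv (free_algebra Y) (universal_seminorm Y S) (subst f (g b)) (gen b)"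
  shows "cstar_isomorphic (universal_cstar X R) (universal_cstar Y S)"
proof -
  let ?A = "universal_cstar X R" and ?B = "universal_cstar Y S"
  interpret X: bounded_presentation X R by (rule X)
  interpret Y: bounded_presentation Y S by (rule Y)
  obtain h where h: "h \<in> cstar_hom ?A ?B" "\<forall>a\<in>carrier ?A. nrm ?B (h a) \<le> nrm ?A a"
    "\<forall>x\<in>free_algebra X. h (const_class X R x) = const_class Y S (subst f x)"
    by (rule Y.subst_universal_hom[OF X f rel_f])
  obtain k where k: "k \<in> cstar_hom ?B ?A" "\<forall>a\<in>carrier ?B. nrm ?A (k a) \<le> nrm ?B a"
    "\<forall>x\<in>free_algebra Y. k (const_class Y S x) = const_class X R (subst g x)"
    by (rule X.subst_universal_hom[OF Y g rel_g])
  have hc: "h a \<in> carrier ?B" if "a \<in> carrier ?A" for a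
    using h(1) that by (auto simp: cstar_hom_def ring_hom_def)
  have kc: "k b \<in> carrier ?A" if "b \<in> carrier ?B" for b
    using k(1) that by (auto simp: cstar_hom_def ring_hom_def)
  have comp: "subst p (subst q x) = subst (\<lambda>a. subst p (q a)) x"
    for p :: "'y \<Rightarrow> 'z falg" and q :: "'x \<Rightarrow> 'y falg" and x
  proof -
    have letter: "subst p (letter_subst q a) = letter_subst (\<lambda>a. subst p (q a)) a" for a
      by (cases a) (simp_all add: subst_fstar)
    have "subst p (prod_list (map (letter_subst q) ls)) = prod_list (map (letter_subst (\<lambda>a. subst p (q a))) ls)" for ls
      by (induction ls) (simp_all add: subst_mult letter)
    then show ?thesis
      unfolding subst_def[of q] subst_def[of "\<lambda>a. subst p (q a)"]
      by (simp add: subst_sum subst_fscale word_subst_def)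
  qed
  have "k (h a) = a" if "a \<in> carrier ?A" for a
  proof (rule X.cstar_endo_eq_id[OF cstar_hom_comp[OF h(1) k(1)] _ _ that])
    show "nrm ?A (k (h a)) \<le> nrm ?A a" if "a \<in> carrier ?A" for a
      using bspec[OF h(2) that] bspec[OF k(2) hc[OF that]] by linarith
    show "k (h (const_class X R x)) = const_class X R x" if x: "x \<in> free_algebra X" for x
    proof -
      have fx: "subst f x \<in> free_algebra Y" using f x by (rule Y.subst_closed)
      then have "k (h (const_class X R x)) = const_class X R (subst g (subst f x))"
        using x h(3) k(3) by simp
      also have "\<dots> = const_class X R x"
        using X.eqv_subst_self[OF gf x] X.subst_closed[OF g fx] x
        by (simp add: X.const_class_eq_iff comp)
      finally show ?thesis .
    qed
  qed
  moreover have "h (k b) = b" if "b \<in> carrier ?B" for b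
  proof (rule Y.cstar_endo_eq_id[OF cstar_hom_comp[OF k(1) h(1)] _ _ that])
    show "nrm ?B (h (k a)) \<le> nrm ?B a" if "a \<in> carrier ?B" for a
      using bspec[OF k(2) that] bspec[OF h(2) kc[OF that]] by linarith
    show "h (k (const_class Y S x)) = const_class Y S x" if x: "x \<in> free_algebra Y" for x
    proof -
      have gx: "subst g x \<in> free_algebra X" using g x by (rule X.subst_closed)
      then have "h (k (const_class Y S x)) = const_class Y S (subst f (subst g x))"
        using x h(3) k(3) by simp
      also have "\<dots> = const_class Y S x"
        using Y.eqv_subst_self[OF fg x] Y.subst_closed[OF f gx] x
        by (simp add: Y.const_class_eq_iff comp)
      finally show ?thesis .
    qed
  qed
  ultimately have "bij_betw h (carrier ?A) (carrier ?B)"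
    using hc kc by (intro bij_betw_byWitness[where f' = k]) auto
  with h(1) show ?thesis by (auto simp: cstar_isomorphic_def)
qed

section \<open>Cuntz-Krieger, Exel-Pardo and groupoid families modulo a C*-seminorm\<close>

text \<open>\<open>F\<close> and \<open>N\<close> stay arbitrary so that both universal algebras are
  instances.\<close>

locale ck_family = star_seminorm F N + fin_digraph E
  for F :: "'g falg set" and N :: "'g falg \<Rightarrow> real" and E :: "('v, 'e) pre_digraph" +
  fixes p :: "'v \<Rightarrow> 'g falg" and s :: "'e \<Rightarrow> 'g falg"
  assumes p_idem: "v \<in> verts E \<Longrightarrow> p v * p v \<doteq> p v"
    and p_star: "v \<in> verts E \<Longrightarrow> fstar (p v) \<doteq> p v"
    and p_orth: "\<lbrakk>v \<in> verts E; w \<in> verts E; v \<noteq> w\<rbrakk> \<Longrightarrow> p v * p w \<doteq> 0"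
    and s_partial_isometry: "e \<in> arcs E \<Longrightarrow> s e * fstar (s e) * s e \<doteq> s e"
    and s_initial: "e \<in> arcs E \<Longrightarrow> fstar (s e) * s e \<doteq> p (tail E e)"
    and p_range: "v \<in> verts E \<Longrightarrow> p v \<doteq> (\<Sum>e\<in>edges_from E v. s e * fstar (s e))"
    and p_sum: "(\<Sum>v\<in>verts E. p v) \<doteq> 1"
begin

lemma p_mem: "v \<in> verts E \<Longrightarrow> p v \<in> F"
  using p_idem by (rule eqv_closed)

lemma s_mem: "e \<in> arcs E \<Longrightarrow> s e \<in> F"
  using s_partial_isometry by (rule eqv_closed)

lemmas mem = p_mem s_mem one_mem mult_mem fstar_mem sum_mem tail_in_verts head_in_verts

text \<open>This absorption is not among the Cuntz-Krieger relations; it comes from the range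
  relation through \<open>range_le_sum\<close>.\<close>

lemma p_s_head:
  assumes e: "e \<in> arcs E" shows "p (head E e) * s e \<doteq> s e"
proof (rule range_le_sum[where I = "edges_from E (head E e)" and s = s and j = e])
  show "finite (edges_from E (head E e))" by (simp add: edges_from_def)
  show "e \<in> edges_from E (head E e)" using e by (simp add: edges_from_def)
  show "s i * fstar (s i) * s i \<doteq> s i" if "i \<in> edges_from E (head E e)" for i
    using that by (simp add: edges_from_def s_partial_isometry)
qed (use e in \<open>auto intro: p_idem p_star p_range\<close>)

lemma p_s_orth:
  assumes e: "e \<in> arcs E" and v: "v \<in> verts E" "v \<noteq> head E e" shows "p v * s e \<doteq> 0"
proof -
  have "p v * s e \<doteq> p v * (p (head E e) * s e)"
    using e v by (intro eqv_mult_left eqv_sym[OF p_s_head] mem)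
  also have "\<dots> = (p v * p (head E e)) * s e" by (simp add: mult.assoc)
  also have "\<dots> \<doteq> 0" using e v by (intro eqv_zero_mult(1) p_orth mem)
  finally show ?thesis .
qed

lemma s_p_tail:
  assumes e: "e \<in> arcs E" shows "s e * p (tail E e) \<doteq> s e"
proof -
  have "s e * p (tail E e) \<doteq> s e * (fstar (s e) * s e)"
    using e by (intro eqv_mult_left eqv_sym[OF s_initial] mem)
  also have "\<dots> \<doteq> s e" using s_partial_isometry[OF e] by (simp add: mult.assoc)
  finally show ?thesis .
qed

text \<open>For x = u_k this says that passing from u_k to the sum of the u_(k,v), and from there to
  the sum of the u_k p_v, returns u_k.\<close>

lemma mult_p_sum:
  assumes x: "x \<in> F" shows "(\<Sum>v\<in>verts E. x * p v) \<doteq> x"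
  using eqv_mult_left[OF p_sum x] by (simp add: sum_distrib_left)

end

locale exel_pardo_family =
  ck_family F N E p s + self_similar_group K E \<sigma>0 \<sigma>1 \<phi>
  for F :: "'g falg set" and N :: "'g falg \<Rightarrow> real" and E :: "('v, 'e) pre_digraph" and p s
    and K :: "('k, 'm) monoid_scheme" (structure) and \<sigma>0 \<sigma>1 \<phi> +
  fixes u :: "'k \<Rightarrow> 'g falg"
  assumes u_mult: "\<lbrakk>k \<in> carrier K; l \<in> carrier K\<rbrakk> \<Longrightarrow> u (k \<otimes> l) \<doteq> u k * u l"
    and u_isometry: "k \<in> carrier K \<Longrightarrow> fstar (u k) * u k \<doteq> 1"
    and u_coisometry: "k \<in> carrier K \<Longrightarrow> u k * fstar (u k) \<doteq> 1"
    and u_s: "\<lbrakk>k \<in> carrier K; e \<in> arcs E\<rbrakk> \<Longrightarrow> u k * s e \<doteq> s (\<sigma>1 k e) * u (\<phi> k e)"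
    and u_p: "\<lbrakk>k \<in> carrier K; v \<in> verts E\<rbrakk> \<Longrightarrow> u k * p v \<doteq> p (\<sigma>0 k v) * u k"

text \<open>The relations of the groupoid algebra in explicit form: units are replaced by
  \<open>p\<close>, and composition, edge action and restriction are already evaluated. No groupoid
  appears, so such a family can be compared with an Exel-Pardo family in the same algebra.\<close>

locale groupoid_family =
  ck_family F N E p s + self_similar_group K E \<sigma>0 \<sigma>1 \<phi>
  for F :: "'g falg set" and N :: "'g falg \<Rightarrow> real" and E :: "('v, 'e) pre_digraph" and p s
    and K :: "('k, 'm) monoid_scheme" (structure) and \<sigma>0 \<sigma>1 \<phi> +
  fixes U :: "'k \<Rightarrow> 'v \<Rightarrow> 'g falg"
  assumes U_unit: "v \<in> verts E \<Longrightarrow> U \<one> v \<doteq> p v"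
    and U_partial_isometry: "\<lbrakk>k \<in> carrier K; v \<in> verts E\<rbrakk> \<Longrightarrow> U k v * fstar (U k v) * U k v \<doteq> U k v"
    and U_initial: "\<lbrakk>k \<in> carrier K; v \<in> verts E\<rbrakk> \<Longrightarrow> fstar (U k v) * U k v \<doteq> p v"
    and U_final: "\<lbrakk>k \<in> carrier K; v \<in> verts E\<rbrakk> \<Longrightarrow> U k v * fstar (U k v) \<doteq> p (\<sigma>0 k v)"
    and U_mult: "\<lbrakk>k \<in> carrier K; l \<in> carrier K; v \<in> verts E\<rbrakk> \<Longrightarrow> U k (\<sigma>0 l v) * U l v \<doteq> U (k \<otimes> l) v"
    and U_mult_zero: "\<lbrakk>k \<in> carrier K; l \<in> carrier K; v \<in> verts E; w \<in> verts E; w \<noteq> \<sigma>0 l v\<rbrakk> \<Longrightarrow>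
          U k w * U l v \<doteq> 0"
    and U_s: "\<lbrakk>k \<in> carrier K; e \<in> arcs E\<rbrakk> \<Longrightarrow>
          U k (head E e) * s e \<doteq> s (\<sigma>1 k e) * U (\<phi> k e) (tail E e)"
    and U_s_zero: "\<lbrakk>k \<in> carrier K; v \<in> verts E; e \<in> arcs E; v \<noteq> head E e\<rbrakk> \<Longrightarrow> U k v * s e \<doteq> 0"

section \<open>From unitaries u_k to partial isometries u_k p_v\<close>

context exel_pardo_family
begin

lemma u_mem: "k \<in> carrier K \<Longrightarrow> u k \<in> F"
  using u_mult[of k \<one>] by (auto dest: eqv_closed)

lemmas u_mems = mem u_mem v_closed e_closed cocycle_closed

text \<open>The relations do not list this; it holds because u_1 is idempotent and an
  isometry.\<close>

lemma u_one: "u \<one> \<doteq> 1"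
proof -
  have "u \<one> = 1 * u \<one>" by simp
  also have "\<dots> \<doteq> fstar (u \<one>) * u \<one> * u \<one>"
    by (intro eqv_mult_right eqv_sym[OF u_isometry] u_mems one_closed)
  also have "\<dots> = fstar (u \<one>) * (u \<one> * u \<one>)" by (simp add: mult.assoc)
  also have "\<dots> \<doteq> fstar (u \<one>) * u (\<one> \<otimes> \<one>)"
    by (intro eqv_mult_left eqv_sym[OF u_mult] u_mems one_closed)
  also have "\<dots> \<doteq> 1" using u_isometry[OF one_closed] by simp
  finally show ?thesis .
qed

text \<open>By \<open>u_p\<close>, the product of u_k p_w and u_l p_v is congruent to u_k p_w p_(lv)
  u_l, so orthogonality of the vertex projections encodes composability of arrows. The vanishing of
  edge products rests on \<open>p_s_orth\<close>.\<close>

theorem groupoid_family: "groupoid_family F N E p s K \<sigma>0 \<sigma>1 \<phi> (\<lambda>k v. u k * p v)"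
proof
  fix v assume v: "v \<in> verts E"
  show "u \<one> * p v \<doteq> p v" using eqv_mult_right[OF u_one p_mem[OF v]] by simp
  fix k assume k: "k \<in> carrier K"
  have "fstar (u k * p v) * (u k * p v) = fstar (p v) * (fstar (u k) * u k) * p v"
    by (simp add: fstar_mult mult.assoc)
  also have "\<dots> \<doteq> p v * 1 * p v"
    using k v by (intro eqv_mult eqv_refl p_star u_isometry u_mems)
  also have "\<dots> \<doteq> p v" using p_idem[OF v] by simp
  finally show initial: "fstar (u k * p v) * (u k * p v) \<doteq> p v" .
  have "u k * p v * fstar (u k * p v) * (u k * p v) = u k * p v * (fstar (u k * p v) * (u k * p v))"
    by (simp add: mult.assoc)
  also have "\<dots> \<doteq> u k * p v * p v" using k v by (intro eqv_mult_left initial u_mems)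
  also have "\<dots> = u k * (p v * p v)" by (simp add: mult.assoc)
  also have "\<dots> \<doteq> u k * p v" using k v by (intro eqv_mult_left p_idem u_mems)
  finally show "u k * p v * fstar (u k * p v) * (u k * p v) \<doteq> u k * p v" .
  have "u k * p v * fstar (u k * p v) = u k * (p v * fstar (p v)) * fstar (u k)"
    by (simp add: fstar_mult mult.assoc)
  also have "\<dots> \<doteq> u k * (p v * p v) * fstar (u k)"
    using k v by (intro eqv_mult_right eqv_mult_left p_star u_mems)
  also have "\<dots> \<doteq> u k * p v * fstar (u k)"
    using k v by (intro eqv_mult_right eqv_mult_left p_idem u_mems)
  also have "\<dots> \<doteq> p (\<sigma>0 k v) * u k * fstar (u k)"
    using k v by (intro eqv_mult_right u_p u_mems)
  also have "\<dots> = p (\<sigma>0 k v) * (u k * fstar (u k))" by (simp add: mult.assoc)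
  also have "\<dots> \<doteq> p (\<sigma>0 k v) * 1" using k v by (intro eqv_mult_left u_coisometry u_mems)
  finally show "u k * p v * fstar (u k * p v) \<doteq> p (\<sigma>0 k v)" by simp
  show "u k * p v * s e \<doteq> 0" if e: "e \<in> arcs E" "v \<noteq> head E e" for e
    using eqv_zero_mult(2)[OF p_s_orth[OF e(1) v e(2)] u_mem[OF k]] by (simp add: mult.assoc)
  fix l assume l: "l \<in> carrier K"
  have "u k * p (\<sigma>0 l v) * (u l * p v) = u k * (p (\<sigma>0 l v) * u l) * p v" by (simp add: mult.assoc)
  also have "\<dots> \<doteq> u k * (u l * p v) * p v"
    using k l v by (intro eqv_mult_right eqv_mult_left eqv_sym[OF u_p] u_mems)
  also have "\<dots> = (u k * u l) * (p v * p v)" by (simp add: mult.assoc)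
  also have "\<dots> \<doteq> u (k \<otimes> l) * p v" using k l v by (intro eqv_mult eqv_sym[OF u_mult] p_idem)
  finally show "u k * p (\<sigma>0 l v) * (u l * p v) \<doteq> u (k \<otimes> l) * p v" .
  fix w assume w: "w \<in> verts E" "w \<noteq> \<sigma>0 l v"
  have "u k * p w * (u l * p v) \<doteq> u k * p w * (p (\<sigma>0 l v) * u l)"
    using k l v w by (intro eqv_mult_left u_p u_mems)
  also have "\<dots> = u k * ((p w * p (\<sigma>0 l v)) * u l)" by (simp add: mult.assoc)
  also have "\<dots> \<doteq> 0" using k l v w by (intro eqv_zero_mult p_orth u_mems)
  finally show "u k * p w * (u l * p v) \<doteq> 0" .
next
  fix k e assume k: "k \<in> carrier K" and e: "e \<in> arcs E"
  have "u k * p (head E e) * s e = u k * (p (head E e) * s e)" by (simp add: mult.assoc)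
  also have "\<dots> \<doteq> u k * s e" using k e by (intro eqv_mult_left p_s_head u_mems)
  \<comment> \<open>The projection inserted here survives the use of \<open>u_s\<close> and cuts
    u_(\<phi> k e) down to the required arrow.\<close>
  also have "\<dots> \<doteq> u k * (s e * p (tail E e))"
    using k e by (intro eqv_mult_left eqv_sym[OF s_p_tail] u_mems)
  also have "\<dots> = u k * s e * p (tail E e)" by (simp add: mult.assoc)
  also have "\<dots> \<doteq> s (\<sigma>1 k e) * u (\<phi> k e) * p (tail E e)"
    using k e by (intro eqv_mult_right u_s u_mems)
  finally show "u k * p (head E e) * s e \<doteq> s (\<sigma>1 k e) * (u (\<phi> k e) * p (tail E e))"
    by (simp add: mult.assoc)
qed

end

section \<open>From partial isometries U k v to the unitaries obtained by summing over v\<close>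

context groupoid_family
begin

lemma U_mem: "\<lbrakk>k \<in> carrier K; v \<in> verts E\<rbrakk> \<Longrightarrow> U k v \<in> F"
  using U_partial_isometry by (rule eqv_closed)

lemmas U_mems = mem U_mem v_closed e_closed cocycle_closed

lemma U_p: assumes "k \<in> carrier K" "v \<in> verts E" shows "U k v * p v \<doteq> U k v"
proof -
  have "U k v * p v \<doteq> U k v * (fstar (U k v) * U k v)"
    using assms by (intro eqv_mult_left eqv_sym[OF U_initial] U_mems)
  also have "\<dots> \<doteq> U k v" using U_partial_isometry[OF assms] by (simp add: mult.assoc)
  finally show ?thesis .
qed

lemma p_U: assumes "k \<in> carrier K" "v \<in> verts E" shows "p (\<sigma>0 k v) * U k v \<doteq> U k v"
proof -
  have "p (\<sigma>0 k v) * U k v \<doteq> U k v * fstar (U k v) * U k v"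
    using assms by (intro eqv_mult_right eqv_sym[OF U_final] U_mems)
  also have "\<dots> \<doteq> U k v" using assms by (rule U_partial_isometry)
  finally show ?thesis .
qed

lemma U_p_zero:
  assumes "k \<in> carrier K" "v \<in> verts E" "w \<in> verts E" "v \<noteq> w" shows "U k v * p w \<doteq> 0"
proof -
  have "U k v * p w \<doteq> U k v * p v * p w"
    using assms by (intro eqv_mult_right eqv_sym[OF U_p] U_mems)
  also have "\<dots> = U k v * (p v * p w)" by (simp add: mult.assoc)
  also have "\<dots> \<doteq> 0" using assms by (intro eqv_zero_mult p_orth U_mems)
  finally show ?thesis .
qed

lemma p_U_zero:
  assumes "k \<in> carrier K" "v \<in> verts E" "w \<in> verts E" "w \<noteq> \<sigma>0 k v" shows "p w * U k v \<doteq> 0"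
proof -
  have "p w * U k v \<doteq> p w * (p (\<sigma>0 k v) * U k v)"
    using assms by (intro eqv_mult_left eqv_sym[OF p_U] U_mems)
  also have "\<dots> = (p w * p (\<sigma>0 k v)) * U k v" by (simp add: mult.assoc)
  also have "\<dots> \<doteq> 0" using assms by (intro eqv_zero_mult p_orth U_mems)
  finally show ?thesis .
qed

lemma \<sigma>0_inj: "\<lbrakk>k \<in> carrier K; v \<in> verts E; w \<in> verts E\<rbrakk> \<Longrightarrow> \<sigma>0 k v = \<sigma>0 k w \<longleftrightarrow> v = w"
  using vertex_action.inj_prop[of k] by (auto dest: inj_onD)

text \<open>Distinct vertices have distinct images under \<open>\<sigma>0 k\<close>, so the ranges
  of the \<open>U k v\<close> are orthogonal; \<open>U_star_U_zero\<close> is the dual fact for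
  initial projections. Together they kill the cross terms when the sum of the \<open>U k v\<close>
  is shown to be unitary.\<close>

lemma star_U_U_zero:
  assumes k: "k \<in> carrier K" and v: "v \<in> verts E" "w \<in> verts E" "v \<noteq> w"
  shows "fstar (U k v) * U k w \<doteq> 0"
proof -
  have "fstar (U k v) * U k w \<doteq> fstar (U k v) * (p (\<sigma>0 k w) * U k w)"
    using k v by (intro eqv_mult_left eqv_sym[OF p_U] U_mems)
  also have "\<dots> \<doteq> fstar (U k v) * (fstar (p (\<sigma>0 k w)) * U k w)"
    using k v by (intro eqv_mult_left eqv_mult_right eqv_sym[OF p_star] U_mems)
  also have "\<dots> = fstar (p (\<sigma>0 k w) * U k v) * U k w" by (simp add: fstar_mult mult.assoc)
  also have "\<dots> \<doteq> 0"
    using k v eqv_fstar[OF p_U_zero[of k v "\<sigma>0 k w"]]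
    by (intro eqv_zero_mult U_mems) (auto simp: \<sigma>0_inj v_closed)
  finally show ?thesis .
qed

lemma U_star_U_zero:
  assumes k: "k \<in> carrier K" and v: "v \<in> verts E" "w \<in> verts E" "v \<noteq> w"
  shows "U k v * fstar (U k w) \<doteq> 0"
proof -
  have "U k v * fstar (U k w) \<doteq> U k v * p v * fstar (U k w)"
    using k v by (intro eqv_mult_right eqv_sym[OF U_p] U_mems)
  also have "\<dots> \<doteq> U k v * fstar (p v) * fstar (U k w)"
    using k v by (intro eqv_mult_left eqv_mult_right eqv_sym[OF p_star] U_mems)
  also have "\<dots> = U k v * fstar (U k w * p v)" by (simp add: fstar_mult mult.assoc)
  also have "\<dots> \<doteq> 0"
    using k v eqv_fstar[OF U_p_zero[of k w v]] by (intro eqv_zero_mult U_mems) auto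
  finally show ?thesis .
qed

lemma sum_verts_single:
  assumes "v \<in> verts E" "f v \<in> F" "\<And>w. \<lbrakk>w \<in> verts E; w \<noteq> v\<rbrakk> \<Longrightarrow> f w \<doteq> 0"
  shows "(\<Sum>w\<in>verts E. f w) \<doteq> f v"
  using assms by (intro eqv_sum_single) simp_all

text \<open>Besides giving \<open>u_p\<close> for the sum, this is the check that u_(k,v), sent to
  u_k p_v and back, is recovered.\<close>

lemma sum_U_p:
  assumes "k \<in> carrier K" "v \<in> verts E" shows "(\<Sum>w\<in>verts E. U k w) * p v \<doteq> U k v"
proof -
  have "(\<Sum>w\<in>verts E. U k w * p v) \<doteq> U k v * p v"
    using assms by (intro sum_verts_single U_p_zero U_mems)
  also have "\<dots> \<doteq> U k v" using assms by (rule U_p)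
  finally show ?thesis by (simp add: sum_distrib_right)
qed

lemma p_sum_U:
  assumes "k \<in> carrier K" "v \<in> verts E" shows "p (\<sigma>0 k v) * (\<Sum>w\<in>verts E. U k w) \<doteq> U k v"
proof -
  have "(\<Sum>w\<in>verts E. p (\<sigma>0 k v) * U k w) \<doteq> p (\<sigma>0 k v) * U k v"
    using assms by (intro sum_verts_single p_U_zero U_mems) (auto simp: \<sigma>0_inj)
  also have "\<dots> \<doteq> U k v" using assms by (rule p_U)
  finally show ?thesis by (simp add: sum_distrib_left)
qed

theorem exel_pardo_family: "exel_pardo_family F N E p s K \<sigma>0 \<sigma>1 \<phi> (\<lambda>k. \<Sum>v\<in>verts E. U k v)"
proof
  let ?u = "\<lambda>k. \<Sum>v\<in>verts E. U k v"
  fix k assume k: "k \<in> carrier K"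
  have "fstar (?u k) * ?u k = (\<Sum>w\<in>verts E. \<Sum>v\<in>verts E. fstar (U k v) * U k w)"
    by (subst sum.swap) (simp add: fstar_sum sum_product)
  also have "\<dots> \<doteq> (\<Sum>w\<in>verts E. fstar (U k w) * U k w)"
    using k by (intro eqv_sum sum_verts_single[where f = "\<lambda>v. fstar (U k v) * U k _"] star_U_U_zero U_mems)
  also have "\<dots> \<doteq> (\<Sum>w\<in>verts E. p w)" using k by (intro eqv_sum U_initial)
  also note p_sum
  finally show "fstar (?u k) * ?u k \<doteq> 1" .
  have "?u k * fstar (?u k) = (\<Sum>w\<in>verts E. \<Sum>v\<in>verts E. U k v * fstar (U k w))"
    by (subst sum.swap) (simp add: fstar_sum sum_product)
  also have "\<dots> \<doteq> (\<Sum>w\<in>verts E. U k w * fstar (U k w))"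
    using k by (intro eqv_sum sum_verts_single[where f = "\<lambda>v. U k v * fstar (U k _)"] U_star_U_zero U_mems)
  also have "\<dots> \<doteq> (\<Sum>w\<in>verts E. p (\<sigma>0 k w))" using k by (intro eqv_sum U_final)
  also have "\<dots> = (\<Sum>w\<in>verts E. p w)"
    using k by (intro sum.reindex_bij_betw) (simp add: bij_betw_def vertex_action.inj_prop vertex_action.surj_prop)
  also note p_sum
  finally show "?u k * fstar (?u k) \<doteq> 1" .
  show "?u k * p v \<doteq> p (\<sigma>0 k v) * ?u k" if v: "v \<in> verts E" for v
    using sum_U_p[OF k v] eqv_sym[OF p_sum_U[OF k v]] by (rule eqv_trans)
  show "?u (k \<otimes> l) \<doteq> ?u k * ?u l" if l: "l \<in> carrier K" for l
  proof -
    have "?u k * ?u l = (\<Sum>v\<in>verts E. \<Sum>w\<in>verts E. U k w * U l v)"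
      by (subst sum.swap) (simp add: sum_product)
    also have "\<dots> \<doteq> (\<Sum>v\<in>verts E. U k (\<sigma>0 l v) * U l v)"
      using k l by (intro eqv_sum sum_verts_single[where f = "\<lambda>w. U k w * U l _"] U_mult_zero U_mems)
    also have "\<dots> \<doteq> (\<Sum>v\<in>verts E. U (k \<otimes> l) v)" using k l by (intro eqv_sum U_mult)
    finally show ?thesis by (rule eqv_sym)
  qed
  fix e assume e: "e \<in> arcs E"
  let ?f = "\<sigma>1 k e" and ?c = "\<phi> k e"
  have "?u k * s e = (\<Sum>v\<in>verts E. U k v * s e)" by (simp add: sum_distrib_right)
  also have "\<dots> \<doteq> U k (head E e) * s e"
    using k e by (intro sum_verts_single[where f = "\<lambda>v. U k v * s e"] U_s_zero U_mems)
  also have "\<dots> \<doteq> s ?f * U ?c (tail E e)" using k e by (rule U_s)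
  \<comment> \<open>The single term is recovered from the whole sum by a vertex projection. Since
    \<open>\<phi> k e\<close> and \<open>k\<close> act alike on vertices, this projection sits at
    the source of \<open>?f\<close> and is absorbed by \<open>s ?f\<close>.\<close>
  also have "\<dots> \<doteq> s ?f * (p (\<sigma>0 ?c (tail E e)) * ?u ?c)"
    using k e by (intro eqv_mult_left eqv_sym[OF p_sum_U] U_mems)
  also have "\<dots> = s ?f * p (tail E ?f) * ?u ?c"
    using k e by (simp add: tail_equivariant cocycle_vertex mult.assoc)
  also have "\<dots> \<doteq> s ?f * ?u ?c" using k e by (intro eqv_mult_right s_p_tail U_mems)
  finally show "?u k * s e \<doteq> s ?f * ?u ?c" .
qed

end

section \<open>The action of the transformation groupoid\<close>

context path_extension
begin

abbreviation "G \<equiv> transformation_groupoid K (verts E) \<sigma>0"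
abbreviation "\<alpha> \<equiv> transformation_act E \<sigma>0 \<sigma>s"

lemma transformation_groupoid_simps:
  "arr G = carrier K \<times> verts E" "obj G = verts E" "dm G (k, v) = v" "cd G (k, v) = \<sigma>0 k v"
  "cmp G (k, w) (l, v) = (k \<otimes> l, v)" "idn G v = (\<one>, v)"
  by (simp_all add: transformation_groupoid_def)

lemma app_transformation_act: "\<mu> \<in> paths_from E v \<Longrightarrow> app \<alpha> (k, v) \<mu> = \<sigma>s k \<mu>"
  by (simp add: app_def transformation_act_def)

lemma path_closed: "\<lbrakk>k \<in> carrier K; \<mu> \<in> paths E\<rbrakk> \<Longrightarrow> \<sigma>s k \<mu> \<in> paths E"
  using path_action.element_image by blast

lemma vertex_one: "v \<in> verts E \<Longrightarrow> \<sigma>0 \<one> v = v"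
  using vertex_action.id_eq_one by (metis restrict_apply')

lemma path_one: "\<mu> \<in> paths E \<Longrightarrow> \<sigma>s \<one> \<mu> = \<mu>"
  using path_action.id_eq_one by (metis restrict_apply')

lemma vertex_inv: "\<lbrakk>k \<in> carrier K; v \<in> verts E\<rbrakk> \<Longrightarrow> \<sigma>0 (inv k) (\<sigma>0 k v) = v"
  using vertex_action.composition_rule[of v "inv k" k] by (simp add: vertex_one)

lemma path_inv: "\<lbrakk>k \<in> carrier K; \<mu> \<in> paths E\<rbrakk> \<Longrightarrow> \<sigma>s (inv k) (\<sigma>s k \<mu>) = \<mu>"
  using path_action.composition_rule[of \<mu> "inv k" k] by (simp add: path_one)

lemma paths_from_closed:
  "\<lbrakk>k \<in> carrier K; \<mu> \<in> paths_from E v\<rbrakk> \<Longrightarrow> \<sigma>s k \<mu> \<in> paths_from E (\<sigma>0 k v)"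
  by (auto simp: paths_from_def path_closed act_rng)

lemma edge_path_from: "e \<in> edges_from E v \<Longrightarrow> edge_path E e \<in> paths_from E v"
  by (auto simp: edges_from_def paths_from_def edge_path_closed) (simp add: edge_path_def rng_def)

lemma cat_from:
  "\<lbrakk>\<mu> \<in> paths_from E v; \<nu> \<in> paths_from E (src E \<mu>)\<rbrakk> \<Longrightarrow> cat \<mu> \<nu> \<in> paths_from E v"
  by (auto simp: paths_from_def rng_cat intro: cat_closed)

lemma partial_iso_act:
  assumes k: "k \<in> carrier K" and v: "v \<in> verts E"
  shows "partial_iso E v (\<sigma>0 k v) (\<sigma>s k)"
proof -
  have inv: "\<sigma>s k (\<sigma>s (inv k) \<mu>) = \<mu>" if "\<mu> \<in> paths E" for \<mu>
    using path_inv[of "inv k" \<mu>] k that by simp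
  have bwd: "\<sigma>s (inv k) \<mu> \<in> paths_from E v" if "\<mu> \<in> paths_from E (\<sigma>0 k v)" for \<mu>
    using paths_from_closed[of "inv k" \<mu> "\<sigma>0 k v"] k v that by (simp add: vertex_inv)
  have "\<exists>f\<in>edges_from E (src E (\<sigma>s k \<mu>)). \<sigma>s k (cat \<mu> (edge_path E e)) = cat (\<sigma>s k \<mu>) (edge_path E f)"
    if \<mu>: "\<mu> \<in> paths_from E v" and e: "e \<in> edges_from E (src E \<mu>)" for \<mu> e
  proof (rule bexI)
    have \<mu>': "\<mu> \<in> paths E" using \<mu> by (simp add: paths_from_def)
    have e': "e \<in> arcs E" "head E e = src E \<mu>" using e by (auto simp: edges_from_def)
    have c: "\<phi>s k \<mu> \<in> carrier K" using k \<mu>' by (rule coc_closed)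
    \<comment> \<open>The appended edge is moved by \<open>\<phi>s k \<mu>\<close> rather than by
      \<open>k\<close>; it still attaches to \<open>\<sigma>s k \<mu>\<close> because both act alike
      on vertices.\<close>
    show "\<sigma>1 (\<phi>s k \<mu>) e \<in> edges_from E (src E (\<sigma>s k \<mu>))"
      using c k e' \<mu>' src_closed[OF \<mu>']
      by (simp add: edges_from_def e_closed head_equivariant coc_vertex act_src)
    show "\<sigma>s k (cat \<mu> (edge_path E e)) = cat (\<sigma>s k \<mu>) (edge_path E (\<sigma>1 (\<phi>s k \<mu>) e))"
      using act_cat[OF k \<mu>', of "edge_path E e"] edge_path_from[OF e] c e'
      by (simp add: act_edge paths_from_def)
  qed
  then show ?thesis
    unfolding partial_iso_def using k
    by (intro conjI allI ballI bij_betw_byWitness[where f' = "\<sigma>s (inv k)"])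
      (auto simp: path_inv inv bwd paths_from_closed act_len, auto simp: paths_from_def path_inv inv act_len)
qed

text \<open>Arrows of \<open>PIso E\<close> carry extensional maps. The edge condition evaluates the
  map at an extended path, which still starts at v, so restriction does not affect it.\<close>

lemma partial_iso_restrict:
  assumes "partial_iso E v w g" shows "partial_iso E v w (restrict g (paths_from E v))"
proof -
  have "cat \<mu> (edge_path E e) \<in> paths_from E v"
    if "\<mu> \<in> paths_from E v" "e \<in> edges_from E (src E \<mu>)" for \<mu> e
    using that by (intro cat_from edge_path_from)
  moreover have "bij_betw (restrict g (paths_from E v)) {\<mu> \<in> paths_from E v. len \<mu> = n} B \<longleftrightarrow>
      bij_betw g {\<mu> \<in> paths_from E v. len \<mu> = n} B" for n B
    by (rule bij_betw_cong) simp
  ultimately show ?thesis using assms by (simp add: partial_iso_def)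
qed

theorem groupoid_action: "groupoid_action G E \<alpha>"
proof (intro groupoid_action.intro groupoid_hom.intro groupoid_hom_axioms.intro groupoid_action_axioms.intro)
  show "groupoid G" using vertex_action.group_action_axioms by (rule transformation_groupoid)
  show "groupoid (PIso E)" by (rule groupoid_PIso)
  show "obj G = verts E" by (simp add: transformation_groupoid_simps)
  show "\<alpha> (idn G v) = idn (PIso E) v" if "v \<in> obj G" for v
    using that by (auto simp: transformation_groupoid_simps transformation_act_def PIso_def vertex_one
        path_one paths_from_def fun_eq_iff)
  fix g assume g: "g \<in> arr G"
  obtain k w where gk: "g = (k, w)" and k: "k \<in> carrier K" and w: "w \<in> verts E"
    using g by (auto simp: transformation_groupoid_simps)
  show "\<alpha> g \<in> arr (PIso E)"
    using partial_iso_restrict[OF partial_iso_act[OF k w]] k w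
    by (simp add: gk transformation_act_def PIso_def v_closed)
  fix h assume h: "h \<in> arr G" and gh: "dm G g = cd G h"
  obtain l v where hl: "h = (l, v)" and l: "l \<in> carrier K" and v: "v \<in> verts E" and w_eq: "w = \<sigma>0 l v"
    using h gh by (auto simp: transformation_groupoid_simps gk)
  have "\<sigma>s (k \<otimes> l) \<mu> = \<sigma>s k (\<sigma>s l \<mu>)" if "\<mu> \<in> paths_from E v" for \<mu>
    using k l that by (auto simp: paths_from_def intro: path_action.composition_rule)
  then show "dm (PIso E) (\<alpha> g) = cd (PIso E) (\<alpha> h) \<and> \<alpha> (cmp G g h) = cmp (PIso E) (\<alpha> g) (\<alpha> h)"
    using k l v
    by (auto simp: gk hl w_eq transformation_groupoid_simps transformation_act_def PIso_def compose_def
        vertex_action.composition_rule paths_from_closed fun_eq_iff)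
qed

text \<open>The factorisation is \<open>act_cat\<close>; that the restriction ends at the source of
  the moved path is \<open>act_src\<close> combined with \<open>coc_vertex\<close>.\<close>

theorem restriction:
  assumes k: "k \<in> carrier K" and v: "v \<in> verts E" and \<mu>: "\<mu> \<in> paths_from E v"
  shows "is_restriction G E \<alpha> (k, v) \<mu> (\<phi>s k \<mu>, src E \<mu>)"
  unfolding is_restriction_def
proof (intro conjI ballI)
  have \<mu>': "\<mu> \<in> paths E" using \<mu> by (simp add: paths_from_def)
  note c = coc_closed[OF k \<mu>'] src_closed[OF \<mu>']
  show "(\<phi>s k \<mu>, src E \<mu>) \<in> arr G" using c by (simp add: transformation_groupoid_simps)
  show "dm G (\<phi>s k \<mu>, src E \<mu>) = src E \<mu>" by (simp add: transformation_groupoid_simps)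
  show "cd G (\<phi>s k \<mu>, src E \<mu>) = src E (app \<alpha> (k, v) \<mu>)"
    using k c \<mu>' \<mu> by (simp add: transformation_groupoid_simps app_transformation_act act_src coc_vertex)
  fix \<nu> assume \<nu>: "\<nu> \<in> paths_from E (src E \<mu>)"
  then show "app \<alpha> (k, v) (cat \<mu> \<nu>) = cat (app \<alpha> (k, v) \<mu>) (app \<alpha> (\<phi>s k \<mu>, src E \<mu>) \<nu>)"
    using act_cat[OF k \<mu>', of \<nu>] \<mu> cat_from[OF \<mu> \<nu>]
    by (simp add: app_transformation_act) (simp add: paths_from_def)
qed

theorem self_similar_groupoid_action:
  assumes "faithful G \<alpha>" shows "self_similar_groupoid_action G E \<alpha>"
proof (intro self_similar_groupoid_action.intro groupoid_action self_similar_groupoid_action_axioms.intro assms)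
  fix g e assume g: "g \<in> arr G" and e: "e \<in> edges_from E (dm G g)"
  obtain k v where "g = (k, v)" by (cases g)
  then show "\<exists>h. is_restriction G E \<alpha> g (edge_path E e) h"
    using restriction[of k v "edge_path E e"] edge_path_from[of e v] g e
    by (auto simp: transformation_groupoid_simps)
qed

lemma edge_act_transformation:
  assumes "k \<in> carrier K" "e \<in> arcs E" shows "edge_act E \<alpha> (k, head E e) e = \<sigma>1 k e"
proof -
  have "app \<alpha> (k, head E e) (edge_path E e) = edge_path E (\<sigma>1 k e)"
    using assms edge_path_from[of e "head E e"] by (simp add: app_transformation_act act_edge edges_from_def)
  then show ?thesis by (simp add: edge_act_def edge_path_def)
qed

text \<open>\<open>edge_restr\<close> is a definite description. Faithfulness makes restrictions
  unique, so the explicit one from \<open>restriction\<close> is the one described.\<close>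

lemma edge_restr_transformation:
  assumes "faithful G \<alpha>" "k \<in> carrier K" "e \<in> arcs E"
  shows "edge_restr G E \<alpha> (k, head E e) e = (\<phi> k e, tail E e)"
proof -
  interpret S: self_similar_groupoid_action G E \<alpha> using assms(1) by (rule self_similar_groupoid_action)
  have e: "e \<in> edges_from E (head E e)" using assms by (simp add: edges_from_def)
  have "is_restriction G E \<alpha> (k, head E e) (edge_path E e) (\<phi> k e, tail E e)"
    using restriction[OF assms(2) _ edge_path_from[OF e]] assms by (simp add: coc_edge)
  moreover have "is_restriction G E \<alpha> (k, head E e) (edge_path E e) (edge_restr G E \<alpha> (k, head E e) e)"
    using assms e by (intro S.edge_restr) (simp_all add: transformation_groupoid_simps)
  ultimately show ?thesis by (rule S.restriction_unique[rotated])
qed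

end

section \<open>The isomorphism\<close>

fun to_exel_pardo :: "('k \<times> 'v, 'v, 'e) ck_gen \<Rightarrow> ('k, 'v, 'e) ck_gen falg" where
  "to_exel_pardo (UGen (k, v)) = gU k * gP v"
| "to_exel_pardo (PGen v) = gP v"
| "to_exel_pardo (SGen e) = gS e"

fun to_groupoid :: "'v set \<Rightarrow> ('k, 'v, 'e) ck_gen \<Rightarrow> ('k \<times> 'v, 'v, 'e) ck_gen falg" where
  "to_groupoid V (UGen k) = (\<Sum>v\<in>V. gU (k, v))"
| "to_groupoid V (PGen v) = gP v"
| "to_groupoid V (SGen e) = gS e"

lemmas subst_simps = subst_add subst_mult subst_fstar subst_sum

lemma (in ck_family) subst_ck_relations:
  assumes "(x, y) \<in> ck_relations E" "\<And>v. f (PGen v) = p v" "\<And>e. f (SGen e) = s e"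
  shows "subst f x \<doteq> subst f y"
  using assms unfolding ck_relations_def
  by (auto simp: subst_simps intro: p_idem p_star p_orth s_partial_isometry s_initial p_range p_sum)

section \<open>The universal generators as families modulo the universal seminorm\<close>

lemma ck_family_universal:
  fixes X :: "('g, 'v, 'e) ck_gen set"
  assumes "bounded_presentation X R" "fin_digraph E" "ck_relations E \<subseteq> R"
  shows "ck_family (free_algebra X) (universal_seminorm X R) E gP gS"
proof -
  interpret bounded_presentation X R by (rule assms)
  have rel: "eqv x y" if "(x, y) \<in> ck_relations E" for x y
    using that assms(3) by (intro eqv_relation) auto
  show ?thesis
    by (intro ck_family.intro ck_family_axioms.intro assms(2) star_seminorm_axioms rel)
      (auto simp: ck_relations_def)
qed

lemma (in self_similar_group) exel_pardo_family_universal: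
  assumes "fin_digraph E"
  shows "exel_pardo_family (free_algebra (ck_generators (carrier K) E))
    (universal_seminorm (ck_generators (carrier K) E) (exel_pardo_relations K E \<sigma>0 \<sigma>1 \<phi>))
    E gP gS K \<sigma>0 \<sigma>1 \<phi> gU"
proof -
  let ?X = "ck_generators (carrier K) E :: ('k, 'v, 'e) ck_gen set" and ?R = "exel_pardo_relations K E \<sigma>0 \<sigma>1 \<phi>"
  interpret bounded_presentation ?X ?R by (rule exel_pardo_presentation)
  interpret ck_family "free_algebra ?X" "universal_seminorm ?X ?R" E gP gS
    using bounded_presentation_axioms assms
    by (rule ck_family_universal) (auto simp: exel_pardo_relations_def)
  show ?thesis
    by (intro exel_pardo_family.intro exel_pardo_family_axioms.intro ck_family_axioms
        self_similar_group_axioms eqv_relation; unfold exel_pardo_relations_def; blast)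
qed

lemma groupoid_relations_intros:
  "g \<in> arr H \<Longrightarrow> (gU g * fstar (gU g) * gU g, gU g) \<in> groupoid_relations H E \<beta>"
  "g \<in> arr H \<Longrightarrow> (fstar (gU g) * gU g, gU (idn H (dm H g))) \<in> groupoid_relations H E \<beta>"
  "g \<in> arr H \<Longrightarrow> (gU g * fstar (gU g), gU (idn H (cd H g))) \<in> groupoid_relations H E \<beta>"
  "\<lbrakk>g \<in> arr H; h \<in> arr H; dm H g = cd H h\<rbrakk> \<Longrightarrow> (gU g * gU h, gU (cmp H g h)) \<in> groupoid_relations H E \<beta>"
  "\<lbrakk>g \<in> arr H; h \<in> arr H; dm H g \<noteq> cd H h\<rbrakk> \<Longrightarrow> (gU g * gU h, 0) \<in> groupoid_relations H E \<beta>"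
  "v \<in> verts E \<Longrightarrow> (gU (idn H v), gP v) \<in> groupoid_relations H E \<beta>"
  "\<lbrakk>g \<in> arr H; e \<in> arcs E; dm H g = head E e\<rbrakk> \<Longrightarrow>
    (gU g * gS e, gS (edge_act E \<beta> g e) * gU (edge_restr H E \<beta> g e)) \<in> groupoid_relations H E \<beta>"
  "\<lbrakk>g \<in> arr H; e \<in> arcs E; dm H g \<noteq> head E e\<rbrakk> \<Longrightarrow> (gU g * gS e, 0) \<in> groupoid_relations H E \<beta>"
  by (simp only: groupoid_relations_def Un_iff mem_Collect_eq; blast)+

context path_extension
begin

lemma groupoid_family_universal:
  assumes fin: "fin_digraph E" and faithful: "faithful G \<alpha>"
  shows "groupoid_family (free_algebra (ck_generators (arr G) E))
    (universal_seminorm (ck_generators (arr G) E) (groupoid_relations G E \<alpha>))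
    E gP gS K \<sigma>0 \<sigma>1 \<phi> (\<lambda>k v. gU (k, v))"
proof -
  let ?X = "ck_generators (arr G) E :: ('k \<times> 'v, 'v, 'e) ck_gen set" and ?R = "groupoid_relations G E \<alpha>"
  interpret S: self_similar_groupoid_action G E \<alpha> using faithful by (rule self_similar_groupoid_action)
  interpret X: bounded_presentation ?X ?R using wf_digraph by (rule S.groupoid_presentation)
  have ck: "ck_family (free_algebra ?X) (universal_seminorm ?X ?R) E gP gS"
    using X.bounded_presentation_axioms fin
    by (rule ck_family_universal) (auto simp: groupoid_relations_def)
  have arr: "(k, v) \<in> arr G" if "k \<in> carrier K" "v \<in> verts E" for k v
    using that by (simp add: transformation_groupoid_simps)
  note rel = groupoid_relations_intros[where H = G and E = E and \<beta> = \<alpha>, THEN X.eqv_relation]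
  \<comment> \<open>The relations for initial and final projections speak of u_(1,v), the locale of
    p_v; this congruence passes between them.\<close>
  have unit: "X.eqv (gU (\<one>, v)) (gP v)" if "v \<in> verts E" for v
    using rel(6)[OF that] by (simp add: transformation_groupoid_simps)
  show ?thesis
  proof (intro groupoid_family.intro groupoid_family_axioms.intro ck self_similar_group_axioms)
    fix v assume v: "v \<in> verts E"
    show "X.eqv (gU (\<one>, v)) (gP v)" using v by (rule unit)
    fix k assume k: "k \<in> carrier K"
    note g = arr[OF k v]
    show "X.eqv (gU (k, v) * fstar (gU (k, v)) * gU (k, v)) (gU (k, v))" using g by (rule rel(1))
    show "X.eqv (fstar (gU (k, v)) * gU (k, v)) (gP v)"
      using X.eqv_trans[OF rel(2)[OF g]] unit[OF v] by (simp add: transformation_groupoid_simps)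
    show "X.eqv (gU (k, v) * fstar (gU (k, v))) (gP (\<sigma>0 k v))"
      using X.eqv_trans[OF rel(3)[OF g]] unit[OF v_closed[OF k v]] by (simp add: transformation_groupoid_simps)
    show "X.eqv (gU (k, v) * gS e) 0" if "e \<in> arcs E" "v \<noteq> head E e" for e
      using rel(8)[OF g] that by (simp add: transformation_groupoid_simps)
    fix l assume l: "l \<in> carrier K"
    show "X.eqv (gU (k, \<sigma>0 l v) * gU (l, v)) (gU (k \<otimes> l, v))"
      using rel(4)[OF arr[OF k v_closed[OF l v]] arr[OF l v]] by (simp add: transformation_groupoid_simps)
    show "X.eqv (gU (k, w) * gU (l, v)) 0" if "w \<in> verts E" "w \<noteq> \<sigma>0 l v" for w
      using rel(5)[OF arr[OF k that(1)] arr[OF l v]] that by (simp add: transformation_groupoid_simps)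
  next
    fix k e assume k: "k \<in> carrier K" and e: "e \<in> arcs E"
    show "X.eqv (gU (k, head E e) * gS e) (gS (\<sigma>1 k e) * gU (\<phi> k e, tail E e))"
      using rel(7)[OF arr[OF k head_in_verts[OF e]] e] k e
      by (simp add: edge_act_transformation edge_restr_transformation[OF faithful] transformation_groupoid_simps)
  qed
qed

theorem isomorphism:
  assumes fin: "fin_digraph E" and faithful: "faithful G \<alpha>"
  shows "cstar_isomorphic (groupoid_algebra G E \<alpha>) (exel_pardo_algebra K E \<sigma>0 \<sigma>1 \<phi>)"
  unfolding groupoid_algebra_def exel_pardo_algebra_def
proof (rule cstar_isomorphic_presentations)
  let ?X = "ck_generators (arr G) E :: ('k \<times> 'v, 'v, 'e) ck_gen set" and ?R = "groupoid_relations G E \<alpha>"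
  let ?Y = "ck_generators (carrier K) E :: ('k, 'v, 'e) ck_gen set"
  let ?S = "exel_pardo_relations K E \<sigma>0 \<sigma>1 \<phi>"
  interpret S: self_similar_groupoid_action G E \<alpha> using faithful by (rule self_similar_groupoid_action)
  show X: "bounded_presentation ?X ?R" using wf_digraph by (rule S.groupoid_presentation)
  show Y: "bounded_presentation ?Y ?S" by (rule exel_pardo_presentation)
  interpret X: bounded_presentation ?X ?R by (rule X)
  interpret Y: bounded_presentation ?Y ?S by (rule Y)
  \<comment> \<open>Each universal algebra carries both kinds of families: its own by construction,
    the other by translation. The images of generators under \<open>?f\<close> and \<open>?g\<close>
    are the translated families.\<close>
  interpret YF: exel_pardo_family "free_algebra ?Y" "universal_seminorm ?Y ?S" E gP gS K \<sigma>0 \<sigma>1 \<phi> gU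
    using fin by (rule exel_pardo_family_universal)
  interpret YG: groupoid_family "free_algebra ?Y" "universal_seminorm ?Y ?S" E gP gS K \<sigma>0 \<sigma>1 \<phi> "\<lambda>k v. gU k * gP v"
    by (rule YF.groupoid_family)
  interpret XG: groupoid_family "free_algebra ?X" "universal_seminorm ?X ?R" E gP gS K \<sigma>0 \<sigma>1 \<phi> "\<lambda>k v. gU (k, v)"
    using fin faithful by (rule groupoid_family_universal)
  interpret XF: exel_pardo_family "free_algebra ?X" "universal_seminorm ?X ?R" E gP gS K \<sigma>0 \<sigma>1 \<phi>
      "\<lambda>k. \<Sum>v\<in>verts E. gU (k, v)"
    by (rule XG.exel_pardo_family)
  let ?f = "to_exel_pardo :: ('k \<times> 'v, 'v, 'e) ck_gen \<Rightarrow> ('k, 'v, 'e) ck_gen falg"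
  let ?g = "to_groupoid (verts E) :: ('k, 'v, 'e) ck_gen \<Rightarrow> ('k \<times> 'v, 'v, 'e) ck_gen falg"
  have X_cases: thesis if "a \<in> ?X" "\<And>k v. \<lbrakk>a = UGen (k, v); k \<in> carrier K; v \<in> verts E\<rbrakk> \<Longrightarrow> thesis"
    "\<And>v. \<lbrakk>a = PGen v; v \<in> verts E\<rbrakk> \<Longrightarrow> thesis" "\<And>e. \<lbrakk>a = SGen e; e \<in> arcs E\<rbrakk> \<Longrightarrow> thesis" for a thesis
    using that by (auto simp: ck_generators_def transformation_groupoid_simps)
  have Y_cases: thesis if "b \<in> ?Y" "\<And>k. \<lbrakk>b = UGen k; k \<in> carrier K\<rbrakk> \<Longrightarrow> thesis"
    "\<And>v. \<lbrakk>b = PGen v; v \<in> verts E\<rbrakk> \<Longrightarrow> thesis" "\<And>e. \<lbrakk>b = SGen e; e \<in> arcs E\<rbrakk> \<Longrightarrow> thesis" for b thesis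
    using that by (auto simp: ck_generators_def)
  show f: "?f a \<in> free_algebra ?Y" if "a \<in> ?X" for a
    by (rule X_cases[OF that]) (simp_all add: YG.U_mem YF.p_mem YF.s_mem)
  show g: "?g b \<in> free_algebra ?X" if "b \<in> ?Y" for b
    by (rule Y_cases[OF that]) (simp_all add: XF.u_mem XG.p_mem XG.s_mem)
  show "X.eqv (subst ?g (?f a)) (gen a)" if "a \<in> ?X" for a
    by (rule X_cases[OF that]) (simp_all add: subst_mult XG.sum_U_p X.eqv_refl XG.p_mem XG.s_mem)
  show "Y.eqv (subst ?f (?g b)) (gen b)" if "b \<in> ?Y" for b
    by (rule Y_cases[OF that])
      (simp_all add: subst_sum YF.mult_p_sum[OF YF.u_mem] Y.eqv_refl YF.p_mem YF.s_mem)
  show "X.eqv (subst ?g x) (subst ?g y)" if "(x, y) \<in> ?S" for x y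
  proof -
    have "(x, y) \<in> ck_relations E \<or> (x, y) \<in> ?S - ck_relations E" using that by blast
    then show ?thesis
    proof
      assume "(x, y) \<in> ck_relations E"
      then show ?thesis by (rule XG.subst_ck_relations) simp_all
    next
      assume "(x, y) \<in> ?S - ck_relations E"
      then show ?thesis
        unfolding exel_pardo_relations_def
        by (auto simp: subst_mult subst_fstar intro: XF.u_mult XF.u_isometry XF.u_coisometry XF.u_s XF.u_p)
    qed
  qed
  show "Y.eqv (subst ?f x) (subst ?f y)" if "(x, y) \<in> ?R" for x y
  proof -
    have "(x, y) \<in> ck_relations E \<or> (x, y) \<in> ?R - ck_relations E" using that by blast
    then show ?thesis
    proof
      assume "(x, y) \<in> ck_relations E"
      then show ?thesis by (rule YF.subst_ck_relations) simp_all
    next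
      assume "(x, y) \<in> ?R - ck_relations E"
      \<comment> \<open>A unit u_(1,v) is sent to u_1 p_v, whereas the locale facts use p_v, so the
        relations that mention units are first restated for u_1 p_v.\<close>
      have unit_idem: "Y.eqv (gU \<one> * gP v * (gU \<one> * gP v)) (gU \<one> * gP v)" if "v \<in> verts E" for v
        using YG.U_mult[OF one_closed one_closed that] that by (simp add: vertex_one)
      have unit_star: "Y.eqv (fstar (gU \<one> * gP v)) (gU \<one> * gP v)" if v: "v \<in> verts E" for v
        using Y.eqv_trans[OF Y.eqv_fstar[OF YG.U_unit[OF v]] Y.eqv_trans[OF YF.p_star[OF v] Y.eqv_sym[OF YG.U_unit[OF v]]]] .
      have initial: "Y.eqv (fstar (gU k * gP v) * (gU k * gP v)) (gU \<one> * gP v)"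
        and final: "Y.eqv (gU k * gP v * fstar (gU k * gP v)) (gU \<one> * gP (\<sigma>0 k v))"
        if "k \<in> carrier K" "v \<in> verts E" for k v
        using Y.eqv_trans[OF YG.U_initial[OF that] Y.eqv_sym[OF YG.U_unit]]
          Y.eqv_trans[OF YG.U_final[OF that] Y.eqv_sym[OF YG.U_unit]] that by (simp_all add: v_closed)
      note facts = unit_idem unit_star initial final YG.U_unit YG.U_partial_isometry YG.U_mult YG.U_mult_zero YG.U_s YG.U_s_zero
      show ?thesis
        using \<open>(x, y) \<in> ?R - ck_relations E\<close> unfolding groupoid_relations_def
        by (auto simp: transformation_groupoid_simps subst_mult subst_fstar edge_act_transformation edge_restr_transformation[OF faithful]
            intro: facts)
    qed
  qed
qed

end

theorem propositionA2:
  fixes K :: "('k, 'm) monoid_scheme" and E :: "('v, 'e) pre_digraph"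
    and \<sigma>0 :: "'k \<Rightarrow> 'v \<Rightarrow> 'v" and \<sigma>1 :: "'k \<Rightarrow> 'e \<Rightarrow> 'e" and \<phi> :: "'k \<Rightarrow> 'e \<Rightarrow> 'k"
    and \<sigma>s :: "'k \<Rightarrow> ('v, 'e) path \<Rightarrow> ('v, 'e) path" and \<phi>s :: "'k \<Rightarrow> ('v, 'e) path \<Rightarrow> 'k"
    and G :: "('k \<times> 'v, 'v) gpd"
    and \<alpha> :: "'k \<times> 'v \<Rightarrow> 'v \<times> (('v, 'e) path \<Rightarrow> ('v, 'e) path) \<times> 'v"
  assumes "self_similar_group K E \<sigma>0 \<sigma>1 \<phi>"
    and "fin_digraph E"
    and "path_extension K E \<sigma>0 \<sigma>1 \<phi> \<sigma>s \<phi>s"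
    and "G = transformation_groupoid K (verts E) \<sigma>0"
    and "\<alpha> = transformation_act E \<sigma>0 \<sigma>s"
  shows "groupoid_action G E \<alpha> \<and>
    (faithful G \<alpha> \<longrightarrow>
       self_similar_groupoid_action G E \<alpha> \<and>
       (\<forall>k\<in>carrier K. \<forall>v\<in>verts E. \<forall>\<mu>\<in>paths_from E v.
          is_restriction G E \<alpha> (k, v) \<mu> (\<phi>s k \<mu>, src E \<mu>)) \<and>
       (no_sources E \<longrightarrow>
          cstar_isomorphic (groupoid_algebra G E \<alpha>) (exel_pardo_algebra K E \<sigma>0 \<sigma>1 \<phi>)))"
proof -
  interpret path_extension K E \<sigma>0 \<sigma>1 \<phi> \<sigma>s \<phi>s by (rule assms(3))
  show ?thesis
    unfolding assms(4,5)
    using groupoid_action self_similar_groupoid_action restriction isomorphism[OF assms(2)] by blast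
qed

end
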